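(* Let $R$ (red points) and $B$ (blue points) be independent Poisson point processes of intensity $1$ on $\mathbb{R}$, and consider the cost functions $f_{\gamma,0}$ (every blue-red edge has cost zero). Then, almost surely, the following holds. (i) For $\gamma\in(-\infty,0)$, there is a unique $(\gamma,0)$-minimal matching, and it is locally infinite and a factor. (ii) For $\gamma=0$, the cost function $f_{0,0}$ is not scale invariant; however, there are uncountably many $(0,0)$-minimal matchings that are not scale invariant. (iii) For $\gamma\in(0,\infty)\cup\{1^+\}\cup\{1^-\}$, there are uncountably many $(\gamma,0)$-minimal matchings.
   Context: A matching $M$ between $R$ (red) and $B$ (blue) is a set of edges $\langle x,y\rangle$, $x\in R$, $y\in B$, with each point in at most one edge. An edge $\langle x,y\rangle$ is red-blue if $x<y$ and blue-red if $y<x$. With cost function $f$, the edge $\langle x,y\rangle$ costs $f(y-x)$, and the cost of a finite matching is the sum over its edges; unmatched points count as infinite cost. For finite $R,B$ an $f$-minimal matching minimizes total cost among the matchings with as few unmatched points as possible. For countable $R,B$, call a finite set $S\subset R\cup B$ admissible for $M$ if it is a union of edges of $M$ and unmatched points; $M$ is $f$-minimal if for every admissible $S$ the restriction $M|_S$ is an $f$-minimal matching between $R\cap S$ and $B\cap S$. The cost functions with $a=0$ are $f_{\gamma,0}(x)=0$ for $x<0$ and, for $x>0$, $f_{\gamma,0}(x)=x^\gamma$ if $\gamma>0$, $f_{0,0}(x)=\log x$, and $f_{\gamma,0}(x)=-x^{\gamma}$ if $\gamma<0$. A $(\gamma,0)$-minimal matching is an $f_{\gamma,0}$-minimal matching.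 $M$ is $(1^+,0)$-minimal (resp. $(1^-,0)$-minimal) if for every admissible $S$, $M|_S$ is $f_{\gamma,0}$-minimal for all $\gamma>1$ (resp. $\gamma<1$) sufficiently close to $1$. For $k>0$, $M_k$ denotes the matching between $kR$ and $kB$ given by $M_k(kx)=kM(x)$ for matched $x$. A cost function $f$ is scale invariant if for all countable (possibly finite) $R,B$, all $f$-minimal $M$ between them and all $k>0$, $M_k$ is $f$-minimal between $kR$ and $kB$. An $f$-minimal matching $M$ is not scale invariant if $M_k$ fails to be $f$-minimal between $kR$ and $kB$ for some $k>0$. An edge $\langle x,y\rangle$ crosses $z\in\mathbb{R}$ if $x<z<y$ or $y<z<x$. A matching is locally finite if every $z\in\mathbb{R}$ is crossed by finitely many edges, and locally infinite otherwise. A matching scheme $M$ is invariant if the law of $(R,B,M)$ is invariant under translations of $\mathbb{R}$; it is a factor if it is invariant and $M$ is a deterministic function of $(R,B)$. *)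

theory Defs
  imports "HOL-Probability.Probability"
begin

section \<open>Matchings of red and blue points of the line\<close>

text \<open>An edge is an ordered pair whose first component is the red endpoint and whose second
  component is the blue endpoint; it is red-blue if \<open>fst e < snd e\<close>, blue-red if \<open>snd e < fst e\<close>.\<close>

type_synonym edge = "real \<times> real"

definition endpoints :: "edge \<Rightarrow> real set" where
  "endpoints e = {fst e, snd e}"

definition matching :: "real set \<Rightarrow> real set \<Rightarrow> edge set \<Rightarrow> bool" where
  "matching R B M \<longleftrightarrow>
     M \<subseteq> R \<times> B \<and>
     (\<forall>z. \<forall>e\<in>M. \<forall>e'\<in>M. z \<in> endpoints e \<and> z \<in> endpoints e' \<longrightarrow> e = e')"

definition unmatched :: "real set \<Rightarrow> real set \<Rightarrow> edge set \<Rightarrow> real set" where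
  "unmatched R B M = (R \<union> B) - (\<Union>e\<in>M. endpoints e)"

definition total_cost :: "(real \<Rightarrow> real) \<Rightarrow> edge set \<Rightarrow> real" where
  "total_cost f M = (\<Sum>(x, y)\<in>M. f (y - x))"

text \<open>The next two notions are meaningful for finite \<open>R\<close> and \<open>B\<close> only.\<close>

definition fewest_unmatched :: "real set \<Rightarrow> real set \<Rightarrow> edge set \<Rightarrow> bool" where
  "fewest_unmatched R B = is_arg_min (\<lambda>M. card (unmatched R B M)) (matching R B)"

definition finite_minimal :: "(real \<Rightarrow> real) \<Rightarrow> real set \<Rightarrow> real set \<Rightarrow> edge set \<Rightarrow> bool" where
  "finite_minimal f R B = is_arg_min (total_cost f) (fewest_unmatched R B)"

definition admissible :: "real set \<Rightarrow> real set \<Rightarrow> edge set \<Rightarrow> real set \<Rightarrow> bool" where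
  "admissible R B M S \<longleftrightarrow>
     finite S \<and> (\<exists>E\<subseteq>M. \<exists>U\<subseteq>unmatched R B M. S = (\<Union>e\<in>E. endpoints e) \<union> U)"

definition restrict_matching :: "edge set \<Rightarrow> real set \<Rightarrow> edge set" where
  "restrict_matching M S = {e \<in> M. endpoints e \<subseteq> S}"

text \<open>For finite \<open>R\<close> and \<open>B\<close> this agrees with \<^const>\<open>finite_minimal\<close>: the whole of
  \<open>R \<union> B\<close> is then admissible, and conversely an improvement of \<open>M\<close> on an admissible set
  is an improvement of \<open>M\<close>.\<close>

definition minimal_matching :: "(real \<Rightarrow> real) \<Rightarrow> real set \<Rightarrow> real set \<Rightarrow> edge set \<Rightarrow> bool" where
  "minimal_matching f R B M \<longleftrightarrow>
     matching R B M \<and>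
     (\<forall>S. admissible R B M S \<longrightarrow> finite_minimal f (R \<inter> S) (B \<inter> S) (restrict_matching M S))"

text \<open>\<open>cost \<gamma>\<close> is the cost function \<open>f\<close> with parameters \<open>\<gamma>\<close> and \<open>a = 0\<close>. The value at \<open>0\<close> is
  a convention; it plays no role as long as \<open>R\<close> and \<open>B\<close> are disjoint.\<close>

definition cost :: "real \<Rightarrow> real \<Rightarrow> real" where
  "cost \<gamma> x =
     (if x \<le> 0 then 0
      else if \<gamma> > 0 then x powr \<gamma>
      else if \<gamma> = 0 then ln x
      else - (x powr \<gamma>))"

definition gamma_minimal :: "real \<Rightarrow> real set \<Rightarrow> real set \<Rightarrow> edge set \<Rightarrow> bool" where
  "gamma_minimal \<gamma> = minimal_matching (cost \<gamma>)"

text \<open>In the following two definitions, how close \<open>\<gamma>\<close> must be to \<open>1\<close> may depend on \<open>S\<close>.\<close>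

definition one_plus_minimal :: "real set \<Rightarrow> real set \<Rightarrow> edge set \<Rightarrow> bool" where
  "one_plus_minimal R B M \<longleftrightarrow>
     matching R B M \<and>
     (\<forall>S. admissible R B M S \<longrightarrow>
        (\<forall>\<^sub>F \<gamma> in at_right 1.
           finite_minimal (cost \<gamma>) (R \<inter> S) (B \<inter> S) (restrict_matching M S)))"

definition one_minus_minimal :: "real set \<Rightarrow> real set \<Rightarrow> edge set \<Rightarrow> bool" where
  "one_minus_minimal R B M \<longleftrightarrow>
     matching R B M \<and>
     (\<forall>S. admissible R B M S \<longrightarrow>
        (\<forall>\<^sub>F \<gamma> in at_left 1.
           finite_minimal (cost \<gamma>) (R \<inter> S) (B \<inter> S) (restrict_matching M S)))"

definition scale_points :: "real \<Rightarrow> real set \<Rightarrow> real set" where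
  "scale_points k R = (\<lambda>x. k * x) ` R"

definition scale_matching :: "real \<Rightarrow> edge set \<Rightarrow> edge set" where
  "scale_matching k M = (\<lambda>(x, y). (k * x, k * y)) ` M"

definition scale_invariant_matching ::
    "(real \<Rightarrow> real) \<Rightarrow> real set \<Rightarrow> real set \<Rightarrow> edge set \<Rightarrow> bool" where
  "scale_invariant_matching f R B M \<longleftrightarrow>
     (\<forall>k>0. minimal_matching f (scale_points k R) (scale_points k B) (scale_matching k M))"

text \<open>A point has one colour only, so \<open>R\<close> and \<open>B\<close> range over disjoint sets.\<close>

definition scale_invariant_cost :: "(real \<Rightarrow> real) \<Rightarrow> bool" where
  "scale_invariant_cost f \<longleftrightarrow>
     (\<forall>R B M. countable R \<and> countable B \<and> R \<inter> B = {} \<and> minimal_matching f R B M \<longrightarrow>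
        scale_invariant_matching f R B M)"

definition crosses :: "edge \<Rightarrow> real \<Rightarrow> bool" where
  "crosses e z \<longleftrightarrow> fst e < z \<and> z < snd e \<or> snd e < z \<and> z < fst e"

definition locally_finite :: "edge set \<Rightarrow> bool" where
  "locally_finite M \<longleftrightarrow> (\<forall>z. finite {e \<in> M. crosses e z})"

section \<open>Random point configurations and random matchings\<close>

text \<open>The sigma-algebra generated by the counting maps \<open>X \<mapsto> #(X \<inter> A)\<close>, for Borel sets \<open>A\<close>.
  It serves both for sets of points of the line and for matchings, as sets of points
  of the plane.\<close>

definition point_config :: "'a::topological_space set measure" where
  "point_config =
     sigma UNIV {{X. finite (X \<inter> A) \<and> card (X \<inter> A) = n} | A n. A \<in> sets borel}"

text \<open>The finiteness of the counts is part of the condition on their distribution,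
  as the Poisson probabilities sum to \<open>1\<close>.\<close>

definition poisson_process :: "'w measure \<Rightarrow> real \<Rightarrow> ('w \<Rightarrow> real set) \<Rightarrow> bool" where
  "poisson_process P l X \<longleftrightarrow>
     X \<in> P \<rightarrow>\<^sub>M point_config \<and>
     (\<forall>A\<in>sets borel. emeasure lborel A < \<infinity> \<longrightarrow>
        (\<forall>n. measure P {\<omega> \<in> space P. finite (X \<omega> \<inter> A) \<and> card (X \<omega> \<inter> A) = n} =
             (l * measure lborel A) ^ n / fact n * exp (- (l * measure lborel A)))) \<and>
     (\<forall>(I :: nat set) A. finite I \<and> disjoint_family_on A I \<and>
          (\<forall>i\<in>I. A i \<in> sets borel \<and> emeasure lborel (A i) < \<infinity>) \<longrightarrow>
        prob_space.indep_vars P (\<lambda>_. count_space UNIV) (\<lambda>i \<omega>. card (X \<omega> \<inter> A i)) I)"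

definition shift_points :: "real \<Rightarrow> real set \<Rightarrow> real set" where
  "shift_points t R = (\<lambda>x. x + t) ` R"

definition shift_matching :: "real \<Rightarrow> edge set \<Rightarrow> edge set" where
  "shift_matching t M = (\<lambda>(x, y). (x + t, y + t)) ` M"

definition matching_scheme ::
    "'w measure \<Rightarrow> ('w \<Rightarrow> real set) \<Rightarrow> ('w \<Rightarrow> real set) \<Rightarrow> ('w \<Rightarrow> edge set) \<Rightarrow> bool" where
  "matching_scheme P R B M \<longleftrightarrow>
     M \<in> P \<rightarrow>\<^sub>M point_config \<and> (AE \<omega> in P. matching (R \<omega>) (B \<omega>) (M \<omega>))"

definition invariant_scheme ::
    "'w measure \<Rightarrow> ('w \<Rightarrow> real set) \<Rightarrow> ('w \<Rightarrow> real set) \<Rightarrow> ('w \<Rightarrow> edge set) \<Rightarrow> bool" where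
  "invariant_scheme P R B M \<longleftrightarrow>
     matching_scheme P R B M \<and>
     (\<forall>t. distr P (point_config \<Otimes>\<^sub>M point_config \<Otimes>\<^sub>M point_config)
              (\<lambda>\<omega>. (shift_points t (R \<omega>), shift_points t (B \<omega>), shift_matching t (M \<omega>)))
        = distr P (point_config \<Otimes>\<^sub>M point_config \<Otimes>\<^sub>M point_config)
              (\<lambda>\<omega>. (R \<omega>, B \<omega>, M \<omega>)))"

definition factor_scheme ::
    "'w measure \<Rightarrow> ('w \<Rightarrow> real set) \<Rightarrow> ('w \<Rightarrow> real set) \<Rightarrow> ('w \<Rightarrow> edge set) \<Rightarrow> bool" where
  "factor_scheme P R B M \<longleftrightarrow>
     invariant_scheme P R B M \<and>
     (\<exists>\<Phi> \<in> (point_config \<Otimes>\<^sub>M point_config) \<rightarrow>\<^sub>M point_config.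
        AE \<omega> in P. M \<omega> = \<Phi> (R \<omega>, B \<omega>))"

end

theory Submission
  imports Defs
begin

text \<open>For \<open>\<gamma> < 0\<close> swapping partners in two edges shows that a minimal matching of a recurrent
  configuration has only red-blue edges, no two of which cross; the only such perfect matching is the
  matching of brackets (red opens, blue closes). Conversely, uncrossing an arbitrary matching
  at an innermost pair of brackets never increases the cost. Recurrence of the
  walk counting red minus blue points makes every bracket closed and every point crossed infinitely often.

  For \<open>\<gamma> > 0\<close> every perfect matching consisting of blue-red edges costs nothing, and there are
  uncountably many of these by diagonalisation. For \<open>\<gamma> = 0\<close> only red-blue edges shorter than 1 have
  negative cost. Empty unit intervals cut the line into finite windows that no such edge leaves, so
  an optimal family of short edges can be chosen window by window; the remaining points can be matched
  by blue-red edges in uncountably many ways. Scaling down makes it profitable to match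
  a remaining red point to a remaining blue point on its right.\<close>

section \<open>Minimal matchings and exchanges of partners\<close>

text \<open>Randomness enters only through three deterministic properties of a configuration:
  \<open>points\<close>, \<open>recurrent\<close> and \<open>patterned\<close>. Each holds almost
  surely, and all statements about minimal matchings are proved for a fixed configuration. The
  bracket matching does not mention \<gamma>, so one null set serves uncountably many exponents.
  Recurrence turns local exchanges into a global statement. An unmatched red point or a blue-red
  edge would, by exchanges with all edges ending further right, force every blue point on its right
  to have its partner in between, which leaves no room for a blue surplus there; an unmatched blue
  point is the mirror image. For \<gamma> = 0 the obstacle is the sign change of the logarithm at 1:
  a matching of cost zero need not be minimal, and a total cost over the whole line has no meaning,
  so optimality has to be phrased by finite exchanges. The factor property needs the bracket
  matching to be measurable, although its definition quantifies over uncountably many times;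
  isolating endpoints by rational intervals leaves countably many counts.\<close>

lemma matching_iff:
  assumes "R \<inter> B = {}"
  shows "matching R B M \<longleftrightarrow> M \<subseteq> R \<times> B \<and> inj_on fst M \<and> inj_on snd M"
proof
  assume m: "matching R B M"
  then have "M \<subseteq> R \<times> B" by (simp add: matching_def)
  moreover have "inj_on fst M" "inj_on snd M"
    using m unfolding matching_def inj_on_def endpoints_def by blast+
  ultimately show "M \<subseteq> R \<times> B \<and> inj_on fst M \<and> inj_on snd M" by blast
next
  assume m: "M \<subseteq> R \<times> B \<and> inj_on fst M \<and> inj_on snd M"
  have "e = e'" if "e \<in> M" "e' \<in> M" "z \<in> endpoints e" "z \<in> endpoints e'" for e e' z
  proof -
    have "fst e \<in> R" "snd e \<in> B" "fst e' \<in> R" "snd e' \<in> B" using m that by auto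
    then have "fst e = fst e' \<or> snd e = snd e'"
      using that assms unfolding endpoints_def by auto
    then show ?thesis using m that unfolding inj_on_def by blast
  qed
  then show "matching R B M" unfolding matching_def using m by blast
qed

lemma unmatched_eq:
  assumes "R \<inter> B = {}" "M \<subseteq> R \<times> B"
  shows "unmatched R B M = (R - fst ` M) \<union> (B - snd ` M)"
proof -
  have "fst ` M \<subseteq> R" "snd ` M \<subseteq> B" using assms(2) by auto
  moreover have "(\<Union>e\<in>M. endpoints e) = fst ` M \<union> snd ` M" unfolding endpoints_def by auto
  ultimately show ?thesis unfolding unmatched_def using assms(1) by auto
qed

lemma unmatched_empty_iff:
  assumes "R \<inter> B = {}" "M \<subseteq> R \<times> B"
  shows "unmatched R B M = {} \<longleftrightarrow> fst ` M = R \<and> snd ` M = B"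
  unfolding unmatched_eq[OF assms] using assms(2) by auto

text \<open>A competitor that leaves no more points unmatched than a minimiser is itself among the
  matchings with fewest unmatched points, so counting is enough to make the costs
  comparable.\<close>

lemma finite_minimal_le:
  assumes "finite_minimal f R B M" "matching R B N"
    and "card (unmatched R B N) \<le> card (unmatched R B M)"
  shows "total_cost f M \<le> total_cost f N"
proof -
  have "fewest_unmatched R B N"
    using assms unfolding finite_minimal_def fewest_unmatched_def is_arg_min_def
    by (meson leD leI order_le_less_trans)
  then show ?thesis
    using assms(1) unfolding finite_minimal_def is_arg_min_def by (meson leI)
qed

lemma finite_minimal_card_le:
  assumes "finite_minimal f R B M" "matching R B N"
  shows "card (unmatched R B M) \<le> card (unmatched R B N)"
  using assms unfolding finite_minimal_def fewest_unmatched_def is_arg_min_def by (meson leI)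

lemma finite_minimal_perfectI:
  assumes "finite R" "finite B" "matching R B M" "unmatched R B M = {}"
    and "\<And>N. matching R B N \<Longrightarrow> unmatched R B N = {} \<Longrightarrow> total_cost f M \<le> total_cost f N"
  shows "finite_minimal f R B M"
proof -
  have fin: "finite (unmatched R B N)" for N using assms(1,2) unfolding unmatched_def by simp
  have few: "fewest_unmatched R B M"
    using assms(3,4) unfolding fewest_unmatched_def is_arg_min_def by simp
  moreover have "total_cost f M \<le> total_cost f N" if "fewest_unmatched R B N" for N
  proof -
    have "card (unmatched R B N) \<le> card (unmatched R B M)" "matching R B N"
      using that assms(3) unfolding fewest_unmatched_def is_arg_min_def by (auto intro: leI)
    then show ?thesis using assms(4,5) fin by simp
  qed
  ultimately show ?thesis unfolding finite_minimal_def is_arg_min_def by (auto simp: not_less)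
qed

text \<open>An endpoint of an edge of \<open>M\<close> outside \<open>E\<close> is matched, hence
  not in \<open>U\<close>, and it is no endpoint of an edge of \<open>E\<close>. So \<open>S\<close>
  swallows no further edge, and the problem on \<open>S\<close> is exactly the one with edges
  \<open>E\<close> and spare points \<open>U\<close>.\<close>

lemma admissible_restrict:
  assumes disj: "R \<inter> B = {}" and "matching R B M" and E: "E \<subseteq> M" and U: "U \<subseteq> unmatched R B M"
    and S: "S = (\<Union>e\<in>E. endpoints e) \<union> U"
  shows "R \<inter> S = fst ` E \<union> (R \<inter> U)" "B \<inter> S = snd ` E \<union> (B \<inter> U)" "restrict_matching M S = E"
proof -
  have M: "M \<subseteq> R \<times> B" "inj_on fst M" using assms(2) matching_iff[OF disj] by auto
  have "(\<Union>e\<in>E. endpoints e) = fst ` E \<union> snd ` E" unfolding endpoints_def by auto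
  then have S': "S = fst ` E \<union> snd ` E \<union> U" using S by simp
  have "fst ` E \<subseteq> R" "snd ` E \<subseteq> B" using E M(1) by auto
  then show RS: "R \<inter> S = fst ` E \<union> (R \<inter> U)" and "B \<inter> S = snd ` E \<union> (B \<inter> U)"
    unfolding S' using disj by blast+
  show "restrict_matching M S = E"
  proof
    show "E \<subseteq> restrict_matching M S" using E S unfolding restrict_matching_def by auto
    show "restrict_matching M S \<subseteq> E"
    proof
      fix e assume "e \<in> restrict_matching M S"
      then have e: "e \<in> M" "fst e \<in> S" unfolding restrict_matching_def endpoints_def by auto
      then have "fst e \<in> R" "fst e \<in> fst ` M" using M(1) by auto
      moreover from this have "fst e \<notin> U" using U unmatched_eq[OF disj M(1)] M(1) disj by auto
      ultimately have "fst e \<in> fst ` E" using RS e(2) by blast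
      then show "e \<in> E" using e E M(2) by (auto simp: inj_on_def)
    qed
  qed
qed

text \<open>A perfect matching has no spare points, so admissible sets are the endpoint sets of
  finite families \<open>E\<close>, and the competitors are the rearrangements \<open>N\<close> with
  the same two projections. Every explicit matching below is shown to be minimal through this
  comparison.\<close>

lemma finite_minimal_restrict_perfectI:
  assumes disj: "R \<inter> B = {}" and m: "matching R B M" and "unmatched R B M = {}"
    and "admissible R B M S"
    and cost_le: "\<And>E N. finite E \<Longrightarrow> E \<subseteq> M \<Longrightarrow> inj_on fst N \<Longrightarrow> inj_on snd N \<Longrightarrow>
      fst ` N = fst ` E \<Longrightarrow> snd ` N = snd ` E \<Longrightarrow> total_cost f E \<le> total_cost f N"
  shows "finite_minimal f (R \<inter> S) (B \<inter> S) (restrict_matching M S)"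
proof -
  obtain E where E: "E \<subseteq> M" "S = (\<Union>e\<in>E. endpoints e) \<union> {}" and finS: "finite S"
    using assms(3,4) unfolding admissible_def by auto
  have RS: "R \<inter> S = fst ` E" "B \<inter> S = snd ` E" "restrict_matching M S = E"
    using admissible_restrict[OF disj m E(1) _ E(2)] by auto
  have M: "inj_on fst M" "inj_on snd M" using m matching_iff[OF disj] by auto
  then have inj: "inj_on fst E" "inj_on snd E" using E(1) by (auto intro: inj_on_subset)
  have "finite (fst ` E)" unfolding RS(1)[symmetric] using finS by simp
  then have finE: "finite E" using inj(1) by (rule finite_imageD)
  have d: "fst ` E \<inter> snd ` E = {}" using RS disj by blast
  have sub: "E \<subseteq> fst ` E \<times> snd ` E" by force
  show ?thesis
    unfolding RS
  proof (rule finite_minimal_perfectI)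
    show "matching (fst ` E) (snd ` E) E" using matching_iff[OF d] inj sub by blast
    show "unmatched (fst ` E) (snd ` E) E = {}" using unmatched_empty_iff[OF d sub] by simp
    fix N assume N: "matching (fst ` E) (snd ` E) N" "unmatched (fst ` E) (snd ` E) N = {}"
    then have *: "N \<subseteq> fst ` E \<times> snd ` E" "inj_on fst N" "inj_on snd N"
      using matching_iff[OF d] by auto
    have "fst ` N = fst ` E" "snd ` N = snd ` E"
      using unmatched_empty_iff[OF d *(1)] N(2) by auto
    with *(2,3) show "total_cost f E \<le> total_cost f N" by (rule cost_le[OF finE E(1)])
  qed (use finE in auto)
qed

lemma minimal_matching_finite_minimal:
  assumes disj: "R \<inter> B = {}" and min: "minimal_matching f R B M"
    and "finite E" "E \<subseteq> M" "finite U" "U \<subseteq> unmatched R B M"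
  shows "finite_minimal f (fst ` E \<union> (R \<inter> U)) (snd ` E \<union> (B \<inter> U)) E"
proof -
  have m: "matching R B M" using min unfolding minimal_matching_def by simp
  define S where "S = (\<Union>e\<in>E. endpoints e) \<union> U"
  have "finite S" unfolding S_def endpoints_def using assms by auto
  then have "admissible R B M S" unfolding admissible_def using assms S_def by blast
  then show ?thesis
    using min admissible_restrict[OF disj m assms(4,6) S_def] unfolding minimal_matching_def by force
qed

text \<open>The endpoints of two edges form an admissible set, and exchanging partners is another
  perfect matching of it. From this inequality the shape of minimal matchings is read off.\<close>

lemma minimal_matching_swap:
  assumes disj: "R \<inter> B = {}" and min: "minimal_matching f R B M"
    and e: "(r, b) \<in> M" "(r', b') \<in> M" "r \<noteq> r'"
  shows "f (b - r) + f (b' - r') \<le> f (b' - r) + f (b - r')"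
proof -
  have "matching R B M" using min unfolding minimal_matching_def by simp
  then have M: "M \<subseteq> R \<times> B" "inj_on snd M" using matching_iff[OF disj] by auto
  have bb: "b \<noteq> b'" using M(2) e unfolding inj_on_def by fastforce
  have fm: "finite_minimal f {r, r'} {b, b'} {(r, b), (r', b')}"
    using minimal_matching_finite_minimal[OF disj min, of "{(r, b), (r', b')}" "{}"] e by simp
  have d: "{r, r'} \<inter> {b, b'} = {}" using M(1) e disj by auto
  have "matching {r, r'} {b, b'} {(r, b'), (r', b)}"
    unfolding matching_iff[OF d] using e(3) bb by (auto simp: inj_on_def)
  moreover have "unmatched {r, r'} {b, b'} {(r, b'), (r', b)} = {}"
    by (subst unmatched_empty_iff[OF d]) auto
  ultimately have "total_cost f {(r, b), (r', b')} \<le> total_cost f {(r, b'), (r', b)}"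
    using finite_minimal_le[OF fm] by simp
  then show ?thesis using e(3) by (simp add: total_cost_def)
qed

text \<open>Handing \<open>b\<close> over from \<open>r'\<close> to the unmatched point
  \<open>r\<close> keeps the number of unmatched points at one, so only the costs decide.\<close>

lemma minimal_matching_unmatched_red:
  assumes disj: "R \<inter> B = {}" and min: "minimal_matching f R B M"
    and e: "(r', b) \<in> M" "r \<in> R" "r \<notin> fst ` M"
  shows "f (b - r') \<le> f (b - r)"
proof -
  have "matching R B M" using min unfolding minimal_matching_def by simp
  then have M: "M \<subseteq> R \<times> B" using matching_iff[OF disj] by auto
  have rr: "r \<noteq> r'" using e by force
  have u: "{r} \<subseteq> unmatched R B M" using unmatched_eq[OF disj M] e by simp
  have "R \<inter> {r} = {r}" "B \<inter> {r} = {}" using e(2) disj by auto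
  then have fm: "finite_minimal f {r, r'} {b} {(r', b)}"
    using minimal_matching_finite_minimal[OF disj min, of "{(r', b)}" "{r}"] e(1) u
    by (simp add: insert_commute)
  have d: "{r, r'} \<inter> {b} = {}" using M e(1,2) disj by auto
  have "matching {r, r'} {b} {(r, b)}"
    unfolding matching_iff[OF d] by (auto simp: inj_on_def)
  moreover have "unmatched {r, r'} {b} {(r, b)} = {r'}" "unmatched {r, r'} {b} {(r', b)} = {r}"
    using rr by (subst unmatched_eq[OF d]; auto)+
  ultimately have "total_cost f {(r', b)} \<le> total_cost f {(r, b)}"
    using finite_minimal_le[OF fm] by simp
  then show ?thesis by (simp add: total_cost_def)
qed

lemma minimal_matching_unmatched_blue:
  assumes disj: "R \<inter> B = {}" and min: "minimal_matching f R B M"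
    and e: "(r, b') \<in> M" "b \<in> B" "b \<notin> snd ` M"
  shows "f (b' - r) \<le> f (b - r)"
proof -
  have "matching R B M" using min unfolding minimal_matching_def by simp
  then have M: "M \<subseteq> R \<times> B" using matching_iff[OF disj] by auto
  have bb: "b \<noteq> b'" using e by force
  have u: "{b} \<subseteq> unmatched R B M" using unmatched_eq[OF disj M] e by simp
  have "R \<inter> {b} = {}" "B \<inter> {b} = {b}" using e(2) disj by auto
  then have fm: "finite_minimal f {r} {b, b'} {(r, b')}"
    using minimal_matching_finite_minimal[OF disj min, of "{(r, b')}" "{b}"] e(1) u
    by (simp add: insert_commute)
  have d: "{r} \<inter> {b, b'} = {}" using M e(1,2) disj by auto
  have "matching {r} {b, b'} {(r, b)}"
    unfolding matching_iff[OF d] by (auto simp: inj_on_def)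
  moreover have "unmatched {r} {b, b'} {(r, b)} = {b'}" "unmatched {r} {b, b'} {(r, b')} = {b}"
    using bb by (subst unmatched_eq[OF d]; auto)+
  ultimately have "total_cost f {(r, b')} \<le> total_cost f {(r, b)}"
    using finite_minimal_le[OF fm] by simp
  then show ?thesis by (simp add: total_cost_def)
qed

text \<open>Two unmatched points of different colours form an admissible set with empty restriction;
  joining them lowers the number of unmatched points from 2 to 0, whatever the cost.\<close>

lemma minimal_matching_unmatched_monochromatic:
  assumes disj: "R \<inter> B = {}" and min: "minimal_matching f R B M"
  shows "fst ` M = R \<or> snd ` M = B"
proof (rule ccontr)
  assume "\<not> ?thesis"
  moreover have "matching R B M" using min unfolding minimal_matching_def by simp
  then have M: "M \<subseteq> R \<times> B" using matching_iff[OF disj] by auto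
  ultimately obtain r b where rb: "r \<in> R" "r \<notin> fst ` M" "b \<in> B" "b \<notin> snd ` M" by fastforce
  have u: "{r, b} \<subseteq> unmatched R B M" using unmatched_eq[OF disj M] rb by simp
  have "R \<inter> {r, b} = {r}" "B \<inter> {r, b} = {b}" using rb disj by auto
  then have fm: "finite_minimal f {r} {b} {}"
    using minimal_matching_finite_minimal[OF disj min, of "{}" "{r, b}"] u by simp
  have d: "{r} \<inter> {b} = {}" using rb disj by auto
  have "matching {r} {b} {(r, b)}"
    unfolding matching_iff[OF d] by (auto simp: inj_on_def)
  moreover have "unmatched {r} {b} {(r, b)} = {}" "unmatched {r} {b} {} = {r, b}"
    by (subst unmatched_eq[OF d]; auto)+
  moreover have "card {r, b} = 2" using d by auto
  ultimately show False using finite_minimal_card_le[OF fm] by fastforce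
qed

section \<open>Bracket matchings\<close>

definition locally_finite_points :: "real set \<Rightarrow> bool" where
  "locally_finite_points X \<longleftrightarrow> (\<forall>a b. finite (X \<inter> {a..b}))"

lemma locally_finite_pointsD:
  assumes "locally_finite_points X"
  shows "finite (X \<inter> {a..b})" "finite (X \<inter> {a<..b})" "finite (X \<inter> {a..<b})" "finite (X \<inter> {a<..<b})"
proof -
  have f: "finite (X \<inter> {a..b})" using assms unfolding locally_finite_points_def by blast
  show "finite (X \<inter> {a..b})" "finite (X \<inter> {a<..b})" "finite (X \<inter> {a..<b})" "finite (X \<inter> {a<..<b})"
    by (rule finite_subset[OF _ f]; auto)+
qed

lemma locally_finite_points_iff: "locally_finite_points X \<longleftrightarrow> (\<forall>n::nat. finite (X \<inter> {- real n..real n}))"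
proof safe
  assume fin: "\<forall>n::nat. finite (X \<inter> {- real n..real n})"
  have "finite (X \<inter> {a..b})" for a b
  proof -
    obtain n :: nat where "max \<bar>a\<bar> \<bar>b\<bar> \<le> real n" using real_arch_simple by blast
    then have "X \<inter> {a..b} \<subseteq> X \<inter> {- real n..real n}" by auto
    then show ?thesis using fin finite_subset by blast
  qed
  then show "locally_finite_points X" unfolding locally_finite_points_def by blast
qed (simp add: locally_finite_pointsD)

lemma card_points_split:
  assumes "locally_finite_points X"
  shows "a \<le> b \<Longrightarrow> b \<le> c \<Longrightarrow> card (X \<inter> {a..c}) = card (X \<inter> {a..b}) + card (X \<inter> {b<..c})"
    and "a \<le> b \<Longrightarrow> b \<le> c \<Longrightarrow> card (X \<inter> {a..c}) = card (X \<inter> {a..<b}) + card (X \<inter> {b..c})"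
    and "a \<le> b \<Longrightarrow> b \<le> c \<Longrightarrow> card (X \<inter> {a<..c}) = card (X \<inter> {a<..b}) + card (X \<inter> {b<..c})"
    and "a \<le> b \<Longrightarrow> b < c \<Longrightarrow> card (X \<inter> {a..<c}) = card (X \<inter> {a..<b}) + card (X \<inter> {b..<c})"
proof -
  note f = locally_finite_pointsD[OF assms]
  show "a \<le> b \<Longrightarrow> b \<le> c \<Longrightarrow> card (X \<inter> {a..c}) = card (X \<inter> {a..b}) + card (X \<inter> {b<..c})"
    by (subst card_Un_disjoint[symmetric]) (use f in \<open>auto intro!: arg_cong[where f=card]\<close>)
  show "a \<le> b \<Longrightarrow> b \<le> c \<Longrightarrow> card (X \<inter> {a..c}) = card (X \<inter> {a..<b}) + card (X \<inter> {b..c})"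
    by (subst card_Un_disjoint[symmetric]) (use f in \<open>auto intro!: arg_cong[where f=card]\<close>)
  show "a \<le> b \<Longrightarrow> b \<le> c \<Longrightarrow> card (X \<inter> {a<..c}) = card (X \<inter> {a<..b}) + card (X \<inter> {b<..c})"
    by (subst card_Un_disjoint[symmetric]) (use f in \<open>auto intro!: arg_cong[where f=card]\<close>)
  show "a \<le> b \<Longrightarrow> b < c \<Longrightarrow> card (X \<inter> {a..<c}) = card (X \<inter> {a..<b}) + card (X \<inter> {b..<c})"
    by (subst card_Un_disjoint[symmetric]) (use f in \<open>auto intro!: arg_cong[where f=card]\<close>)
qed

lemma card_points_singleton:
  fixes x :: real
  shows "x \<in> X \<Longrightarrow> card (X \<inter> {x..x}) = 1" "x \<notin> X \<Longrightarrow> card (X \<inter> {x..x}) = 0"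
  by (simp_all add: Int_insert_right)

lemma card_points_mono:
  assumes "locally_finite_points X"
  shows "a' \<le> a \<Longrightarrow> b \<le> b' \<Longrightarrow> card (X \<inter> {a..b}) \<le> card (X \<inter> {a'..b'})"
    and "a' \<le> a \<Longrightarrow> b \<le> b' \<Longrightarrow> card (X \<inter> {a<..b}) \<le> card (X \<inter> {a'<..b'})"
    and "a' \<le> a \<Longrightarrow> b \<le> b' \<Longrightarrow> card (X \<inter> {a..<b}) \<le> card (X \<inter> {a'..<b'})"
  by (rule card_mono; use locally_finite_pointsD[OF assms] in force)+

lemma obtain_last_point_before:
  assumes "locally_finite_points X" "x \<in> X" "x < (y :: real)"
  obtains t where "t \<in> X" "x \<le> t" "t < y" "X \<inter> {t<..<y} = {}"
proof -
  let ?F = "X \<inter> {x..<y}"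
  have F: "finite ?F" "x \<in> ?F" using locally_finite_pointsD[OF assms(1)] assms by auto
  then have "Max ?F \<in> ?F" using Max_in by blast
  moreover have "z \<notin> X \<inter> {Max ?F<..<y}" for z
  proof
    assume z: "z \<in> X \<inter> {Max ?F<..<y}"
    then have "z \<in> ?F" using \<open>Max ?F \<in> ?F\<close> by auto
    then show False using z Max_ge[OF F(1)] by fastforce
  qed
  then have "X \<inter> {Max ?F<..<y} = {}" by blast
  ultimately show ?thesis using that[of "Max ?F"] by simp
qed

text \<open>A red point opens a bracket, and its partner is where the count of red minus blue
  points, started at \<open>r\<close>, first returns to zero. The differences \<open>R - B\<close>
  and \<open>B - R\<close> exclude two-coloured points, which makes the later description by
  rational boxes exact for overlapping colours too.\<close>

definition bracket_matching :: "real set \<Rightarrow> real set \<Rightarrow> edge set" where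
  "bracket_matching R B = {(r, b). r \<in> R - B \<and> b \<in> B - R \<and> r < b \<and>
     card (R \<inter> {r..b}) = card (B \<inter> {r..b}) \<and>
     (\<forall>t. r \<le> t \<longrightarrow> t < b \<longrightarrow> card (B \<inter> {r..t}) < card (R \<inter> {r..t}))}"

text \<open>Going right, the blue surplus from any \<open>a\<close> exceeds every bound, which
  closes all open brackets; going left, the red surplus does, which provides an opening for every
  blue point. The bound \<open>K\<close> lets the surplus beat a given number of crossing
  edges.\<close>

definition recurrent :: "real set \<Rightarrow> real set \<Rightarrow> bool" where
  "recurrent R B \<longleftrightarrow> (\<forall>a K.
     (\<exists>t>a. card (R \<inter> {a<..t}) + K < card (B \<inter> {a<..t})) \<and>
     (\<exists>t<a. card (B \<inter> {t..<a}) + K < card (R \<inter> {t..<a})))"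

section \<open>Uniqueness, nesting and existence of bracket partners\<close>

locale points =
  fixes R B :: "real set"
  assumes lfR: "locally_finite_points R" and lfB: "locally_finite_points B"
    and disj: "R \<inter> B = {}"
begin

lemma lfRB: "locally_finite_points (R \<union> B)"
  using lfR lfB unfolding locally_finite_points_def by (simp add: Int_Un_distrib2)

lemma bracket_subset: "bracket_matching R B \<subseteq> R \<times> B"
  unfolding bracket_matching_def by auto

lemma bracket_fst_unique:
  assumes "(r, b) \<in> bracket_matching R B" "(r, b') \<in> bracket_matching R B"
  shows "b = b'"
proof -
  have "\<not> b < b'" if "(r, b) \<in> bracket_matching R B" "(r, b') \<in> bracket_matching R B" for b b'
  proof
    assume "b < b'"
    moreover have "r \<le> b" "card (R \<inter> {r..b}) = card (B \<inter> {r..b})"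
      using that(1) unfolding bracket_matching_def by auto
    moreover have "r \<le> b \<Longrightarrow> b < b' \<Longrightarrow> card (B \<inter> {r..b}) < card (R \<inter> {r..b})"
      using that(2) unfolding bracket_matching_def by blast
    ultimately show False by simp
  qed
  then show ?thesis using assms by (meson linorder_neqE)
qed

text \<open>If \<open>r < r'\<close>, the stretch from \<open>r\<close> up to \<open>r'\<close> has
  a red surplus because the bracket of \<open>r\<close> is still open, while the stretch from
  \<open>r'\<close> to \<open>b\<close> is balanced; together they cannot be balanced.\<close>

lemma bracket_snd_unique:
  assumes "(r, b) \<in> bracket_matching R B" "(r', b) \<in> bracket_matching R B"
  shows "r = r'"
proof -
  have False if rr: "(r, b) \<in> bracket_matching R B" "(r', b) \<in> bracket_matching R B" "r < r'" for r r'
  proof -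
    have r: "r \<in> R" "card (R \<inter> {r..b}) = card (B \<inter> {r..b})"
      "card (R \<inter> {r'..b}) = card (B \<inter> {r'..b})" "r' < b"
      "\<And>t. r \<le> t \<Longrightarrow> t < b \<Longrightarrow> card (B \<inter> {r..t}) < card (R \<inter> {r..t})"
      using rr unfolding bracket_matching_def by auto
    \<comment> \<open>The surplus is known on closed intervals \<open>{r..t}\<close>; the last point
      \<open>t\<close> before \<open>r'\<close> carries it over to \<open>{r..<r'}\<close>.\<close>
    obtain t where t: "r \<le> t" "t < r'" "(R \<union> B) \<inter> {t<..<r'} = {}"
      using obtain_last_point_before[OF lfRB, of r r'] r(1) rr(3) by (metis UnI1)
    have "R \<inter> {r..t} = R \<inter> {r..<r'}" "B \<inter> {r..t} = B \<inter> {r..<r'}" using t by force+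
    then have "card (B \<inter> {r..<r'}) < card (R \<inter> {r..<r'})" using r(5)[of t] t r(4) by simp
    then show False
      using card_points_split(2)[OF lfR, of r r' b] card_points_split(2)[OF lfB, of r r' b] r rr(3)
      by simp
  qed
  then show ?thesis using assms by (meson linorder_neqE)
qed

lemma bracket_matching_matching: "matching R B (bracket_matching R B)"
  unfolding matching_iff[OF disj]
  using bracket_subset bracket_fst_unique bracket_snd_unique by (force simp: inj_on_def)

text \<open>Otherwise both brackets are still open on their stretches: there is a red surplus on
  \<open>{r..<r'}\<close> and on \<open>{r'..b}\<close>, hence on \<open>{r..b}\<close>, which is
  balanced.\<close>

lemma bracket_noncrossing:
  assumes "(r, b) \<in> bracket_matching R B" "(r', b') \<in> bracket_matching R B" "r < r'" "r' < b"
  shows "b' \<le> b"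
proof (rule ccontr)
  assume "\<not> b' \<le> b"
  have r: "r \<in> R" "card (R \<inter> {r..b}) = card (B \<inter> {r..b})"
    "\<And>t. r \<le> t \<Longrightarrow> t < b \<Longrightarrow> card (B \<inter> {r..t}) < card (R \<inter> {r..t})"
    "\<And>t. r' \<le> t \<Longrightarrow> t < b' \<Longrightarrow> card (B \<inter> {r'..t}) < card (R \<inter> {r'..t})"
    using assms unfolding bracket_matching_def by auto
  obtain t where t: "r \<le> t" "t < r'" "(R \<union> B) \<inter> {t<..<r'} = {}"
    using obtain_last_point_before[OF lfRB, of r r'] r(1) assms(3) by (metis UnI1)
  have "R \<inter> {r..t} = R \<inter> {r..<r'}" "B \<inter> {r..t} = B \<inter> {r..<r'}" using t by force+
  then have "card (B \<inter> {r..<r'}) < card (R \<inter> {r..<r'})" using r(3)[of t] t assms(4) by simp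
  moreover have "card (B \<inter> {r'..b}) < card (R \<inter> {r'..b})"
    using r(4)[of b] assms \<open>\<not> b' \<le> b\<close> by simp
  ultimately show False
    using card_points_split(2)[OF lfR, of r r' b] card_points_split(2)[OF lfB, of r r' b] r(2) assms
    by simp
qed

text \<open>The balance changes only at points, so the first time at which it is not positive is the
  minimum of a finite set. There it drops from positive to at most zero at a single point, which
  must be blue, and the value reached is exactly zero.\<close>

lemma bracket_exists_blue:
  assumes r: "r \<in> R" and t0: "r < t0" "card (R \<inter> {r..t0}) \<le> card (B \<inter> {r..t0})"
  obtains b where "(r, b) \<in> bracket_matching R B"
proof -
  let ?X = "R \<union> B"
  define T where "T = {t \<in> ?X \<inter> {r..t0}. card (R \<inter> {r..t}) \<le> card (B \<inter> {r..t})}"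
  have finT: "finite T"
    unfolding T_def by (rule finite_subset[OF _ locally_finite_pointsD(1)[OF lfRB, of r t0]]) auto
  have rB: "r \<notin> B" using r disj by auto
  \<comment> \<open>Rounding \<open>t\<close> down to a point leaves both counts unchanged, so a
    minimum over points is a minimum over all real times.\<close>
  have round: "\<exists>t'\<in>?X. r \<le> t' \<and> t' \<le> t \<and> R \<inter> {r..t'} = R \<inter> {r..t} \<and> B \<inter> {r..t'} = B \<inter> {r..t}"
    if "r \<le> t" for t
  proof (cases "t \<in> ?X")
    case False
    then have "r < t" using that r by (metis UnI1 order_le_less)
    then obtain t' where "t' \<in> ?X" "r \<le> t'" "t' < t" "?X \<inter> {t'<..<t} = {}"
      using obtain_last_point_before[OF lfRB, of r t] r by (metis UnI1)
    moreover have "z \<le> t'" if "z \<in> ?X" "z \<le> t" for z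
    proof (rule ccontr)
      assume "\<not> z \<le> t'"
      moreover have "z \<noteq> t" using that False by auto
      ultimately have "z \<in> ?X \<inter> {t'<..<t}" using that by auto
      then show False using \<open>?X \<inter> {t'<..<t} = {}\<close> by blast
    qed
    ultimately show ?thesis by (intro bexI[of _ t']) auto
  qed (use that in auto)
  have "T \<noteq> {}"
  proof -
    obtain t' where "t' \<in> ?X" "r \<le> t'" "t' \<le> t0" "R \<inter> {r..t'} = R \<inter> {r..t0}" "B \<inter> {r..t'} = B \<inter> {r..t0}"
      using round[of t0] t0(1) by auto
    then have "t' \<in> T" unfolding T_def using t0(2) by simp
    then show ?thesis by blast
  qed
  define b where "b = Min T"
  have "b \<in> T" unfolding b_def using finT \<open>T \<noteq> {}\<close> by simp
  have before: "card (B \<inter> {r..t}) < card (R \<inter> {r..t})" if t: "r \<le> t" "t < b" for t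
  proof (rule ccontr)
    assume c: "\<not> ?thesis"
    obtain t' where "t' \<in> ?X" "r \<le> t'" "t' \<le> t" "R \<inter> {r..t'} = R \<inter> {r..t}" "B \<inter> {r..t'} = B \<inter> {r..t}"
      using round[of t] t by auto
    then have "t' \<in> T" unfolding T_def using c t \<open>b \<in> T\<close> unfolding T_def by auto
    then have "b \<le> t'" unfolding b_def using finT by simp
    then show False using \<open>t' \<le> t\<close> t by simp
  qed
  have bX: "b \<in> ?X" "r \<le> b" and ble: "card (R \<inter> {r..b}) \<le> card (B \<inter> {r..b})"
    using \<open>b \<in> T\<close> unfolding T_def by auto
  have "b \<noteq> r" using ble card_points_singleton r rB by auto
  then have rb: "r < b" using bX by simp
  obtain t where t: "r \<le> t" "t < b" "?X \<inter> {t<..<b} = {}"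
    using obtain_last_point_before[OF lfRB, of r b] rb r by (metis UnI1)
  have eq: "R \<inter> {r..t} = R \<inter> {r..<b}" "B \<inter> {r..t} = B \<inter> {r..<b}" using t by force+
  have less: "card (B \<inter> {r..<b}) < card (R \<inter> {r..<b})" using before[of t] t unfolding eq by simp
  have splitb: "card (R \<inter> {r..b}) = card (R \<inter> {r..<b}) + card (R \<inter> {b..b})"
    "card (B \<inter> {r..b}) = card (B \<inter> {r..<b}) + card (B \<inter> {b..b})"
    using card_points_split(2)[OF lfR, of r b b] card_points_split(2)[OF lfB, of r b b] rb by simp_all
  have "b \<in> B"
  proof (rule ccontr)
    assume "b \<notin> B"
    then have "card (B \<inter> {b..b}) = 0" by (rule card_points_singleton(2))
    then show False using splitb ble less by linarith
  qed
  then have "b \<notin> R" using disj by auto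
  have "card (R \<inter> {r..b}) = card (B \<inter> {r..b})"
    using splitb ble less card_points_singleton[of b] \<open>b \<in> B\<close> \<open>b \<notin> R\<close> by simp
  then have "(r, b) \<in> bracket_matching R B"
    unfolding bracket_matching_def using r rB \<open>b \<in> B\<close> \<open>b \<notin> R\<close> rb before by simp
  then show thesis by (rule that)
qed

text \<open>Red points get partners directly from the surplus on their right. For a blue point
  \<open>b\<close> the bracket is built from its other end: the candidate is the last red point from
  which the count up to \<open>b\<close> is not in favour of blue.\<close>

lemma recurrent_bracket_perfect:
  assumes "recurrent R B"
  shows "unmatched R B (bracket_matching R B) = {}"
proof -
  have ex_blue: "\<exists>b. (r, b) \<in> bracket_matching R B" if r: "r \<in> R" for r
  proof -
    obtain t where t: "r < t" "card (R \<inter> {r<..t}) + 1 < card (B \<inter> {r<..t})"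
      using assms unfolding recurrent_def by blast
    have "card (R \<inter> {r..t}) \<le> card (B \<inter> {r..t})"
      using card_points_split(1)[OF lfR, of r r t] card_points_split(1)[OF lfB, of r r t] t
        card_points_singleton r by simp
    then show ?thesis using bracket_exists_blue r t(1) by metis
  qed
  have ex_red: "\<exists>r. (r, b) \<in> bracket_matching R B" if b: "b \<in> B" for b
  proof -
    have bR: "b \<notin> R" using b disj by auto
    obtain t where t: "t < b" "card (B \<inter> {t..<b}) + 1 < card (R \<inter> {t..<b})"
      using assms unfolding recurrent_def by blast
    have tb: "card (B \<inter> {t..b}) \<le> card (R \<inter> {t..b})"
      using card_points_split(2)[OF lfR, of t b b] card_points_split(2)[OF lfB, of t b b] t
        card_points_singleton b bR by simp
    \<comment> \<open>Moving the left end up to the first red point discards only blue points, so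
      the inequality survives.\<close>
    have first: "\<exists>s\<in>R. t' \<le> s \<and> s \<le> b \<and> card (B \<inter> {s..b}) \<le> card (R \<inter> {s..b})"
      if t': "t' \<le> b" "card (B \<inter> {t'..b}) \<le> card (R \<inter> {t'..b})" for t'
    proof -
      let ?F = "R \<inter> {t'..b}"
      have fin: "finite ?F" using locally_finite_pointsD[OF lfR] by blast
      have "0 < card (B \<inter> {t'..b})"
        using b t'(1) locally_finite_pointsD[OF lfB] by (auto simp: card_gt_0_iff)
      then have ne: "?F \<noteq> {}" using t'(2) by auto
      define s where "s = Min ?F"
      have s: "s \<in> ?F" unfolding s_def using Min_in[OF fin ne] .
      then have ts: "t' \<le> s" "s \<le> b" "s \<in> R" by auto
      have "?F = R \<inter> {s..b}" using s Min_le[OF fin] unfolding s_def by auto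
      then have "card (B \<inter> {s..b}) \<le> card (R \<inter> {s..b})"
        using t'(2) card_points_mono(1)[OF lfB, of t' s b b] ts(1) by simp
      then show ?thesis using ts by auto
    qed
    let ?T = "{s \<in> R \<inter> {t..b}. card (B \<inter> {s..b}) \<le> card (R \<inter> {s..b})}"
    have finT: "finite ?T"
      by (rule finite_subset[OF _ locally_finite_pointsD(1)[OF lfR, of t b]]) auto
    have "?T \<noteq> {}" using first[OF _ tb] t(1) by auto
    define r where "r = Max ?T"
    have "r \<in> ?T" unfolding r_def by (rule Max_in[OF finT \<open>?T \<noteq> {}\<close>])
    then have r: "r \<in> R" "t \<le> r" "r \<le> b" "card (B \<inter> {r..b}) \<le> card (R \<inter> {r..b})" by auto
    then have "r < b" using bR by (metis order_le_less)
    have max: "\<not> (card (B \<inter> {t'..b}) \<le> card (R \<inter> {t'..b}))" if t': "r < t'" "t' \<le> b" for t'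
    proof
      assume "card (B \<inter> {t'..b}) \<le> card (R \<inter> {t'..b})"
      then obtain s where "s \<in> R" "t' \<le> s" "s \<le> b" "card (B \<inter> {s..b}) \<le> card (R \<inter> {s..b})"
        using first t' by blast
      then have "s \<in> ?T" using t' r by auto
      then have "s \<le> r" unfolding r_def using finT by simp
      then show False using \<open>t' \<le> s\<close> t'(1) by simp
    qed
    \<comment> \<open>The same maximality for half-open intervals: the first point after
      \<open>t'\<close> serves as a closed left end.\<close>
    have max': "\<not> (card (B \<inter> {t'<..b}) \<le> card (R \<inter> {t'<..b}))" if t': "r \<le> t'" "t' < b" for t'
    proof
      assume c: "card (B \<inter> {t'<..b}) \<le> card (R \<inter> {t'<..b})"
      let ?F = "(R \<union> B) \<inter> {t'<..b}"
      have fin: "finite ?F" "?F \<noteq> {}" using locally_finite_pointsD[OF lfRB] b t' by auto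
      define s where "s = Min ?F"
      have s: "s \<in> ?F" unfolding s_def using Min_in[OF fin] .
      have "?F = (R \<union> B) \<inter> {s..b}" using s Min_le[OF fin(1)] unfolding s_def by auto
      then have "R \<inter> {t'<..b} = R \<inter> {s..b}" "B \<inter> {t'<..b} = B \<inter> {s..b}" by blast+
      moreover have "r < s" "s \<le> b" using s t'(1) by auto
      ultimately show False using c max[of s] by simp
    qed
    \<comment> \<open>By maximality red is behind on \<open>{r<..b}\<close>, and the single point
      \<open>r\<close> makes up for it, so the balance is exactly zero.\<close>
    have "card (R \<inter> {r..b}) = card (B \<inter> {r..b})"
      using max'[of r] \<open>r < b\<close> r card_points_split(1)[OF lfR, of r r b] card_points_split(1)[OF lfB, of r r b]
        card_points_singleton[of r] disj by (cases "r \<in> B") auto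
    then obtain b' where b': "(r, b') \<in> bracket_matching R B"
      using bracket_exists_blue[OF r(1) \<open>r < b\<close>] by auto
    then have b'': "r < b'" "card (R \<inter> {r..b'}) = card (B \<inter> {r..b'})"
      "\<And>t. r \<le> t \<Longrightarrow> t < b' \<Longrightarrow> card (B \<inter> {r..t}) < card (R \<inter> {r..t})"
      unfolding bracket_matching_def by auto
    \<comment> \<open>The partner \<open>b'\<close> of \<open>r\<close> must be \<open>b\<close>: a
      later one would need a red surplus on \<open>{r..b}\<close>, an earlier one would leave
      \<open>{b'<..b}\<close> balanced, against \<open>max'\<close>.\<close>
    have "\<not> b < b'" using b''(3)[of b] \<open>card (R \<inter> {r..b}) = _\<close> r by auto
    moreover have "\<not> b' < b"
    proof
      assume "b' < b"
      then show False
        using max'[of b'] b'' \<open>card (R \<inter> {r..b}) = _\<close> card_points_split(1)[OF lfR, of r b' b]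
          card_points_split(1)[OF lfB, of r b' b] by simp
    qed
    ultimately have "b' = b" by simp
    then show ?thesis using b' by blast
  qed
  show ?thesis
    unfolding unmatched_empty_iff[OF disj bracket_subset]
    using ex_blue ex_red bracket_subset by force
qed

text \<open>The blue points in \<open>{a<..t}\<close> have their partners on the left, either still
  in \<open>{a<..t}\<close> or beyond \<open>a\<close>; in the latter case the edge crosses
  \<open>a\<close>. Finitely many crossing edges would therefore bound the blue surplus.\<close>

lemma recurrent_bracket_not_locally_finite:
  assumes "recurrent R B"
  shows "\<not> locally_finite (bracket_matching R B)"
proof
  assume lf: "locally_finite (bracket_matching R B)"
  let ?M = "bracket_matching R B"
  have "infinite {0<..<1::real}" by simp
  moreover have "finite ((R \<union> B) \<inter> {0<..<1})" using locally_finite_pointsD(4)[OF lfRB] .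
  ultimately have "\<not> {0<..<1} \<subseteq> (R \<union> B) \<inter> {0<..<1}" using finite_subset by blast
  \<comment> \<open>As \<open>crosses\<close> is strict, \<open>a\<close> has to avoid the points
    themselves; an edge starting at \<open>a\<close> would not be counted.\<close>
  then obtain a where a: "a \<notin> R \<union> B" by blast
  let ?C = "{e \<in> ?M. crosses e a}"
  have finC: "finite ?C" using lf unfolding locally_finite_def by blast
  obtain t where t: "a < t" "card (R \<inter> {a<..t}) + card ?C < card (B \<inter> {a<..t})"
    using assms unfolding recurrent_def by blast
  have perf: "fst ` ?M = R" "snd ` ?M = B"
    using recurrent_bracket_perfect[OF assms] unmatched_empty_iff[OF disj bracket_subset] by auto
  let ?E = "{e \<in> ?M. snd e \<in> {a<..t}}"
  have inj: "inj_on fst ?M" "inj_on snd ?M"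
    using bracket_matching_matching matching_iff[OF disj] by auto
  have E: "?E \<subseteq> {e \<in> ?M. fst e \<in> R \<inter> {a<..t}} \<union> ?C"
  proof
    fix e assume e: "e \<in> ?E"
    then have "fst e < snd e" "fst e \<in> R" unfolding bracket_matching_def by auto
    then show "e \<in> {e \<in> ?M. fst e \<in> R \<inter> {a<..t}} \<union> ?C"
      using e a unfolding crosses_def by (cases "fst e" a rule: linorder_cases) auto
  qed
  have "snd ` ?E = B \<inter> {a<..t}" using perf(2) by (auto simp: image_iff) (metis imageE snd_conv surj_pair)
  then have "card (B \<inter> {a<..t}) = card ?E"
    using inj(2) by (metis (no_types, lifting) card_image inj_on_subset mem_Collect_eq subsetI)
  also have "\<dots> \<le> card ({e \<in> ?M. fst e \<in> R \<inter> {a<..t}} \<union> ?C)"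
  proof (rule card_mono[OF _ E])
    have "inj_on fst {e \<in> ?M. fst e \<in> R \<inter> {a<..t}}" using inj(1) by (rule inj_on_subset) auto
    then have "finite {e \<in> ?M. fst e \<in> R \<inter> {a<..t}}"
      by (rule inj_on_finite[of _ _ "R \<inter> {a<..t}"]) (use locally_finite_pointsD[OF lfR] in auto)
    then show "finite ({e \<in> ?M. fst e \<in> R \<inter> {a<..t}} \<union> ?C)" using finC by simp
  qed
  also have "\<dots> \<le> card {e \<in> ?M. fst e \<in> R \<inter> {a<..t}} + card ?C" by (rule card_Un_le)
  also have "card {e \<in> ?M. fst e \<in> R \<inter> {a<..t}} \<le> card (R \<inter> {a<..t})"
    by (rule card_inj_on_le[of fst]) (use inj(1) locally_finite_pointsD[OF lfR] in \<open>auto intro: inj_on_subset\<close>)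
  finally show False using t by simp
qed

end

section \<open>Negative exponents\<close>

lemma cost_neg_gamma:
  assumes "\<gamma> < 0"
  shows "x \<le> 0 \<Longrightarrow> cost \<gamma> x = 0" "x > 0 \<Longrightarrow> cost \<gamma> x < 0" "cost \<gamma> x \<le> 0"
    and "0 < x \<Longrightarrow> x < y \<Longrightarrow> cost \<gamma> x < cost \<gamma> y"
  using assms by (auto simp: cost_def powr_less_mono2_neg)

text \<open>Negative powers are strictly convex: the increment \<open>h\<close> over a step of
  length \<open>u\<close> grows. In terms of edges, a nested pair is strictly cheaper than the
  crossing pair with the same endpoints.\<close>

lemma cost_neg_gamma_concave:
  assumes "\<gamma> < 0" "0 < a" "0 < u" "0 < v"
  shows "cost \<gamma> a + cost \<gamma> (a + u + v) < cost \<gamma> (a + u) + cost \<gamma> (a + v)"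
proof -
  define h where "h t = (a + u + t) powr \<gamma> - (a + t) powr \<gamma>" for t
  have "h 0 < h v"
  proof (rule DERIV_pos_imp_increasing[OF assms(4)])
    fix t assume t: "0 \<le> t" "t \<le> v"
    have "(h has_real_derivative \<gamma> * (a + u + t) powr (\<gamma> - 1) - \<gamma> * (a + t) powr (\<gamma> - 1)) (at t)"
      unfolding h_def using t assms by (auto intro!: derivative_eq_intros)
    moreover have "(a + u + t) powr (\<gamma> - 1) < (a + t) powr (\<gamma> - 1)"
      using t assms by (intro powr_less_mono2_neg) auto
    then have "0 < \<gamma> * (a + u + t) powr (\<gamma> - 1) - \<gamma> * (a + t) powr (\<gamma> - 1)"
      using assms(1) by (simp add: mult_less_cancel_left)
    ultimately show "\<exists>y. DERIV h t :> y \<and> 0 < y" by blast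
  qed
  then show ?thesis using assms unfolding h_def cost_def by simp
qed

text \<open>An innermost edge of \<open>M\<close> joins neighbouring points, and uncrossing \<open>N\<close> at these two points
  to create that edge never increases the cost.\<close>

lemma nested_total_cost_le:
  fixes M N :: "edge set"
  assumes f0: "\<And>x. x \<le> 0 \<Longrightarrow> f x = 0" and f_neg: "\<And>x. f x \<le> 0"
    and f_mono: "\<And>x y. 0 < x \<Longrightarrow> x < y \<Longrightarrow> f x \<le> f y"
    and f_concave: "\<And>a u v. 0 < a \<Longrightarrow> 0 < u \<Longrightarrow> 0 < v \<Longrightarrow> f a + f (a + u + v) \<le> f (a + u) + f (a + v)"
    and "finite M" "\<And>e. e \<in> M \<Longrightarrow> fst e < snd e"
    and "\<And>r b r' b'. (r, b) \<in> M \<Longrightarrow> (r', b') \<in> M \<Longrightarrow> r < r' \<Longrightarrow> r' < b \<Longrightarrow> b' \<le> b"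
    and "inj_on fst M" "inj_on snd M" "fst ` M \<inter> snd ` M = {}"
    and "inj_on fst N" "inj_on snd N" "fst ` N = fst ` M" "snd ` N = snd ` M"
  shows "total_cost f M \<le> total_cost f N"
  using assms(5-)
proof (induction "card M" arbitrary: M N)
  case 0
  then have "M = {}" by simp
  then show ?case using 0 by simp
next
  case (Suc n)
  note fin = \<open>finite M\<close>
  have "M \<noteq> {}" using Suc.hyps(2) by auto
  \<comment> \<open>A shortest edge is innermost: an endpoint of another edge strictly inside it
    would, in the absence of crossings, belong to a shorter edge.\<close>
  define e where "e = arg_min_on (\<lambda>e. snd e - fst e) M"
  have eM: "e \<in> M" unfolding e_def by (rule arg_min_if_finite(1)[OF fin \<open>M \<noteq> {}\<close>])
  have shortest: "snd e - fst e \<le> snd e' - fst e'" if "e' \<in> M" for e'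
    using arg_min_if_finite(2)[OF fin \<open>M \<noteq> {}\<close>, of "\<lambda>e. snd e - fst e"] that
    unfolding e_def by (meson not_less)
  obtain r b where e: "e = (r, b)" by (cases e)
  have rb: "r < b" "(r, b) \<in> M" using Suc.prems(2) eM e by auto
  have outside: "r' \<le> r \<or> b \<le> r'" "b' \<le> r \<or> b \<le> b'" if m: "(r', b') \<in> M" for r' b'
  proof -
    have *: "r' < b'" "b - r \<le> b' - r'" using Suc.prems(2)[OF m] shortest[OF m] e by auto
    show "r' \<le> r \<or> b \<le> r'"
    proof (rule ccontr)
      assume "\<not> ?thesis"
      then show False using Suc.prems(3)[OF rb(2) m] * by auto
    qed
    show "b' \<le> r \<or> b \<le> b'"
    proof (rule ccontr)
      assume c: "\<not> ?thesis"
      then have "r' < r" using * by auto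
      then show False using Suc.prems(3)[OF m rb(2)] c by auto
    qed
  qed
  have not_cross: "x \<notin> snd ` M" if "x \<in> fst ` M" for x using Suc.prems(6) that by blast
  define M' where "M' = M - {(r, b)}"
  have finM': "finite M'" and cardM': "n = card M'"
    unfolding M'_def using fin Suc.hyps(2) rb by auto
  have fstM': "fst ` M' = fst ` M - {r}"
    using inj_on_image_set_diff[OF Suc.prems(4), of M "{(r, b)}"] rb unfolding M'_def by simp
  have sndM': "snd ` M' = snd ` M - {b}"
    using inj_on_image_set_diff[OF Suc.prems(5), of M "{(r, b)}"] rb unfolding M'_def by simp
  have IH: "total_cost f M' \<le> total_cost f N'"
    if "inj_on fst N'" "inj_on snd N'" "fst ` N' = fst ` M - {r}" "snd ` N' = snd ` M - {b}" for N'
  proof (rule Suc.hyps(1)[OF cardM' finM'])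
    show "inj_on fst M'" "inj_on snd M'"
      unfolding M'_def using Suc.prems(4,5) by (auto intro: inj_on_diff)
    show "fst ` M' \<inter> snd ` M' = {}" using fstM' sndM' Suc.prems(6) by auto
    show "b2 \<le> b1" if "(r1, b1) \<in> M'" "(r2, b2) \<in> M'" "r1 < r2" "r2 < b1" for r1 b1 r2 b2
      using Suc.prems(3) that unfolding M'_def by blast
  qed (use that Suc.prems(2) fstM' sndM' in \<open>auto simp: M'_def\<close>)
  have costM: "total_cost f M = f (b - r) + total_cost f M'"
    unfolding total_cost_def M'_def using sum.remove[OF fin rb(2), of "\<lambda>(x, y). f (y - x)"] by simp
  have finN: "finite N" using finite_imageD[of fst N] Suc.prems(7,9) fin by simp
  show ?case
  proof (cases "(r, b) \<in> N")
    case True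
    have "total_cost f M' \<le> total_cost f (N - {(r, b)})"
    proof (rule IH)
      show "inj_on fst (N - {(r, b)})" "inj_on snd (N - {(r, b)})"
        using Suc.prems(7,8) by (auto intro: inj_on_diff)
      show "fst ` (N - {(r, b)}) = fst ` M - {r}"
        using inj_on_image_set_diff[OF Suc.prems(7), of N "{(r, b)}"] True Suc.prems(9) by simp
      show "snd ` (N - {(r, b)}) = snd ` M - {b}"
        using inj_on_image_set_diff[OF Suc.prems(8), of N "{(r, b)}"] True Suc.prems(10) by simp
    qed
    then show ?thesis
      using costM sum.remove[OF finN True, of "\<lambda>(x, y). f (y - x)"] unfolding total_cost_def by simp
  next
    case False
    have "r \<in> fst ` N" "b \<in> snd ` N" using Suc.prems(9,10) rb(2) by (auto intro: rev_image_eqI)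
    then obtain b' r' where rb': "(r, b') \<in> N" "(r', b) \<in> N" by auto
    have ne: "b' \<noteq> b" "r' \<noteq> r" using False rb' by auto
    have r'M: "r' \<in> fst ` M" and b'M: "b' \<in> snd ` M"
      using Suc.prems(9,10) rb' by (metis fst_conv rev_image_eqI, metis snd_conv rev_image_eqI)
    have rM: "r \<in> fst ` M" "b \<in> snd ` M" using rb(2) by (auto intro: rev_image_eqI)
    have "r' \<noteq> b" "b' \<noteq> r" using not_cross r'M b'M rM by auto
    then have out: "r' < r \<or> b < r'" "b' < r \<or> b < b'"
      using outside r'M b'M ne by force+
    \<comment> \<open>The two edges of \<open>N\<close> at \<open>r\<close> and \<open>b\<close> are
      to be replaced by \<open>(r, b)\<close> and \<open>(r', b')\<close>; once
      \<open>(r, b)\<close> is split off, the induction hypothesis handles the rest.\<close>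
    define N1 where "N1 = N - {(r, b'), (r', b)}"
    have r'b': "r' \<noteq> b'" using not_cross r'M b'M by auto
    have N: "N = insert (r, b') (insert (r', b) N1)" unfolding N1_def using rb' by auto
    have N1: "(r, b') \<notin> N1" "(r', b) \<notin> N1" "finite N1" unfolding N1_def using finN by auto
    have fst1: "fst ` N1 = fst ` M - {r, r'}"
      using inj_on_image_set_diff[OF Suc.prems(7), of N "{(r, b'), (r', b)}"] rb' Suc.prems(9)
      unfolding N1_def by simp
    have snd1: "snd ` N1 = snd ` M - {b, b'}"
      using inj_on_image_set_diff[OF Suc.prems(8), of N "{(r, b'), (r', b)}"] rb' Suc.prems(10)
      unfolding N1_def by (simp add: insert_commute)
    have inj1: "inj_on fst N1" "inj_on snd N1"
      unfolding N1_def using Suc.prems(7,8) by (auto intro: inj_on_diff)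
    have new: "(r', b') \<notin> N1" using fst1 by (metis DiffE fst_conv image_eqI insertCI)
    have "total_cost f M' \<le> total_cost f (insert (r', b') N1)"
    proof (rule IH)
      show "fst ` insert (r', b') N1 = fst ` M - {r}" using fst1 r'M ne by auto
      show "snd ` insert (r', b') N1 = snd ` M - {b}" using snd1 b'M ne by auto
      show "inj_on fst (insert (r', b') N1)" "inj_on snd (insert (r', b') N1)"
        unfolding inj_on_insert using inj1 new fst1 snd1 by auto
    qed
    also have "total_cost f (insert (r', b') N1) = f (b' - r') + total_cost f N1"
      unfolding total_cost_def using N1(3) new by simp
    finally have 1: "total_cost f M' \<le> f (b' - r') + total_cost f N1" .
    have "(r, b') \<notin> insert (r', b) N1" using N1 ne by auto
    then have 2: "total_cost f N = f (b' - r) + (f (b - r') + total_cost f N1)"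
      unfolding total_cost_def N using N1 by simp
    \<comment> \<open>Since \<open>r'\<close> and \<open>b'\<close> lie outside the innermost edge,
      four cases remain. For \<open>r' < r\<close> and \<open>b < b'\<close> a crossing pair becomes
      nested, which is concavity. In the other cases at least one old edge is blue-red and free, and
      a remaining red-blue one only shrinks to \<open>(r, b)\<close>.\<close>
    have "f (b - r) + f (b' - r') \<le> f (b' - r) + f (b - r')"
      using out(1)
    proof
      assume r': "r' < r"
      show ?thesis using out(2)
      proof
        assume "b < b'"
        then show ?thesis using f_concave[of "b - r" "r - r'" "b' - b"] r' rb(1) by (simp add: algebra_simps)
      next
        assume "b' < r"
        then show ?thesis using f0[of "b' - r"] f_neg[of "b' - r'"] f_mono[of "b - r" "b - r'"] r' rb(1) by simp
      qed
    next
      assume r': "b < r'"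
      then show ?thesis using out(2) f0[of "b - r'"] f_neg[of "b' - r'"] f_neg[of "b - r"] f0[of "b' - r"] f_mono[of "b - r" "b' - r"] rb(1)
        by auto
    qed
    then show ?thesis using 1 2 costM by simp
  qed
qed

section \<open>Minimality and uniqueness of the bracket matching for negative exponents\<close>

context points
begin


text \<open>Such a \<open>g\<close> would embed the blue points of every \<open>{a<..t}\<close> into
  its red points, against the blue surplus.\<close>

lemma exists_blue_without_red:
  assumes "recurrent R B"
    and g: "\<And>b. b \<in> B \<Longrightarrow> a < b \<Longrightarrow> g b \<in> R \<and> a < g b \<and> g b < b" and "inj_on g (B \<inter> {a<..})"
  shows False
proof -
  obtain t where t: "a < t" "card (R \<inter> {a<..t}) + 0 < card (B \<inter> {a<..t})"
    using assms(1) unfolding recurrent_def by blast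
  have "card (B \<inter> {a<..t}) \<le> card (R \<inter> {a<..t})"
  proof (rule card_inj_on_le[of g])
    show "inj_on g (B \<inter> {a<..t})" using assms(3) by (rule inj_on_subset) auto
    show "g ` (B \<inter> {a<..t}) \<subseteq> R \<inter> {a<..t}" using g by force
  qed (rule locally_finite_pointsD[OF lfR])
  then show False using t by simp
qed

lemma exists_red_without_blue:
  assumes "recurrent R B"
    and g: "\<And>r. r \<in> R \<Longrightarrow> r < a \<Longrightarrow> g r \<in> B \<and> g r < a \<and> r < g r" and "inj_on g (R \<inter> {..<a})"
  shows False
proof -
  obtain t where t: "t < a" "card (B \<inter> {t..<a}) + 0 < card (R \<inter> {t..<a})"
    using assms(1) unfolding recurrent_def by blast
  have "card (R \<inter> {t..<a}) \<le> card (B \<inter> {t..<a})"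
  proof (rule card_inj_on_le[of g])
    show "inj_on g (R \<inter> {t..<a})" using assms(3) by (rule inj_on_subset) auto
    show "g ` (R \<inter> {t..<a}) \<subseteq> B \<inter> {t..<a}" using g by force
  qed (rule locally_finite_pointsD[OF lfB])
  then show False using t by simp
qed

lemma bracket_minimal:
  assumes rec: "recurrent R B" and \<gamma>: "\<gamma> < 0"
  shows "gamma_minimal \<gamma> R B (bracket_matching R B)"
  unfolding gamma_minimal_def minimal_matching_def
proof (intro conjI allI impI bracket_matching_matching)
  fix S assume "admissible R B (bracket_matching R B) S"
  then show "finite_minimal (cost \<gamma>) (R \<inter> S) (B \<inter> S) (restrict_matching (bracket_matching R B) S)"
  proof (rule finite_minimal_restrict_perfectI[OF disj bracket_matching_matching recurrent_bracket_perfect[OF rec]])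
    fix E N :: "edge set" assume E: "finite E" "E \<subseteq> bracket_matching R B"
      and N: "inj_on fst N" "inj_on snd N" "fst ` N = fst ` E" "snd ` N = snd ` E"
    have inj: "inj_on fst (bracket_matching R B)" "inj_on snd (bracket_matching R B)"
      using bracket_matching_matching matching_iff[OF disj] by auto
    have "fst ` E \<subseteq> R" "snd ` E \<subseteq> B" using E(2) bracket_subset by auto
    then have *: "fst ` E \<inter> snd ` E = {}" using disj by blast
    show "total_cost (cost \<gamma>) E \<le> total_cost (cost \<gamma>) N"
    proof (rule nested_total_cost_le[OF _ _ _ _ E(1) _ _ _ _ * N])
      show "fst e < snd e" if "e \<in> E" for e using that E(2) unfolding bracket_matching_def by auto
      show "b' \<le> b" if "(r, b) \<in> E" "(r', b') \<in> E" "r < r'" "r' < b" for r b r' b'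
        using bracket_noncrossing that E(2) by blast
      show "inj_on fst E" "inj_on snd E" using inj E(2) by (auto intro: inj_on_subset)
    qed (use cost_neg_gamma[OF \<gamma>] cost_neg_gamma_concave[OF \<gamma>] in \<open>auto intro: less_imp_le\<close>)
  qed
qed

text \<open>Exchanges show that a minimal matching is perfect, red-blue and free of crossings;
  counting partners inside an edge then makes every edge a bracket. Inclusion becomes equality
  because \<open>M\<close> is perfect and bracket partners are unique.\<close>

lemma gamma_minimal_eq_bracket:
  assumes rec: "recurrent R B" and \<gamma>: "\<gamma> < 0" and min: "gamma_minimal \<gamma> R B M"
  shows "M = bracket_matching R B"
proof -
  let ?f = "cost \<gamma>"
  note f = cost_neg_gamma[OF \<gamma>]
  have mm: "minimal_matching ?f R B M" using min unfolding gamma_minimal_def .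
  then have m: "matching R B M" unfolding minimal_matching_def by simp
  then have M: "M \<subseteq> R \<times> B" "inj_on fst M" "inj_on snd M" using matching_iff[OF disj] by auto
  note swap = minimal_matching_swap[OF disj mm]
  have uniq_red: "r = r'" if "(r, b) \<in> M" "(r', b) \<in> M" for r r' b
    using M(3) that unfolding inj_on_def by fastforce
  have uniq_blue: "b = b'" if "(r, b) \<in> M" "(r, b') \<in> M" for r b b'
    using M(2) that unfolding inj_on_def by fastforce
  \<comment> \<open>The form in which recurrence is used: the partner function is the forbidden
    injection once all blue points right of \<open>a\<close> have partners between \<open>a\<close>
    and themselves.\<close>
  have no_red: False if "snd ` M = B" "\<And>r b. (r, b) \<in> M \<Longrightarrow> a < b \<Longrightarrow> a < r \<and> r < b" for a
  proof -
    define g where "g b = (THE r. (r, b) \<in> M)" for b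
    have g: "(g b, b) \<in> M" if "b \<in> B" for b
    proof -
      obtain r where "(r, b) \<in> M" using \<open>snd ` M = B\<close> \<open>b \<in> B\<close> by force
      then show ?thesis unfolding g_def by (rule theI) (use uniq_red \<open>(r, b) \<in> M\<close> in blast)
    qed
    show False
    proof (rule exists_blue_without_red[OF rec, of a g])
      show "g b \<in> R \<and> a < g b \<and> g b < b" if "b \<in> B" "a < b" for b
        using g[OF \<open>b \<in> B\<close>] that M(1) \<open>\<And>r b. (r, b) \<in> M \<Longrightarrow> a < b \<Longrightarrow> a < r \<and> r < b\<close> by blast
      show "inj_on g (B \<inter> {a<..})" using g uniq_blue unfolding inj_on_def by (metis IntE)
    qed
  qed
  have no_blue: False if "fst ` M = R" "\<And>r b. (r, b) \<in> M \<Longrightarrow> r < a \<Longrightarrow> b < a \<and> r < b" for a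
  proof -
    define g where "g r = (THE b. (r, b) \<in> M)" for r
    have g: "(r, g r) \<in> M" if "r \<in> R" for r
    proof -
      obtain b where "(r, b) \<in> M" using \<open>fst ` M = R\<close> \<open>r \<in> R\<close> by force
      then show ?thesis unfolding g_def by (rule theI) (use uniq_blue \<open>(r, b) \<in> M\<close> in blast)
    qed
    show False
    proof (rule exists_red_without_blue[OF rec, of a g])
      show "g r \<in> B \<and> g r < a \<and> r < g r" if "r \<in> R" "r < a" for r
        using g[OF \<open>r \<in> R\<close>] that M(1) \<open>\<And>r b. (r, b) \<in> M \<Longrightarrow> r < a \<Longrightarrow> b < a \<and> r < b\<close> by blast
      show "inj_on g (R \<inter> {..<a})" using g uniq_red unfolding inj_on_def by (metis IntE)
    qed
  qed
  have perfect: "fst ` M = R" "snd ` M = B"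
  proof -
    have "fst ` M \<subseteq> R" "snd ` M \<subseteq> B" using M(1) by auto
    have "r \<in> fst ` M" if r: "r \<in> R" for r
    proof (rule ccontr)
      assume c: "r \<notin> fst ` M"
      then have "snd ` M = B" using minimal_matching_unmatched_monochromatic[OF disj mm] r by auto
      then show False
      proof (rule no_red[of r])
        fix r' b assume e: "(r', b) \<in> M" "r < b"
        \<comment> \<open>The edge is no dearer than one from \<open>r\<close> to \<open>b\<close>,
          whose cost is negative; so it is red-blue and no longer than that, and starts to the right
          of \<open>r\<close>.\<close>
        have le: "?f (b - r') \<le> ?f (b - r)"
          by (rule minimal_matching_unmatched_red[OF disj mm e(1) r c])
        have "r' < b" using le f(1)[of "b - r'"] f(2)[of "b - r"] e(2) by force
        moreover have "r \<noteq> r'" using c e by force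
        ultimately show "r < r' \<and> r' < b" using le f(4)[of "b - r" "b - r'"] e(2) by force
      qed
    qed
    moreover have "b \<in> snd ` M" if b: "b \<in> B" for b
    proof (rule ccontr)
      assume c: "b \<notin> snd ` M"
      then have "fst ` M = R" using minimal_matching_unmatched_monochromatic[OF disj mm] b by auto
      then show False
      proof (rule no_blue[of b])
        fix r b' assume e: "(r, b') \<in> M" "r < b"
        have le: "?f (b' - r) \<le> ?f (b - r)"
          by (rule minimal_matching_unmatched_blue[OF disj mm e(1) b c])
        have "r < b'" using le f(1)[of "b' - r"] f(2)[of "b - r"] e(2) by force
        moreover have "b \<noteq> b'" using c e by force
        ultimately show "b' < b \<and> r < b'" using le f(4)[of "b - r" "b' - r"] e(2) by force
      qed
    qed
    ultimately show "fst ` M = R" "snd ` M = B"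
      using \<open>fst ` M \<subseteq> R\<close> \<open>snd ` M \<subseteq> B\<close> by auto
  qed
  have neq: "r \<noteq> b" if "r \<in> R" "b \<in> B" for r b using that disj by auto
  have red_blue: "r0 < b0" if e0: "(r0, b0) \<in> M" for r0 b0
  proof (rule ccontr)
    assume "\<not> r0 < b0"
    then have b0: "b0 < r0" using neq e0 M(1) by force
    show False
    proof (rule no_red[OF perfect(2), of r0])
      fix r b assume e: "(r, b) \<in> M" "r0 < b"
      have "r \<noteq> r0" using e uniq_blue e0 b0 by fastforce
      \<comment> \<open>The blue-red edge \<open>(r0, b0)\<close> is free, so an exchange with it
        bounds the cost of \<open>(r, b)\<close> by that of \<open>(r0, b)\<close>: again
        \<open>(r, b)\<close> is red-blue and starts to the right of \<open>r0\<close>.\<close>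
      then have s: "?f (b - r) \<le> ?f (b0 - r) + ?f (b - r0)"
        using swap[OF e(1) e0] f(1)[of "b0 - r0"] b0 by simp
      have "r < b" using s f(1)[of "b - r"] f(2)[of "b - r0"] f(3)[of "b0 - r"] e(2) by force
      moreover have "r0 < r"
      proof (rule ccontr)
        assume "\<not> r0 < r"
        then have "b - r0 < b - r" using \<open>r \<noteq> r0\<close> by simp
        then have "?f (b - r0) < ?f (b - r)" using f(4)[of "b - r0" "b - r"] e(2) by simp
        then show False using s f(3)[of "b0 - r"] by simp
      qed
      ultimately show "r0 < r \<and> r < b" by simp
    qed
  qed
  have noncross: "\<not> (r < r' \<and> r' < b \<and> b < b')" if e: "(r, b) \<in> M" "(r', b') \<in> M" for r b r' b'
  proof
    assume c: "r < r' \<and> r' < b \<and> b < b'"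
    then have "?f (b - r) + ?f (b' - r') \<le> ?f (b' - r) + ?f (b - r')" using swap[OF e] by auto
    moreover have "?f (b - r') + ?f (b' - r) < ?f (b - r) + ?f (b' - r')"
      using cost_neg_gamma_concave[OF \<gamma>, of "b - r'" "r' - r" "b' - b"] c by simp
    ultimately show False by simp
  qed
  have sub: "M \<subseteq> bracket_matching R B"
  proof
    fix e assume eM: "e \<in> M"
    then obtain r b where e: "e = (r, b)" "r \<in> R" "b \<in> B" "(r, b) \<in> M" using M(1) by auto
    have rb: "r < b" using red_blue e by simp
    \<comment> \<open>Partners of blue points in \<open>{r..t}\<close> lie in
      \<open>{r<..t}\<close>: without crossings no red-blue edge enters from the left of
      \<open>r\<close>, and \<open>r\<close> itself belongs to \<open>b\<close>. The missed point
      \<open>r\<close> yields the strict surplus.\<close>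
    have inner_blue: "card (B \<inter> {r..t}) \<le> card (R \<inter> {r<..t})" if t: "t < b" for t
    proof -
      let ?E = "{e \<in> M. snd e \<in> {r..t}}"
      have "snd ` ?E = B \<inter> {r..t}" using perfect(2) by auto
      then have "card (B \<inter> {r..t}) = card ?E"
        using M(3) by (metis (no_types, lifting) card_image inj_on_subset mem_Collect_eq subsetI)
      also have "\<dots> \<le> card (R \<inter> {r<..t})"
      proof (rule card_inj_on_le[of fst])
        show "inj_on fst ?E" using M(2) by (rule inj_on_subset) auto
        show "fst ` ?E \<subseteq> R \<inter> {r<..t}"
        proof
          fix r' assume "r' \<in> fst ` ?E"
          then obtain b' where b': "(r', b') \<in> M" "r \<le> b'" "b' \<le> t" by auto
          have "r' < b'" "r' \<in> R" "b' \<in> B" using red_blue b' M(1) by auto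
          moreover have "r \<noteq> b'" using neq e(2) \<open>b' \<in> B\<close> by simp
          moreover have "r \<noteq> r'"
          proof
            assume "r = r'"
            then have "b' = b" using uniq_blue b'(1) e(4) by blast
            then show False using b' t by simp
          qed
          moreover have "\<not> r' < r"
            using noncross[OF b'(1) e(4)] b' t \<open>r \<noteq> b'\<close> by auto
          ultimately show "r' \<in> R \<inter> {r<..t}" using b' by auto
        qed
      qed (rule locally_finite_pointsD[OF lfR])
      finally show ?thesis .
    qed
    have c1: "card (B \<inter> {r..t}) < card (R \<inter> {r..t})" if "r \<le> t" "t < b" for t
      using inner_blue[of t] that card_points_split(1)[OF lfR, of r r t]
        card_points_singleton(1)[of r R] e(2) by simp
    \<comment> \<open>The same reasoning in both directions: no edge leaves \<open>{r..b}\<close> on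
      either side, so the edges inside pair up its two colours.\<close>
    have "card (B \<inter> {r..b}) = card (R \<inter> {r..b})"
    proof -
      let ?E = "{e \<in> M. snd e \<in> {r..b}}"
      have "snd ` ?E = B \<inter> {r..b}" using perfect(2) by auto
      moreover have "fst ` ?E = R \<inter> {r..b}"
      proof
        show "fst ` ?E \<subseteq> R \<inter> {r..b}"
        proof
          fix r' assume "r' \<in> fst ` ?E"
          then obtain b' where b': "(r', b') \<in> M" "r \<le> b'" "b' \<le> b" by auto
          have "r' < b'" "r' \<in> R" "b' \<in> B" using red_blue b' M(1) by auto
          moreover have "r \<noteq> b'" using neq e \<open>b' \<in> B\<close> by simp
          moreover have "\<not> r' < r"
          proof
            assume "r' < r"
            then have "b' \<noteq> b" using uniq_red e b' by blast
            then show False using noncross[OF b'(1) e(4)] b' \<open>r' < r\<close> \<open>r \<noteq> b'\<close> by auto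
          qed
          ultimately show "r' \<in> R \<inter> {r..b}" using b' by auto
        qed
        show "R \<inter> {r..b} \<subseteq> fst ` ?E"
        proof
          fix r' assume r': "r' \<in> R \<inter> {r..b}"
          then obtain b' where b': "(r', b') \<in> M" using perfect(1) by force
          have "r' < b'" using red_blue b' by simp
          moreover have "b' \<le> b"
          proof (cases "r' = r")
            case True
            then show ?thesis using uniq_blue b' e by blast
          next
            case False
            moreover have "r' \<noteq> b" using neq r' e by auto
            ultimately show ?thesis using noncross[OF e(4) b'] r' by auto
          qed
          ultimately show "r' \<in> fst ` ?E" using b' r' by (auto intro!: rev_image_eqI)
        qed
      qed
      moreover have "card (fst ` ?E) = card ?E" "card (snd ` ?E) = card ?E"
        by (rule card_image, rule inj_on_subset[OF M(2)], auto)
           (rule card_image, rule inj_on_subset[OF M(3)], auto)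
      ultimately show ?thesis by simp
    qed
    then show "e \<in> bracket_matching R B"
      unfolding bracket_matching_def using e rb c1 neq by auto
  qed
  moreover have "bracket_matching R B \<subseteq> M"
  proof
    fix e assume e: "e \<in> bracket_matching R B"
    obtain r b where rb: "e = (r, b)" by (cases e)
    then have "r \<in> R" using e bracket_subset by auto
    then obtain b' where "(r, b') \<in> M" using perfect(1) by force
    moreover from this have "b' = b" using sub bracket_fst_unique e rb by blast
    ultimately show "e \<in> M" using rb by simp
  qed
  ultimately show ?thesis by blast
qed

end

section \<open>Non-negative exponents\<close>

locale unbounded_points =
  fixes R B :: "real set"
  assumes countR: "countable R" and countB: "countable B"
    and unboundedR: "\<And>z. \<exists>r\<in>R. z < r" and unboundedB: "\<And>z. \<exists>b\<in>B. b < z"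
begin

text \<open>Finite stages of a construction. Red points far to the right and blue points far to the
  left are always available, so every stage extends to any prescribed point.\<close>

definition partial :: "edge set \<Rightarrow> bool" where
  "partial F \<longleftrightarrow> finite F \<and> F \<subseteq> R \<times> B \<and> inj_on fst F \<and> inj_on snd F \<and> (\<forall>e\<in>F. snd e < fst e)"

definition blue_red_matchings :: "edge set set" where
  "blue_red_matchings = {M. M \<subseteq> R \<times> B \<and> inj_on fst M \<and> inj_on snd M \<and>
     fst ` M = R \<and> snd ` M = B \<and> (\<forall>e\<in>M. snd e < fst e)}"

lemma partial_insert:
  assumes "partial F" "r \<in> R" "b \<in> B" "b < r" "r \<notin> fst ` F" "b \<notin> snd ` F"
  shows "partial (insert (r, b) F)"
  using assms unfolding partial_def inj_on_insert by auto

lemma fresh_blue: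
  assumes "finite X"
  obtains b where "b \<in> B" "b < r" "b \<notin> X"
proof -
  obtain b where "b \<in> B" "b < Min (insert r X)" using unboundedB by blast
  then show ?thesis using that[of b] assms by auto
qed

lemma fresh_red:
  assumes "finite X"
  obtains r where "r \<in> R" "b < r" "r \<notin> X"
proof -
  obtain r where "r \<in> R" "Max (insert b X) < r" using unboundedR by blast
  then show ?thesis using that[of r] assms by auto
qed

lemma partial_extend_red:
  assumes "partial F" "r \<in> R"
  shows "\<exists>F'. partial F' \<and> F \<subseteq> F' \<and> r \<in> fst ` F'"
proof (cases "r \<in> fst ` F")
  case False
  obtain b where "b \<in> B" "b < r" "b \<notin> snd ` F"
    using fresh_blue[of "snd ` F" r] assms unfolding partial_def by auto
  then have "partial (insert (r, b) F)" using partial_insert assms False by blast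
  then show ?thesis by (metis fst_conv image_eqI insertI1 subset_insertI)
qed (use assms in auto)

lemma partial_extend_blue:
  assumes "partial F" "b \<in> B"
  shows "\<exists>F'. partial F' \<and> F \<subseteq> F' \<and> b \<in> snd ` F'"
proof (cases "b \<in> snd ` F")
  case False
  obtain r where "r \<in> R" "b < r" "r \<notin> fst ` F"
    using fresh_red[of "fst ` F" b] assms unfolding partial_def by auto
  then have "partial (insert (r, b) F)" using partial_insert assms False by blast
  then show ?thesis by (metis snd_conv image_eqI insertI1 subset_insertI)
qed (use assms in auto)

lemma partial_extend_avoid:
  assumes F: "partial F" and L: "inj_on fst L"
  shows "\<exists>F'. partial F' \<and> F \<subseteq> F' \<and> \<not> F' \<subseteq> L"
proof -
  have fin: "finite (fst ` F)" "finite (snd ` F)" using F unfolding partial_def by auto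
  obtain r where r: "r \<in> R" "r \<notin> fst ` F" using fresh_red[OF fin(1)] by metis
  obtain b where b: "b \<in> B" "b < r" "b \<notin> snd ` F" using fresh_blue[OF fin(2)] by metis
  obtain b' where b': "b' \<in> B" "b' < r" "b' \<notin> insert b (snd ` F)"
    using fresh_blue[of "insert b (snd ` F)"] fin by auto
  have "(r, b) \<notin> L \<or> (r, b') \<notin> L" using L b'(3) unfolding inj_on_def by fastforce
  moreover have "partial (insert (r, b) F)" "partial (insert (r, b') F)"
    using partial_insert[OF F r(1)] r b b' by auto
  ultimately show ?thesis by (metis insert_subset subset_insertI)
qed

lemma uncountable_blue_red_matchings: "uncountable blue_red_matchings"
proof
  assume "countable blue_red_matchings"
  define L where "L = from_nat_into blue_red_matchings"
  define pR where "pR = from_nat_into R"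
  define pB where "pB = from_nat_into B"
  have ne: "R \<noteq> {}" "B \<noteq> {}" using unboundedR unboundedB by blast+
  have pR: "pR n \<in> R" and pB: "pB n \<in> B" for n
    unfolding pR_def pB_def by (rule from_nat_into[OF ne(1)], rule from_nat_into[OF ne(2)])
  \<comment> \<open>Stage \<open>n\<close> takes in the \<open>n\<close>-th red and blue points and
    an edge outside \<open>L n\<close>. The guard \<open>inj_on fst (L n)\<close> is there because
    \<open>blue_red_matchings\<close> is not yet known to be nonempty, so \<open>L n\<close> need
    not belong to it.\<close>
  have "\<exists>F'. partial F' \<and> F \<subseteq> F' \<and> pR n \<in> fst ` F' \<and> pB n \<in> snd ` F' \<and> (inj_on fst (L n) \<longrightarrow> \<not> F' \<subseteq> L n)"
    if F: "partial F" for F n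
  proof -
    obtain F1 where F1: "partial F1" "F \<subseteq> F1" "pR n \<in> fst ` F1" using partial_extend_red[OF F pR] by blast
    obtain F2 where F2: "partial F2" "F1 \<subseteq> F2" "pB n \<in> snd ` F2" using partial_extend_blue[OF F1(1) pB] by blast
    obtain F3 where "partial F3" "F2 \<subseteq> F3" "inj_on fst (L n) \<longrightarrow> \<not> F3 \<subseteq> L n"
      using partial_extend_avoid[OF F2(1), of "L n"] F2(1) by blast
    then show ?thesis using F1 F2 by (intro exI[of _ F3]) blast
  qed
  moreover have "partial {}" unfolding partial_def by simp
  ultimately obtain F where F: "\<And>n. partial (F n)" "\<And>n. F n \<subseteq> F (Suc n) \<and> pR n \<in> fst ` F (Suc n) \<and>
      pB n \<in> snd ` F (Suc n) \<and> (inj_on fst (L n) \<longrightarrow> \<not> F (Suc n) \<subseteq> L n)"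
    using dependent_nat_choice[of "\<lambda>n. partial" "\<lambda>n F F'. F \<subseteq> F' \<and> pR n \<in> fst ` F' \<and> pB n \<in> snd ` F' \<and>
      (inj_on fst (L n) \<longrightarrow> \<not> F' \<subseteq> L n)"] by metis
  define M where "M = (\<Union>n. F n)"
  have chain: "F m \<subseteq> F n \<or> F n \<subseteq> F m" for m n
    using lift_Suc_mono_le[of F] F(2) by (metis nat_le_linear)
  have MRB: "M \<subseteq> R \<times> B" "\<forall>e\<in>M. snd e < fst e"
    unfolding M_def using F(1) unfolding partial_def by blast+
  have "R \<subseteq> fst ` M"
  proof
    fix r assume "r \<in> R"
    then obtain n where "r = pR n" unfolding pR_def using from_nat_into_surj[OF countR] by metis
    then show "r \<in> fst ` M" using F(2)[of n] unfolding M_def by auto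
  qed
  moreover have "B \<subseteq> snd ` M"
  proof
    fix b assume "b \<in> B"
    then obtain n where "b = pB n" unfolding pB_def using from_nat_into_surj[OF countB] by metis
    then show "b \<in> snd ` M" using F(2)[of n] unfolding M_def by auto
  qed
  moreover have "inj_on fst M" "inj_on snd M"
    unfolding M_def by (rule inj_on_UNION_chain[OF chain]; use F(1) in \<open>simp add: partial_def\<close>)+
  ultimately have "M \<in> blue_red_matchings"
    unfolding blue_red_matchings_def using MRB by force
  then obtain n where "M = L n"
    unfolding L_def using from_nat_into_surj[OF \<open>countable blue_red_matchings\<close>] by metis
  then have "\<not> F (Suc n) \<subseteq> M" using F(2)[of n] \<open>inj_on fst M\<close> by auto
  then show False unfolding M_def by blast
qed

end

section \<open>Positive exponents and the one-sided limits at 1\<close>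

lemma cost_nonneg: "\<gamma> > 0 \<Longrightarrow> 0 \<le> cost \<gamma> x"
  by (simp add: cost_def)

lemma total_cost_blue_red:
  assumes "\<And>e. e \<in> M \<Longrightarrow> snd e < fst e"
  shows "total_cost (cost \<gamma>) M = 0"
  unfolding total_cost_def by (rule sum.neutral) (use assms in \<open>force simp: cost_def\<close>)

lemma total_cost_nonneg: "\<gamma> > 0 \<Longrightarrow> 0 \<le> total_cost (cost \<gamma>) M"
  unfolding total_cost_def by (rule sum_nonneg) (auto simp: cost_nonneg)

lemma locally_finite_points_countable:
  assumes "locally_finite_points X" shows "countable X"
proof -
  have "X = (\<Union>n::nat. X \<inter> {- real n..real n})"
    by (auto intro: exI[of _ "nat \<lceil>\<bar>x\<bar>\<rceil>" for x]) (meson abs_le_iff minus_le_iff real_nat_ceiling_ge)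
  moreover have "countable (\<Union>n::nat. X \<inter> {- real n..real n})"
    using locally_finite_pointsD(1)[OF assms] by (intro countable_UN) (auto intro: countable_finite)
  ultimately show ?thesis by simp
qed

lemma finite_minimal_blue_red:
  assumes "R \<inter> B = {}" "M \<subseteq> R \<times> B" "inj_on fst M" "inj_on snd M" "fst ` M = R" "snd ` M = B"
    and br: "\<forall>e\<in>M. snd e < fst e" and "\<gamma> > 0" and S: "admissible R B M S"
  shows "finite_minimal (cost \<gamma>) (R \<inter> S) (B \<inter> S) (restrict_matching M S)"
proof (rule finite_minimal_restrict_perfectI[OF assms(1) _ _ S])
  show "matching R B M" using assms matching_iff by auto
  show "unmatched R B M = {}" using assms unmatched_empty_iff by auto
  show "total_cost (cost \<gamma>) E \<le> total_cost (cost \<gamma>) N" if "E \<subseteq> M" for E N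
  proof -
    have "total_cost (cost \<gamma>) E = 0" by (rule total_cost_blue_red) (use br that in blast)
    then show ?thesis using total_cost_nonneg[OF \<open>\<gamma> > 0\<close>, of N] by simp
  qed
qed

text \<open>The matchings do not depend on \<gamma> and are minimal for every positive exponent at
  once, so the limiting versions only ask that exponents close to 1 be positive.\<close>

lemma uncountable_minimal_positive:
  assumes "R \<inter> B = {}" "unbounded_points R B"
  shows "\<gamma> > 0 \<Longrightarrow> uncountable {M. gamma_minimal \<gamma> R B M}"
    and "uncountable {M. one_plus_minimal R B M}" and "uncountable {M. one_minus_minimal R B M}"
proof -
  interpret unbounded_points R B by fact
  have m: "matching R B M" if "M \<in> blue_red_matchings" for M
    using that unfolding blue_red_matchings_def matching_iff[OF assms(1)] by auto
  have min: "finite_minimal (cost \<gamma>) (R \<inter> S) (B \<inter> S) (restrict_matching M S)"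
    if "M \<in> blue_red_matchings" "\<gamma> > 0" "admissible R B M S" for M \<gamma> S
    using that finite_minimal_blue_red[OF assms(1)] unfolding blue_red_matchings_def by blast
  show "uncountable {M. gamma_minimal \<gamma> R B M}" if "\<gamma> > 0"
  proof -
    have "blue_red_matchings \<subseteq> {M. gamma_minimal \<gamma> R B M}"
      unfolding gamma_minimal_def minimal_matching_def using m min that by blast
    then show ?thesis using uncountable_blue_red_matchings countable_subset by blast
  qed
  have "blue_red_matchings \<subseteq> {M. one_plus_minimal R B M}"
  proof
    fix M assume M: "M \<in> blue_red_matchings"
    have "\<forall>\<^sub>F \<gamma> in at_right (1::real). 0 < \<gamma>" by (rule eventually_at_right_less[THEN eventually_mono]) simp
    then have "\<forall>\<^sub>F \<gamma> in at_right 1. finite_minimal (cost \<gamma>) (R \<inter> S) (B \<inter> S) (restrict_matching M S)"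
      if "admissible R B M S" for S
      by eventually_elim (use min[OF M] that in blast)
    then show "M \<in> {M. one_plus_minimal R B M}" unfolding one_plus_minimal_def using m[OF M] by blast
  qed
  then show "uncountable {M. one_plus_minimal R B M}"
    using uncountable_blue_red_matchings countable_subset by blast
  have "blue_red_matchings \<subseteq> {M. one_minus_minimal R B M}"
  proof
    fix M assume M: "M \<in> blue_red_matchings"
    have "\<forall>\<^sub>F \<gamma> in at_left (1::real). \<gamma> \<in> {0<..<1}" by (rule eventually_at_left_real) simp
    then have "\<forall>\<^sub>F \<gamma> in at_left 1. finite_minimal (cost \<gamma>) (R \<inter> S) (B \<inter> S) (restrict_matching M S)"
      if "admissible R B M S" for S
      by eventually_elim (use min[OF M] that in auto)
    then show "M \<in> {M. one_minus_minimal R B M}" unfolding one_minus_minimal_def using m[OF M] by blast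
  qed
  then show "uncountable {M. one_minus_minimal R B M}"
    using uncountable_blue_red_matchings countable_subset by blast
qed

text \<open>Three consecutive unit cells: red only, empty, blue only. Red points of the first cell
  have no blue point within distance 1 on their right, and blue points of the last have no red point
  within distance 1 on their left, so short red-blue edges leave both free; the middle cell is a
  barrier for such edges.\<close>

definition isolating_pattern :: "real set \<Rightarrow> real set \<Rightarrow> int \<Rightarrow> bool" where
  "isolating_pattern R B n \<longleftrightarrow>
     R \<inter> {n..<n+1} \<noteq> {} \<and> R \<inter> {n+1..<n+3} = {} \<and>
     B \<inter> {n..<n+2} = {} \<and> B \<inter> {n+2..<n+3} \<noteq> {}"

definition patterned :: "real set \<Rightarrow> real set \<Rightarrow> bool" where
  "patterned R B \<longleftrightarrow> (\<forall>z::real. (\<exists>n. z \<le> n \<and> isolating_pattern R B n) \<and> (\<exists>n. n \<le> z \<and> isolating_pattern R B n))"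

section \<open>Optimal families of red-blue edges shorter than 1\<close>

definition short_matching :: "real set \<Rightarrow> real set \<Rightarrow> edge set \<Rightarrow> bool" where
  "short_matching R B M \<longleftrightarrow> M \<subseteq> R \<times> B \<and> inj_on fst M \<and> inj_on snd M \<and>
     (\<forall>(x, y)\<in>M. x < y \<and> y < x + 1)"

text \<open>The replacement \<open>N\<close> may use points that \<open>M\<close> leaves free and
  need not cover those of \<open>E\<close>. This freedom matters because a competing perfect
  matching may break short edges and form new ones with points that were joined by blue-red
  edges.\<close>

definition locally_optimal :: "(real \<Rightarrow> real) \<Rightarrow> real set \<Rightarrow> real set \<Rightarrow> edge set \<Rightarrow> bool" where
  "locally_optimal f R B M \<longleftrightarrow> short_matching R B M \<and>
     (\<forall>E N. finite E \<longrightarrow> E \<subseteq> M \<longrightarrow> finite N \<longrightarrow> short_matching R B N \<longrightarrow>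
        fst ` N \<inter> fst ` (M - E) = {} \<longrightarrow> snd ` N \<inter> snd ` (M - E) = {} \<longrightarrow>
        total_cost f E \<le> total_cost f N)"

lemma short_matching_union:
  assumes "short_matching R B M" "short_matching R B N"
    and "fst ` N \<inter> fst ` M = {}" "snd ` N \<inter> snd ` M = {}"
  shows "short_matching R B (M \<union> N)"
  using assms unfolding short_matching_def inj_on_Un by blast

lemma short_matching_subset:
  assumes "short_matching R B M" "N \<subseteq> M" shows "short_matching R B N"
  using assms unfolding short_matching_def by (auto intro: inj_on_subset)

text \<open>The labels \<open>c\<close> cut the points into finite windows that short edges do not
  leave. Optimal choices in the separate windows are optimal under every finite exchange, because
  both the cost and the exchange split over the windows.\<close>

lemma exists_locally_optimal:
  fixes c :: "real \<Rightarrow> 'k"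
  assumes fin: "\<And>k. finite ((R \<union> B) \<inter> c -` {k})"
    and win: "\<And>x y. x \<in> R \<Longrightarrow> y \<in> B \<Longrightarrow> x < y \<Longrightarrow> y < x + 1 \<Longrightarrow> c x = c y"
  shows "\<exists>M. locally_optimal f R B M"
proof -
  define A where "A k = {m. short_matching R B m \<and> (\<forall>e\<in>m. c (fst e) = k)}" for k
  have sub: "m \<subseteq> ((R \<union> B) \<inter> c -` {k}) \<times> ((R \<union> B) \<inter> c -` {k})" if m: "m \<in> A k" for m k
  proof
    fix e assume "e \<in> m"
    then have "fst e \<in> R" "snd e \<in> B" "fst e < snd e" "snd e < fst e + 1" "c (fst e) = k"
      using m unfolding A_def short_matching_def by auto
    then show "e \<in> ((R \<union> B) \<inter> c -` {k}) \<times> ((R \<union> B) \<inter> c -` {k})"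
      using win[of "fst e" "snd e"] by (cases e) auto
  qed
  have finA: "finite (A k)" for k
    by (rule finite_subset[of _ "Pow (((R \<union> B) \<inter> c -` {k}) \<times> ((R \<union> B) \<inter> c -` {k}))"])
      (use sub fin in auto)
  have neA: "A k \<noteq> {}" for k
    unfolding A_def short_matching_def by (auto intro!: exI[of _ "{}"])
  define m where "m k = arg_min_on (total_cost f) (A k)" for k
  have mA: "m k \<in> A k" for k unfolding m_def by (rule arg_min_if_finite(1)[OF finA neA])
  have m_min: "total_cost f (m k) \<le> total_cost f n" if "n \<in> A k" for n k
    using arg_min_if_finite(2)[OF finA neA, of k "total_cost f"] that unfolding m_def by (meson not_less)
  have finm: "finite (m k)" for k
    by (rule finite_subset[OF sub[OF mA]]) (use fin in auto)
  define M where "M = (\<Union>k. m k)"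
  \<comment> \<open>The windows do not interact: \<open>m k\<close> is recovered as the part of
    \<open>M\<close> with label \<open>k\<close>.\<close>
  have mk: "m k = {e \<in> M. c (fst e) = k}" for k
  proof -
    have "c (fst e) = j" if "e \<in> m j" for e j using mA[of j] that unfolding A_def by blast
    then show ?thesis unfolding M_def by auto
  qed
  have sm: "short_matching R B (m k)" for k using mA unfolding A_def by blast
  have sM: "short_matching R B M"
  proof -
    have "M \<subseteq> R \<times> B" "\<forall>(x, y)\<in>M. x < y \<and> y < x + 1"
      using sm unfolding short_matching_def M_def by blast+
    moreover have "inj_on fst M"
    proof (rule inj_onI)
      fix e e' assume e: "e \<in> M" "e' \<in> M" "fst e = fst e'"
      then have "e \<in> m (c (fst e))" "e' \<in> m (c (fst e))" unfolding mk by auto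
      then show "e = e'" using sm e(3) unfolding short_matching_def inj_on_def by blast
    qed
    moreover have "inj_on snd M"
    proof (rule inj_onI)
      fix e e' assume e: "e \<in> M" "e' \<in> M" "snd e = snd e'"
      then have "c (fst e) = c (snd e)" "c (fst e') = c (snd e')"
        using \<open>M \<subseteq> R \<times> B\<close> \<open>\<forall>(x, y)\<in>M. x < y \<and> y < x + 1\<close> by (auto intro!: win)
      then have "e \<in> m (c (fst e))" "e' \<in> m (c (fst e))" unfolding mk using e by auto
      then show "e = e'" using sm e(3) unfolding short_matching_def inj_on_def by blast
    qed
    ultimately show ?thesis unfolding short_matching_def by blast
  qed
  have "total_cost f E \<le> total_cost f N"
    if E: "finite E" "E \<subseteq> M" and N: "finite N" "short_matching R B N"
      and dis: "fst ` N \<inter> fst ` (M - E) = {}" "snd ` N \<inter> snd ` (M - E) = {}" for E N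
  proof -
    define g where "g = (\<lambda>(x, y). f (y - x))"
    define K where "K = (c \<circ> fst) ` (E \<union> N)"
    have K: "finite K" "(c \<circ> fst) ` E \<subseteq> K" "(c \<circ> fst) ` N \<subseteq> K" unfolding K_def using E N by auto
    have "sum g {e \<in> E. (c \<circ> fst) e = k} \<le> sum g {e \<in> N. (c \<circ> fst) e = k}" for k
    proof -
      define Ek where "Ek = {e \<in> E. (c \<circ> fst) e = k}"
      define Nk where "Nk = {e \<in> N. (c \<circ> fst) e = k}"
      have Ekm: "Ek \<subseteq> m k" unfolding mk Ek_def using E by auto
      have "m k - Ek \<subseteq> M - E" unfolding mk Ek_def by auto
      then have d: "fst ` Nk \<inter> fst ` (m k - Ek) = {}" "snd ` Nk \<inter> snd ` (m k - Ek) = {}"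
        using dis unfolding Nk_def by blast+
      have sN: "short_matching R B Nk" using N(2) by (rule short_matching_subset) (auto simp: Nk_def)
      have sm': "short_matching R B (m k - Ek)" using sm by (rule short_matching_subset) auto
      \<comment> \<open>Within window \<open>k\<close> the exchange yields another member of
        \<open>A k\<close>, so minimality of \<open>m k\<close> bounds the cost of \<open>Ek\<close>
        by that of \<open>Nk\<close>.\<close>
      have "(m k - Ek) \<union> Nk \<in> A k"
        unfolding A_def using short_matching_union[OF sm' sN d] mA[of k] unfolding A_def Nk_def by auto
      then have "sum g (m k) \<le> sum g ((m k - Ek) \<union> Nk)"
        using m_min unfolding total_cost_def g_def by blast
      also have "\<dots> = sum g (m k - Ek) + sum g Nk"
        by (rule sum.union_disjoint) (use finm N d in \<open>auto simp: Nk_def\<close>)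
      finally show ?thesis
        using sum.subset_diff[OF Ekm finm, of g] unfolding Ek_def Nk_def by simp
    qed
    then have "(\<Sum>k\<in>K. sum g {e \<in> E. (c \<circ> fst) e = k}) \<le> (\<Sum>k\<in>K. sum g {e \<in> N. (c \<circ> fst) e = k})"
      by (rule sum_mono)
    then show ?thesis
      using sum.group[OF E(1) K(1,2), of g] sum.group[OF N(1) K(1,3), of g]
      unfolding total_cost_def g_def by simp
  qed
  then show ?thesis unfolding locally_optimal_def using sM by blast
qed

context points
begin

lemma patterned_unbounded_points:
  assumes "patterned R B"
  shows "unbounded_points R B"
proof
  show "countable R" "countable B" using locally_finite_points_countable lfR lfB by auto
  fix z :: real
  obtain n where "z + 1 \<le> real_of_int n" "isolating_pattern R B n" using assms unfolding patterned_def by blast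
  then obtain r where "r \<in> R" "real_of_int n \<le> r" unfolding isolating_pattern_def by auto
  then show "\<exists>r\<in>R. z < r" using \<open>z + 1 \<le> n\<close> by (intro bexI[of _ r]) auto
  obtain n where "real_of_int n \<le> z - 3" "isolating_pattern R B n" using assms unfolding patterned_def by blast
  then obtain b where "b \<in> B" "b < real_of_int n + 3" unfolding isolating_pattern_def by auto
  then show "\<exists>b\<in>B. b < z" using \<open>n \<le> z - 3\<close> by (intro bexI[of _ b]) auto
qed

lemma patterned_locally_optimal:
  assumes "patterned R B"
  shows "\<exists>M. locally_optimal f R B M"
proof -
  define gap where "gap n \<longleftrightarrow> (R \<union> B) \<inter> {real_of_int n..<n+1} = {}" for n :: int
  have gap: "gap (n + 1)" if "isolating_pattern R B n" for n
    using that unfolding gap_def isolating_pattern_def by (force simp: disjoint_iff)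
  \<comment> \<open>Labelling \<open>x\<close> by the set of all gaps that start at or before it
    makes the label change exactly when a gap is entered, without enumerating the gaps.\<close>
  define c where "c x = {n. gap n \<and> real_of_int n \<le> x}" for x
  show ?thesis
  proof (rule exists_locally_optimal[of R B c])
    fix k
    show "finite ((R \<union> B) \<inter> c -` {k})"
    proof (cases "(R \<union> B) \<inter> c -` {k} = {}")
      case False
      then obtain x where x: "c x = k" by auto
      obtain n where n: "real_of_int n \<le> x - 1" "isolating_pattern R B n" using assms unfolding patterned_def by blast
      obtain n' where n': "x \<le> real_of_int n'" "isolating_pattern R B n'" using assms unfolding patterned_def by blast
      \<comment> \<open>A gap starting at or left of \<open>x\<close> and one starting to its right
        enclose the whole window.\<close>
      have "n + 1 \<in> k" "n' + 1 \<notin> k" using x gap n n' unfolding c_def by auto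
      then have "(R \<union> B) \<inter> c -` {k} \<subseteq> (R \<union> B) \<inter> {real_of_int n + 1..real_of_int n' + 1}"
        using gap[OF n'(2)] unfolding c_def by auto
      then show ?thesis using locally_finite_pointsD(1)[OF lfRB] finite_subset by blast
    qed simp
  next
    fix x y assume xy: "x \<in> R" "y \<in> B" "x < y" "y < x + 1"
    \<comment> \<open>A gap starting in \<open>{x<..y}\<close> would contain the point
      \<open>y\<close>, because \<open>y < x + 1\<close>.\<close>
    have "real_of_int n \<le> x" if "gap n" "real_of_int n \<le> y" for n
    proof (rule ccontr)
      assume "\<not> ?thesis"
      then have "y \<in> (R \<union> B) \<inter> {real_of_int n..<n+1}" using that xy by auto
      then show False using that(1) unfolding gap_def by blast
    qed
    then show "c x = c y" unfolding c_def using xy(3) by force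
  qed
qed

text \<open>Fixed short edges \<open>M0\<close> are completed by an arbitrary perfect blue-red
  matching of the points left over, which are unbounded in the required directions because every
  pattern leaves a red and a blue point free. The added edges cost nothing, so minimality rests on
  \<open>M0\<close> alone.\<close>

lemma uncountable_minimal_zero:
  assumes pat: "patterned R B"
  shows "uncountable {M. gamma_minimal 0 R B M \<and> \<not> scale_invariant_matching (cost 0) R B M}"
proof -
  let ?f = "cost 0"
  obtain M0 where M0: "locally_optimal ?f R B M0" using patterned_locally_optimal[OF pat] by blast
  have sM0: "short_matching R B M0" using M0 unfolding locally_optimal_def by blast
  then have M0': "M0 \<subseteq> R \<times> B" "inj_on fst M0" "inj_on snd M0" "\<And>x y. (x, y) \<in> M0 \<Longrightarrow> x < y \<and> y < x + 1"
    unfolding short_matching_def by auto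
  define R1 where "R1 = R - fst ` M0"
  define B1 where "B1 = B - snd ` M0"
  have left: "\<exists>r\<in>R1. \<exists>b\<in>B1. real_of_int n \<le> r \<and> r < b \<and> b < real_of_int n + 3" if n: "isolating_pattern R B n" for n
  proof -
    obtain r where r: "r \<in> R" "real_of_int n \<le> r" "r < real_of_int n + 1" using n unfolding isolating_pattern_def by auto
    obtain b where b: "b \<in> B" "real_of_int n + 2 \<le> b" "b < real_of_int n + 3" using n unfolding isolating_pattern_def by auto
    have "r \<notin> fst ` M0"
    proof
      assume "r \<in> fst ` M0"
      then obtain y where y: "(r, y) \<in> M0" by auto
      then have "y \<in> B" using M0'(1) by blast
      then have "y \<in> B \<inter> {real_of_int n..<n+2}" using M0'(4)[OF y] r by simp
      moreover have "B \<inter> {real_of_int n..<n+2} = {}" using n unfolding isolating_pattern_def by simp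
      ultimately show False by (metis emptyE)
    qed
    moreover have "b \<notin> snd ` M0"
    proof
      assume "b \<in> snd ` M0"
      then obtain x where x: "(x, b) \<in> M0" by auto
      then have "x \<in> R" using M0'(1) by blast
      then have "x \<in> R \<inter> {real_of_int n+1..<n+3}" using M0'(4)[OF x] b by simp
      moreover have "R \<inter> {real_of_int n+1..<n+3} = {}" using n unfolding isolating_pattern_def by simp
      ultimately show False by (metis emptyE)
    qed
    ultimately show ?thesis unfolding R1_def B1_def using r b by (intro bexI[of _ r] bexI[of _ b]) auto
  qed
  interpret U: unbounded_points R1 B1
  proof
    show "countable R1" "countable B1"
      unfolding R1_def B1_def using locally_finite_points_countable lfR lfB by auto
    fix z :: real
    obtain n where n: "z + 1 \<le> real_of_int n" "isolating_pattern R B n" using assms unfolding patterned_def by blast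
    then show "\<exists>r\<in>R1. z < r" using left[OF n(2)] by force
    obtain n where n: "real_of_int n \<le> z - 3" "isolating_pattern R B n" using assms unfolding patterned_def by blast
    then show "\<exists>b\<in>B1. b < z" using left[OF n(2)] by force
  qed
  have good: "gamma_minimal 0 R B (M0 \<union> N) \<and> \<not> scale_invariant_matching ?f R B (M0 \<union> N)"
    if N: "N \<in> U.blue_red_matchings" for N
  proof -
    have N': "N \<subseteq> R1 \<times> B1" "inj_on fst N" "inj_on snd N" "fst ` N = R1" "snd ` N = B1"
      "\<And>e. e \<in> N \<Longrightarrow> snd e < fst e"
      using N unfolding U.blue_red_matchings_def by auto
    let ?M = "M0 \<union> N"
    have MRB: "?M \<subseteq> R \<times> B" using M0'(1) N'(1) unfolding R1_def B1_def by auto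
    have inj: "inj_on fst ?M" "inj_on snd ?M"
      unfolding inj_on_Un using M0' N' unfolding R1_def B1_def by blast+
    have match: "matching R B ?M" using MRB inj matching_iff[OF disj] by blast
    have perf: "unmatched R B ?M = {}"
      unfolding unmatched_empty_iff[OF disj MRB] using N'(4,5) M0'(1) unfolding R1_def B1_def image_Un by auto
    have "gamma_minimal 0 R B ?M"
      unfolding gamma_minimal_def minimal_matching_def
    proof (intro conjI allI impI match)
      fix S assume S: "admissible R B ?M S"
      show "finite_minimal ?f (R \<inter> S) (B \<inter> S) (restrict_matching ?M S)"
      proof (rule finite_minimal_restrict_perfectI[OF disj match perf S])
        fix E N' assume E: "finite E" "E \<subseteq> ?M"
          and N': "inj_on fst N'" "inj_on snd N'" "fst ` N' = fst ` E" "snd ` N' = snd ` E"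
        have finN': "finite N'" using finite_imageD[of fst N'] N' E(1) by simp
        define E0 where "E0 = E \<inter> M0"
        \<comment> \<open>Only red-blue edges shorter than 1 have a negative logarithm; discarding
          all other edges of the competitor does not raise its cost.\<close>
        define N0 where "N0 = {(x, y) \<in> N'. x < y \<and> y < x + 1}"
        have N'RB: "N' \<subseteq> R \<times> B"
        proof
          fix e assume "e \<in> N'"
          then have "fst e \<in> fst ` E" "snd e \<in> snd ` E" using N' by blast+
          then have "fst e \<in> R" "snd e \<in> B" using E(2) MRB by auto
          then show "e \<in> R \<times> B" by (cases e) simp
        qed
        have "total_cost ?f E0 \<le> total_cost ?f N0"
        proof -
          have "finite E0" "E0 \<subseteq> M0" "finite N0" unfolding E0_def N0_def using E finN' by (auto intro: rev_finite_subset)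
          moreover have "short_matching R B N0"
            unfolding short_matching_def N0_def using N'RB N' by (auto intro: inj_on_subset)
          \<comment> \<open>The competitor lives on the endpoints of \<open>E\<close>, which are
            disjoint from those of the remaining edges of \<open>M0\<close> since the projections
            are injective.\<close>
          moreover have "fst ` N0 \<inter> fst ` (M0 - E0) = {}"
          proof -
            have "fst ` N0 \<subseteq> fst ` E" using N'(3) unfolding N0_def by auto
            moreover have "fst ` E \<inter> fst ` (M0 - E) = {}"
              using inj_on_image_Int[OF inj(1), of E "M0 - E"] E(2) by auto
            moreover have "M0 - E0 = M0 - E" unfolding E0_def by auto
            ultimately show ?thesis by auto
          qed
          moreover have "snd ` N0 \<inter> snd ` (M0 - E0) = {}"
          proof -
            have "snd ` N0 \<subseteq> snd ` E" using N'(4) unfolding N0_def by auto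
            moreover have "snd ` E \<inter> snd ` (M0 - E) = {}"
              using inj_on_image_Int[OF inj(2), of E "M0 - E"] E(2) by auto
            moreover have "M0 - E0 = M0 - E" unfolding E0_def by auto
            ultimately show ?thesis by auto
          qed
          ultimately show ?thesis using M0 unfolding locally_optimal_def by blast
        qed
        moreover have "total_cost ?f E = total_cost ?f E0"
          unfolding total_cost_def
        proof (rule sum.mono_neutral_right[OF E(1)])
          show "\<forall>e\<in>E - E0. (case e of (x, y) \<Rightarrow> ?f (y - x)) = 0"
          proof
            fix e assume "e \<in> E - E0"
            then have "e \<in> N" using E(2) unfolding E0_def by auto
            then have "snd e < fst e" using \<open>\<And>e. e \<in> N \<Longrightarrow> snd e < fst e\<close> by blast
            then show "(case e of (x, y) \<Rightarrow> ?f (y - x)) = 0" by (cases e) (simp add: cost_def)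
          qed
        qed (auto simp: E0_def)
        moreover have "total_cost ?f N0 \<le> total_cost ?f N'"
          unfolding total_cost_def
        proof (rule sum_mono2[OF finN'])
          show "0 \<le> (case e of (x, y) \<Rightarrow> ?f (y - x))" if "e \<in> N' - N0" for e
          proof -
            obtain x y where e: "e = (x, y)" by (cases e)
            then have "y - x \<le> 0 \<or> 1 \<le> y - x" using that unfolding N0_def by auto
            then have "0 \<le> ?f (y - x)" by (auto simp: cost_def)
            then show ?thesis unfolding e by simp
          qed
        qed (auto simp: N0_def)
        ultimately show "total_cost ?f E \<le> total_cost ?f N'" by simp
      qed
    qed
    moreover have "\<not> scale_invariant_matching ?f R B ?M"
    proof
      assume inv: "scale_invariant_matching ?f R B ?M"
      obtain n where "isolating_pattern R B n" using pat unfolding patterned_def by blast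
      then obtain r b where rb: "r \<in> R1" "b \<in> B1" "r < b" using left by blast
      obtain b' where b': "(r, b') \<in> N" using N'(4) rb(1) by force
      obtain r' where r': "(r', b) \<in> N" using N'(5) rb(2) by force
      have lt: "b' < r" "b < r'" using N'(6) b' r' by force+
      \<comment> \<open>This scale makes the distance from \<open>r\<close> to \<open>b\<close>
        equal to 1/2, whose logarithm is negative. Exchanging the free edges at \<open>r\<close> and
        \<open>b\<close> then pays off, as the other new edge \<open>(r', b')\<close> is again
        blue-red: \<open>b' < r < b < r'\<close>.\<close>
      define k where "k = 1 / (2 * (b - r))"
      have k: "k > 0" "k * (b - r) = 1 / 2" unfolding k_def using rb(3) by (auto simp: field_simps)
      have min: "minimal_matching ?f (scale_points k R) (scale_points k B) (scale_matching k ?M)"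
        using inv k(1) unfolding scale_invariant_matching_def by blast
      have d: "scale_points k R \<inter> scale_points k B = {}"
        unfolding scale_points_def using disj k(1) by auto
      have "(k * r, k * b') \<in> scale_matching k ?M" "(k * r', k * b) \<in> scale_matching k ?M"
        unfolding scale_matching_def using b' r' by force+
      then have "?f (k * b' - k * r) + ?f (k * b - k * r') \<le> ?f (k * b - k * r) + ?f (k * b' - k * r')"
        using minimal_matching_swap[OF d min] lt rb(3) k(1) by auto
      moreover have "?f (k * b' - k * r) = 0" "?f (k * b - k * r') = 0" "?f (k * b' - k * r') = 0"
        using lt rb(3) k(1) by (auto simp: cost_def)
      moreover have "k * b - k * r = 1 / 2" using k(2) by (simp add: algebra_simps)
      ultimately show False by (simp add: cost_def ln_div)
    qed
    ultimately show ?thesis by blast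
  qed
  \<comment> \<open>\<open>N\<close> is recovered from the union, its edges being oriented opposite
    to those of \<open>M0\<close>.\<close>
  have "inj_on (\<lambda>N. M0 \<union> N) U.blue_red_matchings"
  proof (rule inj_onI)
    fix N N' assume "N \<in> U.blue_red_matchings" "N' \<in> U.blue_red_matchings" "M0 \<union> N = M0 \<union> N'"
    moreover from this have "N \<inter> M0 = {}" "N' \<inter> M0 = {}"
      unfolding U.blue_red_matchings_def using M0'(4) by (fastforce dest: less_asym)+
    ultimately show "N = N'" by blast
  qed
  then have "uncountable ((\<lambda>N. M0 \<union> N) ` U.blue_red_matchings)"
    using U.uncountable_blue_red_matchings countable_image_inj_on by blast
  moreover have "(\<lambda>N. M0 \<union> N) ` U.blue_red_matchings \<subseteq>
      {M. gamma_minimal 0 R B M \<and> \<not> scale_invariant_matching ?f R B M}"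
    using good by blast
  ultimately show ?thesis using countable_subset by blast
qed

end

text \<open>Scaling by \<open>k\<close> adds \<open>ln k\<close> for every red-blue edge, and the
  two perfect matchings of this configuration have different numbers of them. At scale 1 the costs
  are 0 and \<open>ln 3\<close>; at scale 4 they are \<open>ln 16\<close> and \<open>ln 12\<close>,
  so the order is reversed.\<close>

lemma not_scale_invariant_cost_zero: "\<not> scale_invariant_cost (cost 0)"
proof
  assume inv: "scale_invariant_cost (cost 0)"
  let ?R = "{0, 2 :: real}" and ?B = "{1, 3 :: real}" and ?M = "{(0, 1), (2, 3 :: real)} :: edge set"
  have disj: "?R \<inter> ?B = {}" by auto
  have m: "matching ?R ?B ?M" unfolding matching_iff[OF disj] by (auto simp: inj_on_def)
  have "minimal_matching (cost 0) ?R ?B ?M"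
    unfolding minimal_matching_def
  proof (intro conjI allI impI m)
    fix S assume S: "admissible ?R ?B ?M S"
    have perf: "unmatched ?R ?B ?M = {}" by (subst unmatched_empty_iff[OF disj]) auto
    show "finite_minimal (cost 0) (?R \<inter> S) (?B \<inter> S) (restrict_matching ?M S)"
    proof (rule finite_minimal_restrict_perfectI[OF disj m perf S])
      fix E N assume E: "E \<subseteq> ?M" and N: "fst ` N = fst ` E" "snd ` N = snd ` E"
      have "total_cost (cost 0) E = 0"
        unfolding total_cost_def
      proof (intro sum.neutral ballI)
        fix e assume "e \<in> E"
        then have "e = (0, 1) \<or> e = (2, 3)" using E by blast
        then show "(case e of (x, y) \<Rightarrow> cost 0 (y - x)) = 0" by (auto simp: cost_def)
      qed
      moreover have "0 \<le> total_cost (cost 0) N"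
        unfolding total_cost_def
      proof (rule sum_nonneg)
        fix e assume "e \<in> N"
        then have "fst e \<in> fst ` E" "snd e \<in> snd ` E" using N by blast+
        moreover have "fst ` E \<subseteq> fst ` ?M" "snd ` E \<subseteq> snd ` ?M" using E by (auto intro: image_mono)
        ultimately have "fst e \<in> fst ` ?M" "snd e \<in> snd ` ?M" by blast+
        then show "0 \<le> (case e of (x, y) \<Rightarrow> cost 0 (y - x))" by (cases e) (auto simp: cost_def)
      qed
      ultimately show "total_cost (cost 0) E \<le> total_cost (cost 0) N" by simp
    qed
  qed
  then have "minimal_matching (cost 0) (scale_points 4 ?R) (scale_points 4 ?B) (scale_matching 4 ?M)"
    using inv disj unfolding scale_invariant_cost_def scale_invariant_matching_def by auto
  from minimal_matching_swap[OF _ this, of 0 4 8 12]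
  have "cost 0 4 + cost 0 4 \<le> cost 0 12 + cost 0 (- 4)"
    by (simp add: scale_points_def scale_matching_def)
  then have "ln (4 * 4) \<le> ln (12 :: real)" unfolding cost_def by (subst ln_mult) auto
  then show False by simp
qed

section \<open>Laws of Poisson processes\<close>

lemma space_point_config [simp]: "space point_config = UNIV"
  unfolding point_config_def by simp

lemma sets_point_config:
  "A \<in> sets borel \<Longrightarrow> {X. finite (X \<inter> A) \<and> card (X \<inter> A) = n} \<in> sets point_config"
  unfolding point_config_def by (auto intro!: sigma_sets.Basic)

lemma measurable_point_configI:
  fixes F :: "'w \<Rightarrow> 'a::topological_space set"
  assumes "\<And>A n. A \<in> sets borel \<Longrightarrow> {\<omega> \<in> space N. finite (F \<omega> \<inter> A) \<and> card (F \<omega> \<inter> A) = n} \<in> sets N"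
  shows "F \<in> N \<rightarrow>\<^sub>M point_config"
  unfolding point_config_def
proof (rule measurable_sigma_sets[where \<Omega>=UNIV])
  fix y :: "'a set set"
  assume "y \<in> {{X. finite (X \<inter> A) \<and> card (X \<inter> A) = n} |A n. A \<in> sets borel}"
  then obtain A n where "y = {X. finite (X \<inter> A) \<and> card (X \<inter> A) = n}" "A \<in> sets borel" by blast
  moreover from this have "F -` y \<inter> space N = {\<omega> \<in> space N. finite (F \<omega> \<inter> A) \<and> card (F \<omega> \<inter> A) = n}" by auto
  ultimately show "F -` y \<inter> space N \<in> sets N" using assms by simp
qed (auto simp: sets_measure_of)

lemma measurable_finite_count [measurable]:
  assumes [measurable]: "A \<in> sets borel"
  shows "Measurable.pred point_config (\<lambda>X. finite (X \<inter> A))"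
proof -
  have "{X. finite (X \<inter> A)} = (\<Union>n. {X. finite (X \<inter> A) \<and> card (X \<inter> A) = n})" by auto
  then have "{X. finite (X \<inter> A)} \<in> sets point_config" using sets_point_config[OF assms] by auto
  then show ?thesis unfolding pred_def by simp
qed

lemma measurable_card_count [measurable]:
  assumes [measurable]: "A \<in> sets borel"
  shows "(\<lambda>X. card (X \<inter> A)) \<in> point_config \<rightarrow>\<^sub>M count_space UNIV"
proof (rule measurable_count_space_eq2_countable[THEN iffD2])
  \<comment> \<open>An infinite intersection has \<open>card\<close> 0, which adds such
    configurations to the preimage of 0.\<close>
  have "(\<lambda>X. card (X \<inter> A)) -` {n} = {X. finite (X \<inter> A) \<and> card (X \<inter> A) = n} \<union>
     (if n = 0 then - {X. finite (X \<inter> A)} else {})" for n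
    by (auto intro: card_ge_0_finite)
  moreover have "{X. finite (X \<inter> A)} \<in> sets point_config"
    using measurable_finite_count[OF assms] unfolding pred_def by simp
  then have "- {X. finite (X \<inter> A)} \<in> sets point_config"
    using sets.compl_sets[of _ point_config] by (metis Compl_eq_Diff_UNIV space_point_config)
  ultimately show "(\<lambda>X. card (X \<inter> A)) \<in> space point_config \<rightarrow> UNIV \<and>
      (\<forall>n\<in>UNIV. (\<lambda>X. card (X \<inter> A)) -` {n} \<inter> space point_config \<in> sets point_config)"
    using sets_point_config[OF assms] by auto
qed

lemma poisson_processD:
  assumes "poisson_process P l X"
  shows "X \<in> P \<rightarrow>\<^sub>M point_config"
    and "A \<in> sets borel \<Longrightarrow> emeasure lborel A < \<infinity> \<Longrightarrow>
      measure P {\<omega> \<in> space P. finite (X \<omega> \<inter> A) \<and> card (X \<omega> \<inter> A) = n} =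
        (l * measure lborel A) ^ n / fact n * exp (- (l * measure lborel A))"
    and "finite I \<Longrightarrow> disjoint_family_on A' I \<Longrightarrow> (\<And>i. i \<in> I \<Longrightarrow> A' i \<in> sets borel \<and> emeasure lborel (A' i) < \<infinity>) \<Longrightarrow>
      prob_space.indep_vars P (\<lambda>_. count_space UNIV) (\<lambda>i \<omega>. card (X \<omega> \<inter> A' (i::nat))) I"
  using assms unfolding poisson_process_def by blast+

text \<open>The events of exactly \<open>n\<close> points are disjoint and their prescribed
  probabilities sum to 1, so nothing is left for infinitely many points.\<close>

lemma poisson_process_AE_finite:
  assumes "prob_space P" and X: "poisson_process P l X"
    and A [measurable]: "A \<in> sets borel" "emeasure lborel A < \<infinity>"
  shows "AE \<omega> in P. finite (X \<omega> \<inter> A)"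
proof -
  interpret prob_space P by fact
  note [measurable] = poisson_processD(1)[OF X]
  let ?E = "\<lambda>n. {\<omega> \<in> space P. finite (X \<omega> \<inter> A) \<and> card (X \<omega> \<inter> A) = n}"
  let ?m = "l * measure lborel A"
  have "(\<lambda>n. prob (?E n)) sums prob (\<Union>n. ?E n)"
    by (rule finite_measure_UNION) (auto simp: disjoint_family_on_def)
  moreover have "(\<lambda>n. ?m ^ n / fact n * exp (- ?m)) sums (exp ?m * exp (- ?m))"
    using exp_converges[of ?m] by (intro sums_mult2) (simp add: scaleR_conv_of_real field_simps)
  ultimately have "prob (\<Union>n. ?E n) = 1"
    unfolding poisson_processD(2)[OF X A] by (auto simp: exp_minus dest: sums_unique2)
  then have "AE \<omega> in P. \<omega> \<in> (\<Union>n. ?E n)" by (rule AE_prob_1)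
  then show ?thesis by eventually_elim auto
qed

lemma poisson_process_prob_card:
  assumes "prob_space P" and X: "poisson_process P l X"
    and A [measurable]: "A \<in> sets borel" "emeasure lborel A < \<infinity>"
  shows "measure P {\<omega> \<in> space P. card (X \<omega> \<inter> A) = n} =
     (l * measure lborel A) ^ n / fact n * exp (- (l * measure lborel A))"
proof -
  interpret prob_space P by fact
  note [measurable] = poisson_processD(1)[OF X]
  have "prob {\<omega> \<in> space P. card (X \<omega> \<inter> A) = n} = prob {\<omega> \<in> space P. finite (X \<omega> \<inter> A) \<and> card (X \<omega> \<inter> A) = n}"
    by (rule finite_measure_eq_AE) (use poisson_process_AE_finite[OF assms(1) X A] in \<open>auto elim!: eventually_mono\<close>)
  then show ?thesis using poisson_processD(2)[OF X A] by simp
qed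

text \<open>A finite family \<open>A\<close> is decomposed into its atoms: \<open>s\<close> enumerates the sets of indices, and the
  atom of \<open>j\<close> consists of the points lying in \<open>A i\<close> exactly for the \<open>i\<close> in \<open>s j\<close>.\<close>

lemma poisson_process_finite_dim_eq:
  fixes m :: nat
  assumes P: "prob_space P" and X: "poisson_process P l X" and Y: "poisson_process P l Y"
    and A: "\<And>i. i < m \<Longrightarrow> A i \<in> sets borel \<and> emeasure lborel (A i) < \<infinity>"
  shows "emeasure P {\<omega> \<in> space P. \<forall>i<m. finite (X \<omega> \<inter> A i) \<and> card (X \<omega> \<inter> A i) = n i} =
     emeasure P {\<omega> \<in> space P. \<forall>i<m. finite (Y \<omega> \<inter> A i) \<and> card (Y \<omega> \<inter> A i) = n i}"
proof -
  interpret prob_space P by fact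
  obtain s where s: "bij_betw s {0..<card (Pow {..<m})} (Pow {..<m})"
    using ex_bij_betw_nat_finite[of "Pow {..<m}"] by auto
  define K where "K = card (Pow {..<m})"
  have K: "K > 0" unfolding K_def by (simp add: card_Pow)
  define atom where "atom j = {x \<in> (\<Union>i<m. A i). \<forall>i<m. x \<in> A i \<longleftrightarrow> i \<in> s j}" for j
  have atom_borel [measurable]: "atom j \<in> sets borel" for j
  proof -
    have "atom j = (\<Union>i\<in>{..<m}. A i) - (\<Union>i\<in>{i\<in>{..<m}. i \<notin> s j}. A i) - (\<Union>i\<in>{i\<in>{..<m}. i \<in> s j}. - A i)"
      unfolding atom_def by auto
    moreover have "\<dots> \<in> sets borel"
      by (intro sets.Diff sets.finite_UN) (use A in \<open>auto intro!: borel_comp\<close>)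
    ultimately show ?thesis by simp
  qed
  have atom_finite: "emeasure lborel (atom j) < \<infinity>" for j
  proof -
    have "emeasure lborel (atom j) \<le> emeasure lborel (\<Union>i<m. A i)"
      by (rule emeasure_mono) (use A in \<open>auto simp: atom_def\<close>)
    also have "\<dots> \<le> (\<Sum>i<m. emeasure lborel (A i))"
      by (rule emeasure_subadditive_finite) (use A in auto)
    also have "\<dots> < \<infinity>" using A by simp
    finally show ?thesis .
  qed
  have disj: "disjoint_family_on atom {..<K}"
  proof (unfold disjoint_family_on_def, intro ballI impI)
    fix j j' assume j: "j \<in> {..<K}" "j' \<in> {..<K}" "j \<noteq> j'"
    have sj: "s j \<noteq> s j'"
      using inj_onD[OF bij_betw_imp_inj_on[OF s], of j j'] j unfolding K_def by auto
    have "s j \<in> Pow {..<m}" "s j' \<in> Pow {..<m}"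
      using j bij_betw_apply[OF s] unfolding K_def by auto
    then have "\<exists>i<m. (i \<in> s j) \<noteq> (i \<in> s j')" using sj by blast
    then show "atom j \<inter> atom j' = {}" unfolding atom_def by blast
  qed
  have A_atoms: "A i = (\<Union>j\<in>{j\<in>{..<K}. i \<in> s j}. atom j)" if "i < m" for i
  proof
    show "A i \<subseteq> (\<Union>j\<in>{j\<in>{..<K}. i \<in> s j}. atom j)"
    proof
      fix x assume x: "x \<in> A i"
      have "{i\<in>{..<m}. x \<in> A i} \<in> s ` {0..<K}" using s unfolding bij_betw_def K_def by auto
      then obtain j where "j < K" "s j = {i\<in>{..<m}. x \<in> A i}" by auto
      then show "x \<in> (\<Union>j\<in>{j\<in>{..<K}. i \<in> s j}. atom j)"
        using x that unfolding atom_def by auto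
    qed
    show "(\<Union>j\<in>{j\<in>{..<K}. i \<in> s j}. atom j) \<subseteq> A i" using that unfolding atom_def by auto
  qed
  \<comment> \<open>Almost surely the count in \<open>A i\<close> is the sum of the counts in its
    atoms, so the event becomes a condition \<open>T\<close> on the vector of atom counts, whose
    coordinates are independent.\<close>
  define T where "T = {v \<in> space (\<Pi>\<^sub>M j\<in>{..<K}. count_space (UNIV::nat set)).
      \<forall>i\<in>{..<m}. (\<Sum>j\<in>{j\<in>{..<K}. i \<in> s j}. v j) = n i}"
  have T: "T \<in> sets (\<Pi>\<^sub>M j\<in>{..<K}. count_space UNIV)"
    unfolding T_def by measurable
  have key: "emeasure P {\<omega> \<in> space P. \<forall>i<m. finite (Z \<omega> \<inter> A i) \<and> card (Z \<omega> \<inter> A i) = n i} =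
     emeasure (\<Pi>\<^sub>M j\<in>{..<K}. distr P (count_space UNIV) (\<lambda>\<omega>. card (Z \<omega> \<inter> atom j))) T"
    if Z: "poisson_process P l Z" for Z
  proof -
    note [measurable] = poisson_processD(1)[OF Z]
    have "AE \<omega> in P. \<forall>j\<in>{..<K}. finite (Z \<omega> \<inter> atom j)"
      by (rule AE_finite_allI) (auto intro: poisson_process_AE_finite[OF P Z] atom_finite)
    then have ae: "AE \<omega> in P. (\<forall>i<m. finite (Z \<omega> \<inter> A i) \<and> card (Z \<omega> \<inter> A i) = n i) \<longleftrightarrow>
        (\<lambda>j\<in>{..<K}. card (Z \<omega> \<inter> atom j)) \<in> T"
    proof eventually_elim
      fix \<omega> assume fin: "\<forall>j\<in>{..<K}. finite (Z \<omega> \<inter> atom j)"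
      have ZA: "Z \<omega> \<inter> A i = (\<Union>j\<in>{j\<in>{..<K}. i \<in> s j}. Z \<omega> \<inter> atom j)" if "i < m" for i
        using A_atoms[OF that] by auto
      have "finite (Z \<omega> \<inter> A i)" if "i < m" for i unfolding ZA[OF that] by (rule finite_UN_I) (use fin in auto)
      moreover have "card (Z \<omega> \<inter> A i) = (\<Sum>j\<in>{j\<in>{..<K}. i \<in> s j}. card (Z \<omega> \<inter> atom j))" if "i < m" for i
        unfolding ZA[OF that]
        by (rule card_UN_disjoint) (use fin disj in \<open>auto simp: disjoint_family_on_def\<close>)
      moreover have "(\<Sum>j\<in>{j\<in>{..<K}. i \<in> s j}. (\<lambda>j\<in>{..<K}. card (Z \<omega> \<inter> atom j)) j) =
          (\<Sum>j\<in>{j\<in>{..<K}. i \<in> s j}. card (Z \<omega> \<inter> atom j))" for i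
        by (rule sum.cong) auto
      ultimately show "(\<forall>i<m. finite (Z \<omega> \<inter> A i) \<and> card (Z \<omega> \<inter> A i) = n i) \<longleftrightarrow>
        (\<lambda>j\<in>{..<K}. card (Z \<omega> \<inter> atom j)) \<in> T"
        unfolding T_def by (auto simp: space_PiM)
    qed
    have meas: "(\<lambda>\<omega>. \<lambda>j\<in>{..<K}. card (Z \<omega> \<inter> atom j)) \<in> P \<rightarrow>\<^sub>M (\<Pi>\<^sub>M j\<in>{..<K}. count_space UNIV)"
      by measurable
    have "emeasure P {\<omega> \<in> space P. \<forall>i<m. finite (Z \<omega> \<inter> A i) \<and> card (Z \<omega> \<inter> A i) = n i} =
        emeasure P {\<omega> \<in> space P. (\<lambda>j\<in>{..<K}. card (Z \<omega> \<inter> atom j)) \<in> T}"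
    proof (rule emeasure_eq_AE)
      have "(\<lambda>\<omega>. Z \<omega>) -` (\<Inter>i\<in>{..<m}. {X. finite (X \<inter> A i) \<and> card (X \<inter> A i) = n i}) \<inter> space P \<in> events"
        if "m > 0"
        by (rule measurable_sets[OF poisson_processD(1)[OF Z]])
          (use A that in \<open>auto intro!: sets.finite_INT sets_point_config\<close>)
      moreover have "{\<omega> \<in> space P. \<forall>i<m. finite (Z \<omega> \<inter> A i) \<and> card (Z \<omega> \<inter> A i) = n i} =
        (if m > 0 then (\<lambda>\<omega>. Z \<omega>) -` (\<Inter>i\<in>{..<m}. {X. finite (X \<inter> A i) \<and> card (X \<inter> A i) = n i}) \<inter> space P
         else space P)" by auto
      ultimately show "{\<omega> \<in> space P. \<forall>i<m. finite (Z \<omega> \<inter> A i) \<and> card (Z \<omega> \<inter> A i) = n i} \<in> events" by auto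
      show "{\<omega> \<in> space P. (\<lambda>j\<in>{..<K}. card (Z \<omega> \<inter> atom j)) \<in> T} \<in> events"
        using measurable_sets[OF meas T] by (simp add: vimage_def Int_def conj_commute)
    qed (use ae in \<open>auto elim!: eventually_mono\<close>)
    also have "\<dots> = emeasure (distr P (\<Pi>\<^sub>M j\<in>{..<K}. count_space UNIV) (\<lambda>\<omega>. \<lambda>j\<in>{..<K}. card (Z \<omega> \<inter> atom j))) T"
      using T meas by (subst emeasure_distr) (auto simp: vimage_def Int_def conj_commute)
    also have "distr P (\<Pi>\<^sub>M j\<in>{..<K}. count_space UNIV) (\<lambda>\<omega>. \<lambda>j\<in>{..<K}. card (Z \<omega> \<inter> atom j)) =
        (\<Pi>\<^sub>M j\<in>{..<K}. distr P (count_space UNIV) (\<lambda>\<omega>. card (Z \<omega> \<inter> atom j)))"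
      using poisson_processD(3)[OF Z, of "{..<K}" atom] disj atom_finite K
      by (subst indep_vars_iff_distr_eq_PiM'[symmetric]) auto
    finally show ?thesis .
  qed
  \<comment> \<open>The law of an atom count depends only on \<open>l\<close> and the measure of the
    atom, hence is the same for \<open>X\<close> and \<open>Y\<close>.\<close>
  have "distr P (count_space UNIV) (\<lambda>\<omega>. card (X \<omega> \<inter> atom j)) =
      distr P (count_space UNIV) (\<lambda>\<omega>. card (Y \<omega> \<inter> atom j))" for j
  proof (rule measure_eqI_countable[of _ UNIV])
    note [measurable] = poisson_processD(1)[OF X] poisson_processD(1)[OF Y]
    fix k
    have "emeasure (distr P (count_space UNIV) (\<lambda>\<omega>. card (Z \<omega> \<inter> atom j))) {k} =
       ennreal ((l * measure lborel (atom j)) ^ k / fact k * exp (- (l * measure lborel (atom j))))"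
      if Z: "poisson_process P l Z" for Z
    proof -
      note [measurable] = poisson_processD(1)[OF Z]
      have "emeasure (distr P (count_space UNIV) (\<lambda>\<omega>. card (Z \<omega> \<inter> atom j))) {k} =
        emeasure P {\<omega> \<in> space P. card (Z \<omega> \<inter> atom j) = k}"
      proof (subst emeasure_distr)
        show "(\<lambda>\<omega>. card (Z \<omega> \<inter> atom j)) \<in> P \<rightarrow>\<^sub>M count_space UNIV" by measurable
      qed (auto intro!: arg_cong[where f="emeasure P"])
      then show ?thesis
        using poisson_process_prob_card[OF P Z atom_borel atom_finite, of j k] emeasure_eq_measure by simp
    qed
    from this[OF X] this[OF Y]
    show "emeasure (distr P (count_space UNIV) (\<lambda>\<omega>. card (X \<omega> \<inter> atom j))) {k} =
      emeasure (distr P (count_space UNIV) (\<lambda>\<omega>. card (Y \<omega> \<inter> atom j))) {k}" by simp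
  qed auto
  then show ?thesis using key[OF X] key[OF Y] by simp
qed

text \<open>A generator stable under intersections. It is restricted to sets of finite measure,
  where the Poisson law prescribes the counts.\<close>

definition finite_count_events :: "real set set set" where
  "finite_count_events = {{X. \<forall>i<m. finite (X \<inter> A i) \<and> card (X \<inter> A i) = n i} | (m :: nat) A n.
     \<forall>i<m. A i \<in> sets borel \<and> emeasure lborel (A i) < \<infinity>}"

lemma finite_count_eventsE:
  assumes "U \<in> finite_count_events"
  obtains m A n where "U = {X. \<forall>i<m. finite (X \<inter> A i) \<and> card (X \<inter> A i) = n i}"
    "\<forall>i<m::nat. A i \<in> sets borel \<and> emeasure lborel (A i) < \<infinity>"
proof -
  have "\<exists>m A n. U = {X. \<forall>i<m. finite (X \<inter> A i) \<and> card (X \<inter> A i) = n i} \<and>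
      (\<forall>i<m::nat. A i \<in> sets borel \<and> emeasure lborel (A i) < \<infinity>)"
    using assms by (simp only: finite_count_events_def mem_Collect_eq)
  then show thesis using that by (elim exE conjE)
qed

lemma Int_stable_finite_count_events: "Int_stable finite_count_events"
proof (rule Int_stableI)
  fix U V assume UV: "U \<in> finite_count_events" "V \<in> finite_count_events"
  obtain m A n where U: "U = {X. \<forall>i<m. finite (X \<inter> A i) \<and> card (X \<inter> A i) = n i}"
    "\<forall>i<m::nat. A i \<in> sets borel \<and> emeasure lborel (A i) < \<infinity>"
    using UV(1) by (rule finite_count_eventsE)
  obtain m' A' n' where V: "V = {X. \<forall>i<m'. finite (X \<inter> A' i) \<and> card (X \<inter> A' i) = n' i}"
    "\<forall>i<m'::nat. A' i \<in> sets borel \<and> emeasure lborel (A' i) < \<infinity>"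
    using UV(2) by (rule finite_count_eventsE)
  define C where "C i = (if i < m then A i else A' (i - m))" for i
  define k where "k i = (if i < m then n i else n' (i - m))" for i
  have all: "(\<forall>i<m+m'. Q (C i) (k i)) \<longleftrightarrow> (\<forall>i<m. Q (A i) (n i)) \<and> (\<forall>i<m'. Q (A' i) (n' i))" for Q
  proof safe
    fix i assume a: "\<forall>i<m+m'. Q (C i) (k i)"
    { assume "i < m" then show "Q (A i) (n i)" using a[rule_format, of i] unfolding C_def k_def by simp }
    { assume "i < m'" then show "Q (A' i) (n' i)" using a[rule_format, of "m + i"] unfolding C_def k_def by simp }
  next
    fix i assume "\<forall>i<m. Q (A i) (n i)" "\<forall>i<m'. Q (A' i) (n' i)" "i < m + m'"
    then show "Q (C i) (k i)" unfolding C_def k_def by auto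
  qed
  have "U \<inter> V = {X. \<forall>i<m+m'. finite (X \<inter> C i) \<and> card (X \<inter> C i) = k i}"
    unfolding U V using all[of "\<lambda>A n. finite (_ \<inter> A) \<and> card (_ \<inter> A) = n"] by auto
  moreover have "\<forall>i<m+m'. C i \<in> sets borel \<and> emeasure lborel (C i) < \<infinity>"
    using all[of "\<lambda>A n. A \<in> sets borel \<and> emeasure lborel A < \<infinity>"] U(2) V(2) by blast
  ultimately show "U \<inter> V \<in> finite_count_events" unfolding finite_count_events_def mem_Collect_eq by (intro exI conjI)
qed

lemma sets_point_config_eq: "sets point_config = sigma_sets UNIV finite_count_events"
proof
  have basic: "{X. finite (X \<inter> A) \<and> card (X \<inter> A) = n} \<in> sigma_sets UNIV finite_count_events"
    if A: "A \<in> sets borel" for A :: "real set" and n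
  proof -
    interpret S: sigma_algebra UNIV "sigma_sets UNIV finite_count_events"
      by (rule sigma_algebra_sigma_sets) simp
    define D where "D k = A \<inter> {- real k..real k}" for k
    have "{X. finite (X \<inter> D k) \<and> card (X \<inter> D k) = n} \<in> finite_count_events" for k
    proof -
      have "D k \<in> sets borel" "emeasure lborel (D k) < \<infinity>"
        using A le_less_trans[OF emeasure_mono[of "D k" "{- real k..real k}" lborel]]
        unfolding D_def by (auto simp: emeasure_lborel_Icc_eq)
      then show ?thesis
        unfolding finite_count_events_def mem_Collect_eq
        by (intro exI[of _ 1] exI[of _ "\<lambda>_. D k"] exI[of _ "\<lambda>_. n"]) auto
    qed
    \<comment> \<open>The count in \<open>A\<close> is \<open>n\<close> exactly when the counts in
      the bounded parts \<open>D k\<close> are eventually \<open>n\<close>.\<close>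
    then have "(\<Union>k0. \<Inter>k\<in>{k0..}. {X. finite (X \<inter> D k) \<and> card (X \<inter> D k) = n}) \<in> sigma_sets UNIV finite_count_events"
      by (intro S.countable_UN S.countable_INT'') auto
    moreover have "{X. finite (X \<inter> A) \<and> card (X \<inter> A) = n} =
       (\<Union>k0. \<Inter>k\<in>{k0..}. {X. finite (X \<inter> D k) \<and> card (X \<inter> D k) = n})"
    proof (intro set_eqI iffI)
      fix X assume "X \<in> {X. finite (X \<inter> A) \<and> card (X \<inter> A) = n}"
      then have X: "finite (X \<inter> A)" "card (X \<inter> A) = n" by auto
      obtain k0 :: nat where k0: "Max (insert 0 (abs ` (X \<inter> A))) \<le> real k0" using real_arch_simple by blast
      have "X \<inter> D k = X \<inter> A" if "k \<ge> k0" for k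
      proof -
        have "\<bar>x\<bar> \<le> real k" if "x \<in> X \<inter> A" for x
        proof -
          have "\<bar>x\<bar> \<le> Max (insert 0 (abs ` (X \<inter> A)))" using X that by (intro Max_ge) auto
          then show ?thesis using k0 \<open>k \<ge> k0\<close> by simp
        qed
        then show ?thesis unfolding D_def by force
      qed
      then show "X \<in> (\<Union>k0. \<Inter>k\<in>{k0..}. {X. finite (X \<inter> D k) \<and> card (X \<inter> D k) = n})"
        using X by (auto intro!: exI[of _ k0])
    next
      fix X assume "X \<in> (\<Union>k0. \<Inter>k\<in>{k0..}. {X. finite (X \<inter> D k) \<and> card (X \<inter> D k) = n})"
      then obtain k0 where k0: "\<And>k. k \<ge> k0 \<Longrightarrow> finite (X \<inter> D k) \<and> card (X \<inter> D k) = n" by auto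
      \<comment> \<open>Nested finite sets of equal cardinality coincide, so an eventually constant
        count freezes the sets themselves.\<close>
      have "X \<inter> D k = X \<inter> D k0" if "k \<ge> k0" for k
        using k0[OF that] k0[of k0] that by (intro card_subset_eq[symmetric]) (auto simp: D_def)
      moreover have "\<exists>k\<ge>k0. x \<in> D k" if "x \<in> A" for x
      proof -
        obtain k :: nat where "\<bar>x\<bar> \<le> real k" using real_arch_simple by blast
        then show ?thesis using that unfolding D_def by (intro exI[of _ "max k k0"]) auto
      qed
      ultimately have "X \<inter> A = X \<inter> D k0" unfolding D_def by blast
      then show "X \<in> {X. finite (X \<inter> A) \<and> card (X \<inter> A) = n}" using k0[of k0] by simp
    qed
    ultimately show ?thesis by simp
  qed
  show "sets point_config \<subseteq> sigma_sets UNIV finite_count_events"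
    unfolding point_config_def
    by (subst sets_measure_of) (auto intro!: sigma_sets_mono basic)
  show "sigma_sets UNIV finite_count_events \<subseteq> sets (point_config :: real set measure)"
  proof -
    have "U \<in> sets point_config" if "U \<in> finite_count_events" for U
    proof -
      obtain m A n where U: "U = {X. \<forall>i<m. finite (X \<inter> A i) \<and> card (X \<inter> A i) = n i}"
        "\<forall>i<m::nat. A i \<in> sets borel \<and> emeasure lborel (A i) < \<infinity>"
        using \<open>U \<in> finite_count_events\<close> by (rule finite_count_eventsE)
      show ?thesis
      proof (cases "m = 0")
        case True
        then show ?thesis using U sets.top[of point_config] by simp
      next
        case False
        have "U = (\<Inter>i\<in>{..<m}. {X. finite (X \<inter> A i) \<and> card (X \<inter> A i) = n i})" unfolding U by auto
        then show ?thesis using U(2) False by (auto intro!: sets.finite_INT sets_point_config)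
      qed
    qed
    then have "finite_count_events \<subseteq> sets point_config" by blast
    then show ?thesis by (metis sets.sigma_sets_subset space_point_config)
  qed
qed

text \<open>The two laws agree on an intersection-stable generator; the whole space belongs to it
  through the choice \<open>m = 0\<close>.\<close>

lemma poisson_process_distr_unique:
  assumes P: "prob_space P" and X: "poisson_process P l X" and Y: "poisson_process P l Y"
  shows "distr P point_config X = distr P point_config Y"
proof (rule measure_eqI_generator_eq[where E=finite_count_events and \<Omega>=UNIV and A="\<lambda>_. UNIV"])
  interpret prob_space P by fact
  show "range (\<lambda>_. UNIV) \<subseteq> finite_count_events"
    unfolding finite_count_events_def by (auto intro!: exI[of _ "0::nat"])
  show "emeasure (distr P point_config X) UNIV \<noteq> \<infinity>"
    using poisson_processD(1)[OF X] by (subst emeasure_distr) (auto simp: sets.top[of point_config, simplified])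
  fix U assume U: "U \<in> finite_count_events"
  then have "U \<in> sets point_config" unfolding sets_point_config_eq by (rule sigma_sets.Basic)
  moreover obtain m A n where "U = {X. \<forall>i<m. finite (X \<inter> A i) \<and> card (X \<inter> A i) = n i}"
    "\<forall>i<m::nat. A i \<in> sets borel \<and> emeasure lborel (A i) < \<infinity>"
    using U by (rule finite_count_eventsE)
  moreover from this have "Z -` U \<inter> space P = {\<omega> \<in> space P. \<forall>i<m. finite (Z \<omega> \<inter> A i) \<and> card (Z \<omega> \<inter> A i) = n i}" for Z
    by auto
  ultimately show "emeasure (distr P point_config X) U = emeasure (distr P point_config Y) U"
    using poisson_process_finite_dim_eq[OF P X Y, of m A n]
    by (simp add: emeasure_distr poisson_processD(1)[OF X] poisson_processD(1)[OF Y])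
qed (auto simp: Int_stable_finite_count_events sets_point_config_eq)

section \<open>Two independent Poisson processes\<close>

lemma (in prob_space) indep_var_commute:
  assumes "indep_var S X T Y" shows "indep_var T Y S X"
proof -
  have "indep_set G F" if "indep_set F G" for F G
    using that unfolding indep_sets2_eq by (metis Int_commute mult.commute)
  then show ?thesis using assms unfolding indep_var_eq by blast
qed

text \<open>Consecutive blocks of length \<open>L\<close> are independent, and each shows the
  pattern with the same probability \<open>q > 0\<close>. The first \<open>n\<close> blocks all miss
  it with probability \<open>(1 - q) ^ n\<close>, which tends to 0.\<close>

lemma (in prob_space) AE_pattern:
  fixes Z :: "nat \<Rightarrow> 'a \<Rightarrow> 'c::countable"
  assumes ind: "indep_vars (\<lambda>_. count_space UNIV) Z UNIV"
    and p: "\<And>i v. prob {\<omega> \<in> space M. Z i \<omega> = v} = p v" "\<And>v. p v > 0"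
    and L: "L > 0"
  shows "AE \<omega> in M. \<exists>j. \<forall>l<L. Z (j * L + l) \<omega> = v l"
proof -
  have Z [measurable]: "Z i \<in> M \<rightarrow>\<^sub>M count_space UNIV" for i
    using ind unfolding indep_vars_def by auto
  define K where "K j = {j * L..<j * L + L}" for j
  have K_div: "i \<in> K j \<longleftrightarrow> i div L = j" for i j
    unfolding K_def using L by (auto simp: div_nat_eqI dividend_less_times_div times_div_less_eq_dividend mult.commute add.commute)
  define Y where "Y j w = (\<forall>l<L. w (j * L + l) = v l)" for j :: nat and w :: "nat \<Rightarrow> 'c"
  \<comment> \<open>Written as a function of the restriction to the block \<open>K j\<close>, the
    event inherits independence from the disjointness of the blocks.\<close>
  define W where "W j \<omega> = Y j (restrict (\<lambda>i. Z i \<omega>) (K j))" for j \<omega>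
  have W_iff: "W j \<omega> \<longleftrightarrow> (\<forall>l<L. Z (j * L + l) \<omega> = v l)" for j \<omega>
    unfolding W_def Y_def K_def by auto
  have "indep_vars (\<lambda>j. PiM (K j) (\<lambda>_. count_space UNIV)) (\<lambda>j \<omega>. restrict (\<lambda>i. Z i \<omega>) (K j)) UNIV"
    by (rule indep_vars_restrict[OF ind]) (auto simp: disjoint_family_on_def K_div)
  then have "indep_vars (\<lambda>_. count_space UNIV) (\<lambda>j \<omega>. Y j (restrict (\<lambda>i. Z i \<omega>) (K j))) UNIV"
  proof (rule indep_vars_compose2)
    fix j
    have [measurable]: "(\<lambda>w. w (j * L + l)) \<in> PiM (K j) (\<lambda>_. count_space UNIV) \<rightarrow>\<^sub>M count_space (UNIV :: 'c set)"
      if "l < L" for l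
      by (rule measurable_component_singleton) (use that in \<open>auto simp: K_def\<close>)
    have "Measurable.pred (PiM (K j) (\<lambda>_. count_space UNIV)) (\<lambda>w. \<forall>l\<in>{..<L}. w (j * L + l) = v l)"
      by (intro pred_intros_finite) (auto intro!: pred_eq_const1)
    then show "Y j \<in> PiM (K j) (\<lambda>_. count_space UNIV) \<rightarrow>\<^sub>M count_space UNIV"
      unfolding Y_def by simp
  qed
  then have indW: "indep_vars (\<lambda>_. count_space UNIV) W UNIV"
    unfolding W_def .
  have [measurable]: "Measurable.pred M (W j)" for j
    using indW unfolding indep_vars_def by auto
  define q where "q = (\<Prod>l<L. p (v l))"
  have q: "0 < q" unfolding q_def by (intro prod_pos) (use p in auto)
  have probW: "prob {\<omega> \<in> space M. W j \<omega>} = q" for j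
  proof -
    have "{\<omega> \<in> space M. W j \<omega>} = (\<Inter>i\<in>K j. Z i -` {v (i - j * L)} \<inter> space M)"
    proof -
      have "(\<forall>l<L. Z (j * L + l) \<omega> = v l) \<longleftrightarrow> (\<forall>i\<in>K j. Z i \<omega> = v (i - j * L))" for \<omega>
      proof safe
        fix i assume "\<forall>l<L. Z (j * L + l) \<omega> = v l" "i \<in> K j"
        then show "Z i \<omega> = v (i - j * L)" unfolding K_def by (auto dest: spec[of _ "i - j * L"])
      next
        fix l assume "\<forall>i\<in>K j. Z i \<omega> = v (i - j * L)" "l < L"
        then show "Z (j * L + l) \<omega> = v l" unfolding K_def by (auto dest: bspec[of _ _ "j * L + l"])
      qed
      moreover have "K j \<noteq> {}" unfolding K_def using L by auto
      ultimately show ?thesis unfolding W_iff by auto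
    qed
    also have "prob \<dots> = (\<Prod>i\<in>K j. prob (Z i -` {v (i - j * L)} \<inter> space M))"
      by (rule indep_varsD[OF ind]) (use L in \<open>auto simp: K_def\<close>)
    also have "\<dots> = (\<Prod>i\<in>K j. p (v (i - j * L)))"
    proof (rule prod.cong[OF refl])
      fix i assume "i \<in> K j"
      have "Z i -` {v (i - j * L)} \<inter> space M = {\<omega> \<in> space M. Z i \<omega> = v (i - j * L)}" by auto
      then show "prob (Z i -` {v (i - j * L)} \<inter> space M) = p (v (i - j * L))" using p(1) by simp
    qed
    also have "\<dots> = q"
      unfolding q_def K_def
      by (rule prod.reindex_bij_witness[of _ "\<lambda>l. j * L + l" "\<lambda>i. i - j * L"]) auto
    finally show ?thesis .
  qed
  have "q \<le> 1" using probW[of 0] prob_le_1 by metis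
  have none: "prob {\<omega> \<in> space M. \<forall>j<n. \<not> W j \<omega>} = (1 - q) ^ n" if "n > 0" for n
  proof -
    have "{\<omega> \<in> space M. \<forall>j<n. \<not> W j \<omega>} = (\<Inter>j\<in>{..<n}. W j -` {False} \<inter> space M)"
      using that by auto
    also have "prob \<dots> = (\<Prod>j\<in>{..<n}. prob (W j -` {False} \<inter> space M))"
      by (rule indep_varsD[OF indW]) (use that in auto)
    also have "\<dots> = (\<Prod>j\<in>{..<n}. 1 - q)"
    proof (rule prod.cong[OF refl])
      fix j
      have "W j -` {False} \<inter> space M = space M - {\<omega> \<in> space M. W j \<omega>}" by auto
      then show "prob (W j -` {False} \<inter> space M) = 1 - q"
        using probW[of j] by (simp add: prob_compl)
    qed
    finally show ?thesis by simp
  qed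
  have "prob {\<omega> \<in> space M. \<forall>j. \<not> W j \<omega>} \<le> (1 - q) ^ Suc n" for n
    unfolding none[of "Suc n", OF zero_less_Suc, symmetric] by (rule finite_measure_mono) auto
  moreover have "(\<lambda>n. (1 - q) ^ Suc n) \<longlonglongrightarrow> 0"
    by (rule LIMSEQ_Suc) (use q \<open>q \<le> 1\<close> in \<open>auto intro!: LIMSEQ_power_zero\<close>)
  ultimately have "prob {\<omega> \<in> space M. \<forall>j. \<not> W j \<omega>} \<le> 0"
    by (intro LIMSEQ_le_const) auto
  then have "prob {\<omega> \<in> space M. \<forall>j. \<not> W j \<omega>} = 0" by (simp add: measure_le_0_iff)
  then have "AE \<omega> in M. \<omega> \<notin> {\<omega> \<in> space M. \<forall>j. \<not> W j \<omega>}"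
    by (subst AE_iff_measurable[OF _ refl]) (auto simp: emeasure_eq_measure)
  then show ?thesis using AE_space by eventually_elim (auto simp: W_iff)
qed

section \<open>Local finiteness and absence of common points\<close>

locale two_poisson = prob_space P for P :: "'w measure" +
  fixes R B :: "'w \<Rightarrow> real set"
  assumes poissonR: "poisson_process P 1 R" and poissonB: "poisson_process P 1 B"
    and indep: "indep_var point_config R point_config B"
begin

lemma prob_space_P: "prob_space P" by (rule prob_space_axioms)

lemmas R_measurable [measurable] = poisson_processD(1)[OF poissonR]
lemmas B_measurable [measurable] = poisson_processD(1)[OF poissonB]

lemma AE_locally_finite_points:
  assumes "poisson_process P 1 X"
  shows "AE \<omega> in P. locally_finite_points (X \<omega>)"
proof -
  have "AE \<omega> in P. \<forall>n::nat. finite (X \<omega> \<inter> {- real n..real n})"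
    unfolding AE_all_countable
    by (intro allI poisson_process_AE_finite[OF prob_space_P assms]) (auto simp: emeasure_lborel_Icc_eq)
  then show ?thesis unfolding locally_finite_points_iff .
qed

lemma prob_nonempty_le:
  assumes X: "poisson_process P 1 X" and A [measurable]: "A \<in> sets borel" "emeasure lborel A < \<infinity>"
  shows "prob (X -` {X. \<not> (finite (X \<inter> A) \<and> card (X \<inter> A) = 0)} \<inter> space P) \<le> measure lborel A"
proof -
  note [measurable] = poisson_processD(1)[OF X]
  have "X -` {X. \<not> (finite (X \<inter> A) \<and> card (X \<inter> A) = 0)} \<inter> space P =
      space P - {\<omega> \<in> space P. finite (X \<omega> \<inter> A) \<and> card (X \<omega> \<inter> A) = 0}" by auto
  then have "prob (X -` {X. \<not> (finite (X \<inter> A) \<and> card (X \<inter> A) = 0)} \<inter> space P) = 1 - exp (- measure lborel A)"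
    using poisson_processD(2)[OF X A, of 0] by (simp add: prob_compl)
  also have "\<dots> \<le> measure lborel A" using exp_ge_add_one_self[of "- measure lborel A"] by simp
  finally show ?thesis .
qed

text \<open>There are \<open>2 * K * m\<close> cells of length \<open>1 / m\<close> in
  \<open>{- K..<K}\<close>, and by independence both processes hit a given cell with probability at
  most \<open>1 / m ^ 2\<close>. The union bound \<open>2 * K / m\<close> tends to 0, while a common
  point is seen for every \<open>m\<close>.\<close>

lemma AE_disjoint: "AE \<omega> in P. R \<omega> \<inter> B \<omega> = {}"
proof -
  have "AE \<omega> in P. R \<omega> \<inter> B \<omega> \<inter> {- real K..<real K} = {}" for K :: nat
  proof -
    define c where "c m i = {- real K + real i / real m..<- real K + real (Suc i) / real m}" for m i :: nat
    define H where "H m i = {X::real set. \<not> (finite (X \<inter> c m i) \<and> card (X \<inter> c m i) = 0)}" for m i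
    have cb [measurable]: "c m i \<in> sets borel" for m i unfolding c_def by simp
    have cm: "measure lborel (c m i) = 1 / real m" "emeasure lborel (c m i) < \<infinity>" if "m > 0" for m i
    proof -
      have "- real K + real i / real m \<le> - real K + real (Suc i) / real m"
        using that by (simp add: divide_right_mono)
      moreover have "- real K + real (Suc i) / real m - (- real K + real i / real m) = 1 / real m"
        using that by (simp add: field_simps)
      ultimately show "measure lborel (c m i) = 1 / real m" "emeasure lborel (c m i) < \<infinity>"
        unfolding c_def by (auto simp: measure_def)
    qed
    have Hs: "H m i \<in> sets point_config" for m i
    proof -
      have "UNIV - {X. finite (X \<inter> c m i) \<and> card (X \<inter> c m i) = 0} \<in> sets point_config"
        using sets.compl_sets[OF sets_point_config[OF cb, of m i 0]] by simp
      moreover have "H m i = UNIV - {X. finite (X \<inter> c m i) \<and> card (X \<inter> c m i) = 0}" unfolding H_def by auto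
      ultimately show ?thesis by simp
    qed
    define E where "E m = (\<Union>i\<in>{..<2*K*m}. (\<lambda>x. (R x, B x)) -` (H m i \<times> H m i) \<inter> space P)" for m
    have Ev: "(\<lambda>x. (R x, B x)) -` (H m i \<times> H m i) \<inter> space P \<in> events" for m i
      by (rule measurable_sets[of _ _ "point_config \<Otimes>\<^sub>M point_config"]) (use Hs in auto)
    then have E: "E m \<in> events" for m unfolding E_def by (intro sets.finite_UN) (auto simp only: finite_lessThan)
    have le: "prob (E m) \<le> 2 * real K / real m" if m: "m > 0" for m
    proof -
      have "prob (E m) \<le> (\<Sum>i<2*K*m. prob ((\<lambda>x. (R x, B x)) -` (H m i \<times> H m i) \<inter> space P))"
        unfolding E_def by (rule measure_UNION_le) (use Ev in auto)
      also have "\<dots> \<le> (\<Sum>i<2*K*m. 1 / real m * (1 / real m))"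
      proof (rule sum_mono)
        fix i
        have "prob (R -` H m i \<inter> space P) \<le> 1 / real m" "prob (B -` H m i \<inter> space P) \<le> 1 / real m"
          using prob_nonempty_le[OF poissonR cb, of m i] prob_nonempty_le[OF poissonB cb, of m i] cm[OF m, of i]
          unfolding H_def by simp_all
        then show "prob ((\<lambda>x. (R x, B x)) -` (H m i \<times> H m i) \<inter> space P) \<le> 1 / real m * (1 / real m)"
          unfolding indep_varD[OF indep Hs Hs] by (intro mult_mono) auto
      qed
      also have "\<dots> = 2 * real K / real m" using m by (simp add: field_simps)
      finally show ?thesis .
    qed
    have sub: "\<omega> \<in> E m" if \<omega>: "\<omega> \<in> space P" "R \<omega> \<inter> B \<omega> \<inter> {- real K..<real K} \<noteq> {}" and m: "m > 0" for \<omega> m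
    proof -
      obtain x where x: "x \<in> R \<omega>" "x \<in> B \<omega>" "- real K \<le> x" "x < real K" using \<omega> by auto
      define i where "i = nat \<lfloor>(x + real K) * real m\<rfloor>"
      have "0 \<le> (x + real K) * real m" using x by simp
      then have i: "real i \<le> (x + real K) * real m" "(x + real K) * real m < real i + 1"
        unfolding i_def by linarith+
      then have "x \<in> c m i" unfolding c_def using m by (auto simp: field_simps)
      moreover have "i < 2 * K * m"
      proof -
        have "real i < 2 * real K * real m" using i(1) x m by (smt (verit) mult_strict_right_mono of_nat_0_less_iff)
        then show ?thesis by (metis of_nat_less_iff of_nat_mult of_nat_numeral)
      qed
      moreover from \<open>x \<in> c m i\<close> have "R \<omega> \<in> H m i" "B \<omega> \<in> H m i"
        unfolding H_def using x by (auto simp: card_eq_0_iff)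
      ultimately show ?thesis unfolding E_def using \<omega>(1) by (intro UN_I[of i]) auto
    qed
    have "prob (\<Inter>m. E (Suc m)) \<le> 2 * real K / real (Suc m)" for m
      by (rule order_trans[OF finite_measure_mono le[of "Suc m"]]) (use E in auto)
    moreover have "(\<lambda>m. 2 * real K / real (Suc m)) \<longlonglongrightarrow> 0"
      using LIMSEQ_Suc[OF lim_const_over_n[of "2 * real K"]] .
    ultimately have "prob (\<Inter>m. E (Suc m)) \<le> 0" by (intro LIMSEQ_le_const) auto
    then have "prob (\<Inter>m. E (Suc m)) = 0" by (simp add: measure_le_0_iff)
    moreover have "(\<Inter>m. E (Suc m)) \<in> events" using E by auto
    ultimately have "(\<Inter>m. E (Suc m)) \<in> null_sets P" by (simp add: null_sets_def emeasure_eq_measure)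
    then have "AE \<omega> in P. \<omega> \<notin> (\<Inter>m. E (Suc m))" by (rule AE_not_in)
    then show ?thesis using AE_space by eventually_elim (use sub in blast)
  qed
  then have "AE \<omega> in P. \<forall>K::nat. R \<omega> \<inter> B \<omega> \<inter> {- real K..<real K} = {}" by (simp add: AE_all_countable)
  then show ?thesis
  proof eventually_elim
    fix \<omega> assume *: "\<forall>K::nat. R \<omega> \<inter> B \<omega> \<inter> {- real K..<real K} = {}"
    have "x \<notin> R \<omega> \<inter> B \<omega>" for x
    proof
      assume "x \<in> R \<omega> \<inter> B \<omega>"
      moreover obtain K :: nat where "\<bar>x\<bar> < real K" using reals_Archimedean2 by blast
      ultimately have "x \<in> R \<omega> \<inter> B \<omega> \<inter> {- real K..<real K}" by auto
      then show False using * by blast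
    qed
    then show "R \<omega> \<inter> B \<omega> = {}" by blast
  qed
qed

end

section \<open>Independence of the pairs of counts in disjoint unit cells\<close>

locale two_poisson_cells = two_poisson +
  fixes A :: "nat \<Rightarrow> real set"
  assumes A_borel [measurable]: "\<And>i. A i \<in> sets borel"
    and A_unit: "\<And>i. emeasure lborel (A i) = 1"
    and A_disjoint: "disjoint_family A"
begin

text \<open>Pairs of counts form one independent sequence, to which patterns and the 0-1 law apply.
  The position and order of the cells stay open, so that walks in both directions and shifted grids
  are instances.\<close>

definition counts :: "nat \<Rightarrow> 'a \<Rightarrow> nat \<times> nat" where
  "counts i \<omega> = (card (R \<omega> \<inter> A i), card (B \<omega> \<inter> A i))"

lemma prob_card:
  assumes "poisson_process P 1 X"
  shows "prob {\<omega> \<in> space P. card (X \<omega> \<inter> A i) = n} = exp (- 1) / fact n"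
proof -
  have "measure lborel (A i) = 1" using A_unit by (simp add: measure_def)
  then show ?thesis
    using poisson_process_prob_card[OF prob_space_P assms A_borel, of i n] A_unit[of i] by simp
qed

lemma measurable_counts [measurable]: "counts i \<in> P \<rightarrow>\<^sub>M count_space UNIV"
proof -
  have "(\<lambda>\<omega>. (card (R \<omega> \<inter> A i), card (B \<omega> \<inter> A i))) \<in> P \<rightarrow>\<^sub>M count_space UNIV \<Otimes>\<^sub>M count_space UNIV"
    by measurable
  then show ?thesis
    unfolding counts_def[abs_def] by (simp add: pair_measure_countable)
qed

lemma prob_cards:
  assumes X: "poisson_process P 1 X" and J: "finite J" "J \<noteq> {}"
  shows "prob (X -` {X. \<forall>i\<in>J. card (X \<inter> A i) \<in> a i} \<inter> space P) =
    (\<Prod>i\<in>J. prob (X -` {X. card (X \<inter> A i) \<in> a i} \<inter> space P))"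
proof -
  have ind: "indep_vars (\<lambda>_. count_space UNIV) (\<lambda>i \<omega>. card (X \<omega> \<inter> A i)) J"
    using poisson_processD(3)[OF X J(1), of A] A_unit A_disjoint disjoint_family_on_mono[of J UNIV A] by simp
  have "X -` {X. \<forall>i\<in>J. card (X \<inter> A i) \<in> a i} \<inter> space P = (\<Inter>i\<in>J. (\<lambda>\<omega>. card (X \<omega> \<inter> A i)) -` a i \<inter> space P)"
    using J by auto
  also have "prob \<dots> = (\<Prod>i\<in>J. prob ((\<lambda>\<omega>. card (X \<omega> \<inter> A i)) -` a i \<inter> space P))"
    by (rule indep_varsD_finite[OF ind]) (use J in auto)
  also have "\<dots> = (\<Prod>i\<in>J. prob (X -` {X. card (X \<inter> A i) \<in> a i} \<inter> space P))"
    by (simp add: vimage_def)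
  finally show ?thesis .
qed

lemma sets_card_in: "{X. card (X \<inter> A i) \<in> a} \<in> sets point_config"
  using measurable_sets[OF measurable_card_count[OF A_borel[of i]], of a] by (simp add: vimage_def)

lemma prob_counts_rectangle:
  "prob (counts i -` (a \<times> b) \<inter> space P) =
     prob (R -` {X. card (X \<inter> A i) \<in> a} \<inter> space P) * prob (B -` {X. card (X \<inter> A i) \<in> b} \<inter> space P)"
proof -
  have "counts i -` (a \<times> b) \<inter> space P =
     (\<lambda>\<omega>. (R \<omega>, B \<omega>)) -` ({X. card (X \<inter> A i) \<in> a} \<times> {X. card (X \<inter> A i) \<in> b}) \<inter> space P"
    unfolding counts_def by auto
  then show ?thesis using indep_varD[OF indep sets_card_in sets_card_in, of i a i b] by simp
qed

text \<open>On rectangles the joint probability splits first by the independence of \<open>R\<close>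
  and \<open>B\<close>, then for each colour by the independence over disjoint cells. Rectangles are
  stable under intersection and, pairs of counts being countable, generate all events of a
  cell.\<close>

lemma indep_vars_counts: "indep_vars (\<lambda>_. count_space UNIV) counts UNIV"
proof -
  define F where "F i = {counts i -` (a \<times> b) \<inter> space P | a b. True}" for i
  have Fev: "F i \<subseteq> events" for i unfolding F_def by (auto intro!: measurable_sets[OF measurable_counts])
  have "indep_sets F UNIV"
  proof (rule indep_setsI)
    fix S J assume J: "J \<noteq> {}" "finite J" and "\<forall>j\<in>J. S j \<in> F j"
    then have "\<forall>j\<in>J. \<exists>a b. S j = counts j -` (a \<times> b) \<inter> space P" unfolding F_def by auto
    then obtain a b where S: "\<And>j. j \<in> J \<Longrightarrow> S j = counts j -` (a j \<times> b j) \<inter> space P" by metis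
    have sets: "{X. \<forall>i\<in>J. card (X \<inter> A i) \<in> a i} \<in> sets point_config" for a
    proof -
      have "{X. \<forall>i\<in>J. card (X \<inter> A i) \<in> a i} = (\<Inter>i\<in>J. {X. card (X \<inter> A i) \<in> a i})" by auto
      then show ?thesis using J sets_card_in by (auto intro!: sets.finite_INT)
    qed
    have "(\<Inter>j\<in>J. S j) = (\<lambda>\<omega>. (R \<omega>, B \<omega>)) -` ({X. \<forall>i\<in>J. card (X \<inter> A i) \<in> a i} \<times> {X. \<forall>i\<in>J. card (X \<inter> A i) \<in> b i}) \<inter> space P"
      using J S unfolding counts_def by auto
    then have "prob (\<Inter>j\<in>J. S j) = prob (R -` {X. \<forall>i\<in>J. card (X \<inter> A i) \<in> a i} \<inter> space P) *
       prob (B -` {X. \<forall>i\<in>J. card (X \<inter> A i) \<in> b i} \<inter> space P)"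
      using indep_varD[OF indep sets sets] by simp
    also have "\<dots> = (\<Prod>j\<in>J. prob (R -` {X. card (X \<inter> A j) \<in> a j} \<inter> space P) *
        prob (B -` {X. card (X \<inter> A j) \<in> b j} \<inter> space P))"
      by (simp only: prob_cards[OF poissonR J(2,1)] prob_cards[OF poissonB J(2,1)] prod.distrib)
    also have "\<dots> = (\<Prod>j\<in>J. prob (S j))"
      by (rule prod.cong) (simp_all only: S prob_counts_rectangle)
    finally show "prob (\<Inter>j\<in>J. S j) = (\<Prod>j\<in>J. prob (S j))" .
  qed (use Fev in auto)
  moreover have "Int_stable (F i)" for i
  proof (rule Int_stableI)
    fix S T assume "S \<in> F i" "T \<in> F i"
    then obtain a b a' b' where "S = counts i -` (a \<times> b) \<inter> space P" "T = counts i -` (a' \<times> b') \<inter> space P"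
      unfolding F_def by blast
    then have "S \<inter> T = counts i -` ((a \<inter> a') \<times> (b \<inter> b')) \<inter> space P" by auto
    then show "S \<inter> T \<in> F i" unfolding F_def by blast
  qed
  ultimately have *: "indep_sets (\<lambda>i. sigma_sets (space P) (F i)) UNIV" by (rule indep_sets_sigma)
  have "indep_sets (\<lambda>i. {counts i -` S \<inter> space P | S. S \<in> sets (count_space UNIV)}) UNIV"
  proof (rule indep_sets_mono_sets[OF *])
    fix i
    interpret S: sigma_algebra "space P" "sigma_sets (space P) (F i)"
      by (rule sigma_algebra_sigma_sets) (auto simp: F_def)
    have "counts i -` S \<inter> space P \<in> sigma_sets (space P) (F i)" for S
    proof -
      have "counts i -` ({fst v} \<times> {snd v}) \<inter> space P \<in> sigma_sets (space P) (F i)" for v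
        unfolding F_def by (intro sigma_sets.Basic) blast
      then have "(\<Union>v\<in>S. counts i -` ({fst v} \<times> {snd v}) \<inter> space P) \<in> sigma_sets (space P) (F i)"
        by (intro S.countable_UN') auto
      moreover have "counts i -` S \<inter> space P = (\<Union>v\<in>S. counts i -` ({fst v} \<times> {snd v}) \<inter> space P)"
        by force
      ultimately show ?thesis by simp
    qed
    then show "{counts i -` S \<inter> space P | S. S \<in> sets (count_space UNIV)} \<subseteq> sigma_sets (space P) (F i)" by blast
  qed
  then show ?thesis unfolding indep_vars_def2 by simp
qed

lemma prob_counts: "prob {\<omega> \<in> space P. counts i \<omega> = v} = exp (- 1) / fact (fst v) * (exp (- 1) / fact (snd v))"
proof -
  have "{\<omega> \<in> space P. counts i \<omega> = v} = counts i -` ({fst v} \<times> {snd v}) \<inter> space P" by auto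
  moreover have "X -` {X. card (X \<inter> A i) \<in> {n}} \<inter> space P = {\<omega> \<in> space P. card (X \<omega> \<inter> A i) = n}" for X n
    by auto
  ultimately show ?thesis
    unfolding \<open>{\<omega> \<in> space P. counts i \<omega> = v} = _\<close> prob_counts_rectangle
    using prob_card[OF poissonR] prob_card[OF poissonB] by simp
qed

lemma AE_counts_pattern:
  assumes "L > 0"
  shows "AE \<omega> in P. \<exists>j. \<forall>l<L. counts (j * L + l) \<omega> = v l"
  by (rule AE_pattern[OF indep_vars_counts prob_counts _ assms]) auto

end

section \<open>Exchange of colours and oscillation of the walk of blue minus red counts\<close>

context two_poisson
begin

text \<open>The law of an independent pair is determined by its marginals, and these coincide as
  both processes have intensity 1.\<close>

lemma distr_pair_commute:
  "distr P (point_config \<Otimes>\<^sub>M point_config) (\<lambda>\<omega>. (R \<omega>, B \<omega>)) =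
   distr P (point_config \<Otimes>\<^sub>M point_config) (\<lambda>\<omega>. (B \<omega>, R \<omega>))"
  using indep indep_var_commute[OF indep] poisson_process_distr_unique[OF prob_space_P poissonR poissonB]
  unfolding indep_var_distribution_eq by metis

end

text \<open>Dropping the first \<open>N\<close> terms changes all later partial sums by a constant
  bounded by \<open>C\<close>, so unboundedness is decided by the tail of the sequence.\<close>

lemma unbounded_partial_sums_tail:
  fixes D :: "nat \<Rightarrow> real"
  shows "(\<forall>K::nat. \<exists>n. real K \<le> (\<Sum>i<n. D i)) \<longleftrightarrow> (\<forall>K::nat. \<exists>n. real K \<le> (\<Sum>i=N..<N+n. D i))"
proof -
  obtain C :: nat where C: "(\<Sum>i<N. \<bar>D i\<bar>) \<le> real C" using real_arch_simple by blast
  have bound: "\<bar>\<Sum>i<n. D i\<bar> \<le> real C" if "n \<le> N" for n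
  proof -
    have "\<bar>\<Sum>i<n. D i\<bar> \<le> (\<Sum>i<n. \<bar>D i\<bar>)" by (rule sum_abs)
    also have "\<dots> \<le> (\<Sum>i<N. \<bar>D i\<bar>)" using that by (intro sum_mono2) auto
    finally show ?thesis using C by simp
  qed
  have split: "(\<Sum>i<N+n. D i) = (\<Sum>i<N. D i) + (\<Sum>i=N..<N+n. D i)" for n
    using sum.atLeastLessThan_concat[of 0 N "N + n" D] by (simp add: lessThan_atLeast0)
  show ?thesis
  proof safe
    fix K :: nat assume "\<forall>K::nat. \<exists>n. real K \<le> (\<Sum>i<n. D i)"
    then obtain n where n: "real (K + C + 1) \<le> (\<Sum>i<n. D i)" by blast
    then have "\<not> n \<le> N" using bound[of n] by auto
    then obtain n' where "n = N + n'" by (metis le_add_diff_inverse nat_le_linear)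
    then show "\<exists>n. real K \<le> (\<Sum>i=N..<N+n. D i)"
      using n split[of n'] bound[of N] by (intro exI[of _ n']) simp
  next
    fix K :: nat assume "\<forall>K::nat. \<exists>n. real K \<le> (\<Sum>i=N..<N+n. D i)"
    then obtain n where "real (K + C) \<le> (\<Sum>i=N..<N+n. D i)" by blast
    then show "\<exists>n. real K \<le> (\<Sum>i<n. D i)"
      using split[of n] bound[of N] by (intro exI[of _ "N + n"]) simp
  qed
qed

context two_poisson_cells
begin

definition excess :: "nat \<Rightarrow> 'a \<Rightarrow> real" where
  "excess i \<omega> = real (card (B \<omega> \<inter> A i)) - real (card (R \<omega> \<inter> A i))"

lemma measurable_excess [measurable]: "excess i \<in> borel_measurable P"
  unfolding excess_def[abs_def] by measurable

lemma prob_blue_excess_0_1: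
  "prob {\<omega> \<in> space P. \<forall>K::nat. \<exists>n. real K \<le> (\<Sum>i<n. excess i \<omega>)} \<in> {0, 1}"
proof -
  define F where "F i = sigma_sets (space P) {counts i -` S \<inter> space P | S. S \<in> sets (count_space UNIV)}" for i
  let ?U = "{\<omega> \<in> space P. \<forall>K::nat. \<exists>n. real K \<le> (\<Sum>i<n. excess i \<omega>)}"
  have sa: "sigma_algebra (space P) (F i)" for i
    unfolding F_def by (rule sigma_algebra_sigma_sets) auto
  have "?U \<in> sigma_sets (space P) (\<Union> (F ` {N..}))" for N
  proof -
    \<comment> \<open>\<open>MN\<close> carries the information of the cells from \<open>N\<close>
      on; the event is measurable for every such \<open>N\<close>, which makes it a tail
      event.\<close>
    define MN where "MN = sigma (space P) (\<Union> (F ` {N..}))"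
    have F_Pow: "\<Union> (F ` {N..}) \<subseteq> Pow (space P)"
      using sigma_sets_into_sp[of "{counts i -` S \<inter> space P | S. S \<in> sets (count_space UNIV)}" "space P" for i]
      unfolding F_def by blast
    then have sp: "space MN = space P" and st: "sets MN = sigma_sets (space P) (\<Union> (F ` {N..}))"
      unfolding MN_def by (auto simp: sets_measure_of space_measure_of)
    have c: "counts i \<in> MN \<rightarrow>\<^sub>M count_space UNIV" if "i \<ge> N" for i
    proof (rule measurableI)
      fix S :: "(nat \<times> nat) set" assume "S \<in> sets (count_space UNIV)"
      then have "counts i -` S \<inter> space P \<in> F i" unfolding F_def by (intro sigma_sets.Basic) blast
      then show "counts i -` S \<inter> space MN \<in> sets MN"
        unfolding sp st using that by (intro sigma_sets.Basic) auto
    qed simp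
    have e: "excess i \<in> borel_measurable MN" if "i \<ge> N" for i
    proof -
      have "(\<lambda>\<omega>. real (snd (counts i \<omega>)) - real (fst (counts i \<omega>))) \<in> borel_measurable MN"
        by (rule measurable_compose[OF c[OF that]]) simp
      then show ?thesis unfolding excess_def[abs_def] counts_def by simp
    qed
    have [measurable]: "(\<lambda>\<omega>. \<Sum>i=N..<N+n. excess i \<omega>) \<in> borel_measurable MN" for n
      by (rule borel_measurable_sum) (use e in auto)
    have "{\<omega> \<in> space MN. \<forall>K::nat. \<exists>n. real K \<le> (\<Sum>i=N..<N+n. excess i \<omega>)} \<in> sets MN"
      by measurable
    then show ?thesis unfolding sp st unbounded_partial_sums_tail[of _ N] .
  qed
  then have "?U \<in> tail_events F" unfolding tail_events_def by blast
  then have "prob ?U = 0 \<or> prob ?U = 1"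
    using kolmogorov_0_1_law[of F ?U] sa indep_vars_counts unfolding F_def indep_vars_def by blast
  then show ?thesis by blast
qed

text \<open>A run of \<open>2 * K + 1\<close> cells with one blue and no red point raises the walk
  by \<open>2 * K + 1\<close>, so its distance from 0 is at least \<open>K\<close> before or after
  the run. Such a run occurs almost surely.\<close>

lemma AE_abs_excess_unbounded: "AE \<omega> in P. \<forall>K::nat. \<exists>n. real K \<le> \<bar>\<Sum>i<n. excess i \<omega>\<bar>"
  unfolding AE_all_countable
proof
  fix K :: nat
  have "AE \<omega> in P. \<exists>j. \<forall>l<2 * K + 1. counts (j * (2 * K + 1) + l) \<omega> = (0, 1)"
    by (rule AE_counts_pattern) simp
  then show "AE \<omega> in P. \<exists>n. real K \<le> \<bar>\<Sum>i<n. excess i \<omega>\<bar>"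
  proof eventually_elim
    fix \<omega> assume "\<exists>j. \<forall>l<2 * K + 1. counts (j * (2 * K + 1) + l) \<omega> = (0, 1)"
    then obtain j where j: "\<And>l. l < 2 * K + 1 \<Longrightarrow> counts (j * (2 * K + 1) + l) \<omega> = (0, 1)" by blast
    define a where "a = j * (2 * K + 1)"
    have "(\<Sum>i=a..<a+(2*K+1). excess i \<omega>) = (\<Sum>i=a..<a+(2*K+1). 1)"
    proof (rule sum.cong[OF refl])
      fix i assume "i \<in> {a..<a+(2*K+1)}"
      then show "excess i \<omega> = 1" using j[of "i - a"] unfolding a_def[symmetric] counts_def excess_def by auto
    qed
    also have "\<dots> = 2 * real K + 1" by simp
    finally have "(\<Sum>i<a+(2*K+1). excess i \<omega>) = (\<Sum>i<a. excess i \<omega>) + (2 * real K + 1)"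
      using sum.atLeastLessThan_concat[of 0 a "a+(2*K+1)" "\<lambda>i. excess i \<omega>"] by (simp add: lessThan_atLeast0)
    then have "real K \<le> \<bar>\<Sum>i<a+(2*K+1). excess i \<omega>\<bar> \<or> real K \<le> \<bar>\<Sum>i<a. excess i \<omega>\<bar>" by linarith
    then show "\<exists>n. real K \<le> \<bar>\<Sum>i<n. excess i \<omega>\<bar>" by blast
  qed
qed

text \<open>Either the walk or its negative is unbounded above; both have the same law as \<open>R\<close> and \<open>B\<close>
  are exchangeable, and each is unbounded with probability 0 or 1.\<close>

lemma AE_excess_unbounded:
  "AE \<omega> in P. (\<forall>K::nat. \<exists>n. real K \<le> (\<Sum>i<n. excess i \<omega>)) \<and> (\<forall>K::nat. \<exists>n. real K \<le> - (\<Sum>i<n. excess i \<omega>))"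
proof -
  let ?U = "{\<omega> \<in> space P. \<forall>K::nat. \<exists>n. real K \<le> (\<Sum>i<n. excess i \<omega>)}"
  let ?V = "{\<omega> \<in> space P. \<forall>K::nat. \<exists>n. real K \<le> - (\<Sum>i<n. excess i \<omega>)}"
  \<comment> \<open>The event is read as a property of the pair of configurations; swapping the pair
    turns \<open>?U\<close> into \<open>?V\<close>.\<close>
  define Q where "Q = {p \<in> space (point_config \<Otimes>\<^sub>M point_config).
     \<forall>K::nat. \<exists>n. real K \<le> (\<Sum>i<n. real (card (snd p \<inter> A i)) - real (card (fst p \<inter> A i)))}"
  have Q: "Q \<in> sets (point_config \<Otimes>\<^sub>M point_config)" unfolding Q_def by measurable
  have ev: "?U \<in> events" "?V \<in> events" by measurable
  have "emeasure P ?U = emeasure (distr P (point_config \<Otimes>\<^sub>M point_config) (\<lambda>\<omega>. (R \<omega>, B \<omega>))) Q"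
    using Q by (subst emeasure_distr) (auto simp: Q_def excess_def space_pair_measure intro!: arg_cong[where f="emeasure P"])
  also have "\<dots> = emeasure (distr P (point_config \<Otimes>\<^sub>M point_config) (\<lambda>\<omega>. (B \<omega>, R \<omega>))) Q"
    by (simp only: distr_pair_commute)
  also have "\<dots> = emeasure P ?V"
    using Q by (subst emeasure_distr)
      (auto simp: Q_def excess_def space_pair_measure sum_negf[symmetric] intro!: arg_cong[where f="emeasure P"])
  finally have eq: "prob ?U = prob ?V" by (simp add: measure_def)
  have "AE \<omega> in P. \<omega> \<in> ?U \<union> ?V"
    using AE_abs_excess_unbounded AE_space
  proof eventually_elim
    fix \<omega> assume u: "\<forall>K::nat. \<exists>n. real K \<le> \<bar>\<Sum>i<n. excess i \<omega>\<bar>" and \<omega>: "\<omega> \<in> space P"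
    show "\<omega> \<in> ?U \<union> ?V"
    proof (rule ccontr)
      assume "\<omega> \<notin> ?U \<union> ?V"
      then obtain K K' :: nat where "\<And>n. (\<Sum>i<n. excess i \<omega>) < real K" "\<And>n. - (\<Sum>i<n. excess i \<omega>) < real K'"
        using \<omega> by (auto simp: not_le)
      moreover obtain n where "real (max K K') \<le> \<bar>\<Sum>i<n. excess i \<omega>\<bar>" using u by blast
      ultimately show False by (smt (verit) max.cobounded1 max.cobounded2 of_nat_mono)
    qed
  qed
  \<comment> \<open>The union has probability 1 and both events have equal probability, hence at
    least 1/2; being 0 or 1, it is 1.\<close>
  then have "1 \<le> prob (?U \<union> ?V)" using ev prob_eq_1[of "?U \<union> ?V"] by simp
  also have "\<dots> \<le> prob ?U + prob ?V" using ev by (rule measure_Un_le)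
  finally have "prob ?U = 1" using eq prob_blue_excess_0_1 by auto
  then have "AE \<omega> in P. \<omega> \<in> ?U" "AE \<omega> in P. \<omega> \<in> ?V"
    using eq ev prob_eq_1[of ?U] prob_eq_1[of ?V] by auto
  then show ?thesis by eventually_elim blast
qed

end

text \<open>Cells open on the left tile intervals right of 0, cells open on the right tile intervals
  left of 0; these are the conventions of \<open>recurrent\<close> in its two directions.\<close>

lemma sum_card_cells:
  assumes "locally_finite_points X"
  shows "(\<Sum>i<n. card (X \<inter> {real i<..real i + 1})) = card (X \<inter> {0<..real n})"
    and "(\<Sum>i<n. card (X \<inter> {- real i - 1..<- real i})) = card (X \<inter> {- real n..<0})"
proof (induction n)
  case (Suc n)
  { case 1
    show ?case using Suc.IH(1) card_points_split(3)[OF assms, of 0 "real n" "real n + 1"] by (simp add: add.commute) }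
  { case 2
    have "- real (Suc n) = - real n - 1" by simp
    moreover have "card (X \<inter> {- real n - 1..<0}) =
        card (X \<inter> {- real n - 1..<- real n}) + card (X \<inter> {- real n..<0})"
      using card_points_split(4)[OF assms, of "- real n - 1" "- real n" 0] by (cases "n = 0") simp_all
    ultimately show ?case using Suc.IH(2) by (simp only: sum.lessThan_Suc add.commute) }
qed auto

section \<open>Almost sure recurrence and isolating patterns\<close>

context two_poisson
begin

lemma AE_recurrent: "AE \<omega> in P. recurrent (R \<omega>) (B \<omega>)"
proof -
  interpret r: two_poisson_cells P R B "\<lambda>i. {real i<..real i + 1}"
    by unfold_locales (auto simp: disjoint_family_on_def)
  interpret l: two_poisson_cells P R B "\<lambda>i. {- real i - 1..<- real i}"
    by unfold_locales (auto simp: disjoint_family_on_def)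
  show ?thesis
    using r.AE_excess_unbounded l.AE_excess_unbounded
      AE_locally_finite_points[OF poissonR] AE_locally_finite_points[OF poissonB]
  proof eventually_elim
    fix \<omega>
    assume r: "(\<forall>K::nat. \<exists>n. real K \<le> (\<Sum>i<n. r.excess i \<omega>)) \<and> (\<forall>K::nat. \<exists>n. real K \<le> - (\<Sum>i<n. r.excess i \<omega>))"
      and l: "(\<forall>K::nat. \<exists>n. real K \<le> (\<Sum>i<n. l.excess i \<omega>)) \<and> (\<forall>K::nat. \<exists>n. real K \<le> - (\<Sum>i<n. l.excess i \<omega>))"
      and R: "locally_finite_points (R \<omega>)" and B: "locally_finite_points (B \<omega>)"
    have sr: "(\<Sum>i<n. r.excess i \<omega>) = real (card (B \<omega> \<inter> {0<..real n})) - real (card (R \<omega> \<inter> {0<..real n}))" for n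
      unfolding r.excess_def sum_subtractf of_nat_sum[symmetric] sum_card_cells[OF R] sum_card_cells[OF B] ..
    have sl: "(\<Sum>i<n. l.excess i \<omega>) = real (card (B \<omega> \<inter> {- real n..<0})) - real (card (R \<omega> \<inter> {- real n..<0}))" for n
      unfolding l.excess_def sum_subtractf of_nat_sum[symmetric] sum_card_cells[OF R] sum_card_cells[OF B] ..
    show "recurrent (R \<omega>) (B \<omega>)"
      unfolding recurrent_def
    proof (intro allI conjI)
      fix a :: real and K :: nat
      \<comment> \<open>The walk starts at 0 while the surplus is wanted from \<open>a\<close>. The
        demand is raised by the points between: blue ones are lost when \<open>a > 0\<close>, red
        ones are gained when \<open>a < 0\<close>.\<close>
      let ?K = "K + card (B \<omega> \<inter> {0<..a}) + card (R \<omega> \<inter> {a<..0}) + 1"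
      obtain n where "real ?K \<le> real (card (B \<omega> \<inter> {0<..real n})) - real (card (R \<omega> \<inter> {0<..real n}))"
        using r[unfolded sr] by blast
      then have n: "?K + card (R \<omega> \<inter> {0<..real n}) \<le> card (B \<omega> \<inter> {0<..real n})" by linarith
      have an: "a < real n"
      proof (rule ccontr)
        assume "\<not> a < real n"
        then have "card (B \<omega> \<inter> {0<..real n}) \<le> card (B \<omega> \<inter> {0<..a})" by (intro card_points_mono[OF B]) auto
        then show False using n by simp
      qed
      have "card (R \<omega> \<inter> {a<..real n}) + K < card (B \<omega> \<inter> {a<..real n})"
      proof (cases "0 \<le> a")
        case True
        have "card (R \<omega> \<inter> {a<..real n}) \<le> card (R \<omega> \<inter> {0<..real n})" using True by (intro card_points_mono[OF R]) auto
        then show ?thesis using n card_points_split(3)[OF B, of 0 a "real n"] True an by simp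
      next
        case False
        have "card (B \<omega> \<inter> {0<..real n}) \<le> card (B \<omega> \<inter> {a<..real n})" using False by (intro card_points_mono[OF B]) auto
        then show ?thesis using n card_points_split(3)[OF R, of a 0 "real n"] False by simp
      qed
      then show "\<exists>t>a. card (R \<omega> \<inter> {a<..t}) + K < card (B \<omega> \<inter> {a<..t})" using an by (intro exI[of _ "real n"] conjI)
    next
      fix a :: real and K :: nat
      \<comment> \<open>Mirror image: red points between \<open>a\<close> and 0 are lost when
        \<open>a < 0\<close>, blue ones are gained when \<open>a > 0\<close>.\<close>
      let ?K = "K + card (R \<omega> \<inter> {a..<0}) + card (B \<omega> \<inter> {0..<a}) + 1"
      obtain n where "real ?K \<le> - (real (card (B \<omega> \<inter> {- real n..<0})) - real (card (R \<omega> \<inter> {- real n..<0})))"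
        using l[unfolded sl] by blast
      then have n: "?K + card (B \<omega> \<inter> {- real n..<0}) \<le> card (R \<omega> \<inter> {- real n..<0})" by linarith
      have an: "- real n < a"
      proof (rule ccontr)
        assume "\<not> - real n < a"
        then have "card (R \<omega> \<inter> {- real n..<0}) \<le> card (R \<omega> \<inter> {a..<0})" by (intro card_points_mono[OF R]) auto
        then show False using n by simp
      qed
      have "card (B \<omega> \<inter> {- real n..<a}) + K < card (R \<omega> \<inter> {- real n..<a})"
      proof (cases "a < 0")
        case True
        have "card (B \<omega> \<inter> {- real n..<a}) \<le> card (B \<omega> \<inter> {- real n..<0})" using True by (intro card_points_mono[OF B]) auto
        then show ?thesis using n card_points_split(4)[OF R, of "- real n" a 0] True an by simp
      next
        case False
        have "card (R \<omega> \<inter> {- real n..<0}) \<le> card (R \<omega> \<inter> {- real n..<a})" using False by (intro card_points_mono[OF R]) auto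
        moreover have "card (B \<omega> \<inter> {- real n..<a}) = card (B \<omega> \<inter> {- real n..<0}) + card (B \<omega> \<inter> {0..<a})"
          using card_points_split(4)[OF B, of "- real n" 0 a] False by (cases "a = 0") auto
        ultimately show ?thesis using n by simp
      qed
      then show "\<exists>t<a. card (B \<omega> \<inter> {t..<a}) + K < card (R \<omega> \<inter> {t..<a})" using an by (intro exI[of _ "- real n"] conjI)
    qed
  qed
qed

lemma isolating_patternI:
  assumes "locally_finite_points X" "locally_finite_points Y"
    and "card (X \<inter> {real_of_int n..<n+1}) = 1" "card (Y \<inter> {real_of_int n..<n+1}) = 0"
    and "card (X \<inter> {real_of_int n+1..<n+2}) = 0" "card (Y \<inter> {real_of_int n+1..<n+2}) = 0"
    and "card (X \<inter> {real_of_int n+2..<n+3}) = 0" "card (Y \<inter> {real_of_int n+2..<n+3}) = 1"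
  shows "isolating_pattern X Y n"
proof -
  have split: "{real_of_int n+1..<n+3} = {real_of_int n+1..<n+2} \<union> {real_of_int n+2..<n+3}"
    "{real_of_int n..<n+2} = {real_of_int n..<n+1} \<union> {real_of_int n+1..<n+2}" by auto
  have "Y \<inter> {real_of_int n..<n+1} = {}" "X \<inter> {real_of_int n+1..<n+2} = {}"
      "Y \<inter> {real_of_int n+1..<n+2} = {}" "X \<inter> {real_of_int n+2..<n+3} = {}"
    using assms(3-) locally_finite_pointsD(3)[OF assms(1)] locally_finite_pointsD(3)[OF assms(2)]
    by (simp_all add: card_eq_0_iff)
  then have "X \<inter> {real_of_int n+1..<n+3} = {}" "Y \<inter> {real_of_int n..<n+2} = {}"
    unfolding split Int_Un_distrib by simp_all
  moreover have "X \<inter> {real_of_int n..<n+1} \<noteq> {}" "Y \<inter> {real_of_int n+2..<n+3} \<noteq> {}"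
    using assms(3,8) by (metis card.empty zero_neq_one)+
  ultimately show ?thesis unfolding isolating_pattern_def by simp
qed

lemma AE_patterned: "AE \<omega> in P. patterned (R \<omega>) (B \<omega>)"
proof -
  \<comment> \<open>The (red, blue) counts of three consecutive cells, from left to right, that
    produce an isolating pattern.\<close>
  define v where "v = ((!) [(1, 0), (0, 0), (0, 1)] :: nat \<Rightarrow> nat \<times> nat)"
  have right: "AE \<omega> in P. \<exists>n. real z \<le> real_of_int n \<and> isolating_pattern (R \<omega>) (B \<omega>) n" for z :: nat
  proof -
    interpret c: two_poisson_cells P R B "\<lambda>i. {real (z + i)..<real (z + i) + 1}"
      by unfold_locales (auto simp: disjoint_family_on_def)
    have "AE \<omega> in P. \<exists>j. \<forall>l<3. c.counts (j * 3 + l) \<omega> = v l"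
      by (rule c.AE_counts_pattern) simp
    then show ?thesis
      using AE_locally_finite_points[OF poissonR] AE_locally_finite_points[OF poissonB]
    proof eventually_elim
      fix \<omega> assume "\<exists>j. \<forall>l<3. c.counts (j * 3 + l) \<omega> = v l"
        and lf: "locally_finite_points (R \<omega>)" "locally_finite_points (B \<omega>)"
      then obtain j where j: "\<And>l. l < 3 \<Longrightarrow> c.counts (j * 3 + l) \<omega> = v l" by blast
      define n where "n = int (z + j * 3)"
      have "{real_of_int n..<n+1} = {real (z + (j * 3 + 0))..<real (z + (j * 3 + 0)) + 1}"
        "{real_of_int n+1..<n+2} = {real (z + (j * 3 + 1))..<real (z + (j * 3 + 1)) + 1}"
        "{real_of_int n+2..<n+3} = {real (z + (j * 3 + 2))..<real (z + (j * 3 + 2)) + 1}"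
        unfolding n_def by (rule arg_cong2[where f=atLeastLessThan]; simp)+
      then have "isolating_pattern (R \<omega>) (B \<omega>) n"
        using j[of 0, unfolded c.counts_def v_def] j[of 1, unfolded c.counts_def v_def]
          j[of 2, unfolded c.counts_def v_def]
        by (intro isolating_patternI[OF lf]) (simp_all only: prod.inject, simp_all)
      then show "\<exists>n. real z \<le> real_of_int n \<and> isolating_pattern (R \<omega>) (B \<omega>) n"
        by (intro exI[of _ n]) (simp add: n_def)
    qed
  qed
  have left: "AE \<omega> in P. \<exists>n. real_of_int n \<le> - real z \<and> isolating_pattern (R \<omega>) (B \<omega>) n" for z :: nat
  proof -
    interpret c: two_poisson_cells P R B "\<lambda>i. {- real (z + i) - 1..<- real (z + i)}"
      by unfold_locales (auto simp: disjoint_family_on_def)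
    \<comment> \<open>These cells are numbered from right to left, so the pattern is read
      backwards.\<close>
    have "AE \<omega> in P. \<exists>j. \<forall>l<3. c.counts (j * 3 + l) \<omega> = v (2 - l)"
      by (rule c.AE_counts_pattern) simp
    then show ?thesis
      using AE_locally_finite_points[OF poissonR] AE_locally_finite_points[OF poissonB]
    proof eventually_elim
      fix \<omega> assume "\<exists>j. \<forall>l<3. c.counts (j * 3 + l) \<omega> = v (2 - l)"
        and lf: "locally_finite_points (R \<omega>)" "locally_finite_points (B \<omega>)"
      then obtain j where j: "\<And>l. l < 3 \<Longrightarrow> c.counts (j * 3 + l) \<omega> = v (2 - l)" by blast
      \<comment> \<open>The left end of the cell with index \<open>j * 3 + 2\<close>, the leftmost
        of the three.\<close>
      define n where "n = - int (z + j * 3) - 3"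
      have "{real_of_int n..<n+1} = {- real (z + (j * 3 + 2)) - 1..<- real (z + (j * 3 + 2))}"
        "{real_of_int n+1..<n+2} = {- real (z + (j * 3 + 1)) - 1..<- real (z + (j * 3 + 1))}"
        "{real_of_int n+2..<n+3} = {- real (z + (j * 3 + 0)) - 1..<- real (z + (j * 3 + 0))}"
        unfolding n_def by (rule arg_cong2[where f=atLeastLessThan]; simp)+
      then have "isolating_pattern (R \<omega>) (B \<omega>) n"
        using j[of 0, unfolded c.counts_def v_def] j[of 1, unfolded c.counts_def v_def]
          j[of 2, unfolded c.counts_def v_def]
        by (intro isolating_patternI[OF lf]) (simp_all only: prod.inject, simp_all)
      then show "\<exists>n. real_of_int n \<le> - real z \<and> isolating_pattern (R \<omega>) (B \<omega>) n"
        by (intro exI[of _ n]) (simp add: n_def)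
    qed
  qed
  have "AE \<omega> in P. \<forall>z::nat. \<exists>n. real z \<le> real_of_int n \<and> isolating_pattern (R \<omega>) (B \<omega>) n"
    "AE \<omega> in P. \<forall>z::nat. \<exists>n. real_of_int n \<le> - real z \<and> isolating_pattern (R \<omega>) (B \<omega>) n"
    using left right unfolding AE_all_countable by blast+
  then show ?thesis
  proof eventually_elim
    fix \<omega> assume r: "\<forall>z::nat. \<exists>n. real z \<le> real_of_int n \<and> isolating_pattern (R \<omega>) (B \<omega>) n"
      and l: "\<forall>z::nat. \<exists>n. real_of_int n \<le> - real z \<and> isolating_pattern (R \<omega>) (B \<omega>) n"
    show "patterned (R \<omega>) (B \<omega>)"
      unfolding patterned_def
    proof
      fix x :: real
      obtain z :: nat where "\<bar>x\<bar> \<le> real z" using real_arch_simple by blast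
      then have "x \<le> real z" "- real z \<le> x" by auto
      then show "(\<exists>n. x \<le> real_of_int n \<and> isolating_pattern (R \<omega>) (B \<omega>) n) \<and>
          (\<exists>n. real_of_int n \<le> x \<and> isolating_pattern (R \<omega>) (B \<omega>) n)"
        using r l by (meson order_trans)
    qed
  qed
qed

lemma AE_points: "AE \<omega> in P. points (R \<omega>) (B \<omega>)"
  using AE_locally_finite_points[OF poissonR] AE_locally_finite_points[OF poissonB] AE_disjoint
  by eventually_elim (rule points.intro)

end

section \<open>The bracket matching as a factor\<close>

text \<open>Edges have a countable index, but different indices may name the same edge. That at
  least \<open>m\<close> edges lie in \<open>A\<close> is therefore expressed by \<open>m\<close>
  indices with pairwise different edges; exactly \<open>n\<close> means at least \<open>n\<close>
  but not at least \<open>n + 1\<close>.\<close>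

lemma measurable_point_config_edges:
  fixes u v :: "'k::countable \<Rightarrow> 'w \<Rightarrow> real" and F :: "'w \<Rightarrow> edge set"
  assumes T [measurable]: "\<And>k. Measurable.pred N (T k)"
    and u [measurable]: "\<And>k. u k \<in> borel_measurable N" and v [measurable]: "\<And>k. v k \<in> borel_measurable N"
    and F: "\<And>\<omega>. \<omega> \<in> space N \<Longrightarrow> F \<omega> = {(u k \<omega>, v k \<omega>) | k. T k \<omega>}"
  shows "F \<in> N \<rightarrow>\<^sub>M point_config"
proof (rule measurable_point_configI)
  fix A :: "edge set" and n assume A: "A \<in> sets borel"
  have uv: "(\<lambda>\<omega>. (u k \<omega>, v k \<omega>)) \<in> N \<rightarrow>\<^sub>M borel" for k
    unfolding borel_prod[symmetric] by measurable
  have inA: "Measurable.pred N (\<lambda>\<omega>. (u k \<omega>, v k \<omega>) \<in> A)" for k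
    using measurable_sets[OF uv A, of k] unfolding pred_def by (simp add: vimage_def Int_def conj_commute)
  define Q where "Q m \<omega> \<longleftrightarrow> (\<exists>ks\<in>{ks. distinct ks \<and> length ks = m}. (\<forall>k\<in>set ks. T k \<omega> \<and> (u k \<omega>, v k \<omega>) \<in> A) \<and>
      (\<forall>j\<in>set ks. \<forall>k\<in>set ks. j = k \<or> u j \<omega> \<noteq> u k \<omega> \<or> v j \<omega> \<noteq> v k \<omega>))" for m \<omega>
  have Q_meas [measurable]: "Measurable.pred N (Q m)" for m
  proof -
    note [measurable] = inA
    have "Measurable.pred N (\<lambda>\<omega>. j = k \<or> u j \<omega> \<noteq> u k \<omega> \<or> v j \<omega> \<noteq> v k \<omega>)" for j k
      by measurable
    then have pred: "Measurable.pred N (\<lambda>\<omega>. (\<forall>k\<in>set ks. T k \<omega> \<and> (u k \<omega>, v k \<omega>) \<in> A) \<and>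
      (\<forall>j\<in>set ks. \<forall>k\<in>set ks. j = k \<or> u j \<omega> \<noteq> u k \<omega> \<or> v j \<omega> \<noteq> v k \<omega>))" for ks
      using T inA by (intro pred_intros_logic(3) pred_intros_finite(3) finite_set)
    have "Q m = (\<lambda>\<omega>. \<exists>ks\<in>{ks. distinct ks \<and> length ks = m}. (\<forall>k\<in>set ks. T k \<omega> \<and> (u k \<omega>, v k \<omega>) \<in> A) \<and>
      (\<forall>j\<in>set ks. \<forall>k\<in>set ks. j = k \<or> u j \<omega> \<noteq> u k \<omega> \<or> v j \<omega> \<noteq> v k \<omega>))"
      by (rule ext) (rule Q_def)
    then show ?thesis by (simp only:) (rule pred_intros_countable_bounded(4), rule pred)
  qed
  have Q_iff: "Q m \<omega> \<longleftrightarrow> (\<exists>G\<subseteq>F \<omega> \<inter> A. finite G \<and> card G = m)" if \<omega>: "\<omega> \<in> space N" for m \<omega>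
  proof
    assume "Q m \<omega>"
    then obtain ks where ks: "distinct ks" "length ks = m" "\<forall>k\<in>set ks. T k \<omega> \<and> (u k \<omega>, v k \<omega>) \<in> A"
      "\<forall>j\<in>set ks. \<forall>k\<in>set ks. j = k \<or> u j \<omega> \<noteq> u k \<omega> \<or> v j \<omega> \<noteq> v k \<omega>"
      unfolding Q_def by (elim bexE CollectE conjE)
    define K where "K = set ks"
    have K: "finite K" "card K = m" "\<forall>k\<in>K. T k \<omega> \<and> (u k \<omega>, v k \<omega>) \<in> A"
      "\<forall>j\<in>K. \<forall>k\<in>K. j = k \<or> u j \<omega> \<noteq> u k \<omega> \<or> v j \<omega> \<noteq> v k \<omega>"
      using ks distinct_card[OF ks(1)] unfolding K_def by auto
    have "inj_on (\<lambda>k. (u k \<omega>, v k \<omega>)) K" unfolding inj_on_def using K(4) by blast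
    then have "card ((\<lambda>k. (u k \<omega>, v k \<omega>)) ` K) = m" using K(2) card_image by blast
    moreover have "(\<lambda>k. (u k \<omega>, v k \<omega>)) ` K \<subseteq> F \<omega> \<inter> A" using K(3) F[OF \<omega>] by blast
    ultimately show "\<exists>G\<subseteq>F \<omega> \<inter> A. finite G \<and> card G = m" using K(1) by blast
  next
    assume "\<exists>G\<subseteq>F \<omega> \<inter> A. finite G \<and> card G = m"
    then obtain G where G: "G \<subseteq> F \<omega> \<inter> A" "finite G" "card G = m" by blast
    have "\<forall>e\<in>G. \<exists>k. e = (u k \<omega>, v k \<omega>) \<and> T k \<omega>" using G(1) F[OF \<omega>] by blast
    then obtain g where g: "\<And>e. e \<in> G \<Longrightarrow> e = (u (g e) \<omega>, v (g e) \<omega>) \<and> T (g e) \<omega>" by metis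
    have "inj_on g G" unfolding inj_on_def using g by metis
    then have "card (g ` G) = m" using G(3) card_image by blast
    moreover have "\<forall>k\<in>g ` G. T k \<omega> \<and> (u k \<omega>, v k \<omega>) \<in> A"
      using g G(1) by (metis IntD2 imageE subsetD)
    moreover have "\<forall>j\<in>g ` G. \<forall>k\<in>g ` G. j = k \<or> u j \<omega> \<noteq> u k \<omega> \<or> v j \<omega> \<noteq> v k \<omega>"
      using g by (metis imageE)
    moreover obtain ks where "set ks = g ` G" "distinct ks"
      using finite_distinct_list[of "g ` G"] G(2) by auto
    ultimately show "Q m \<omega>"
      unfolding Q_def using distinct_card[of ks] by (intro bexI[of _ ks]) auto
  qed
  have "finite (F \<omega> \<inter> A) \<and> card (F \<omega> \<inter> A) = n \<longleftrightarrow> Q n \<omega> \<and> \<not> Q (Suc n) \<omega>" if \<omega>: "\<omega> \<in> space N" for \<omega>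
    unfolding Q_iff[OF \<omega>]
  proof safe
    assume "finite (F \<omega> \<inter> A)" "n = card (F \<omega> \<inter> A)"
    then show "\<exists>G\<subseteq>F \<omega> \<inter> A. finite G \<and> card G = card (F \<omega> \<inter> A)" by blast
  next
    fix G assume "finite (F \<omega> \<inter> A)" "G \<subseteq> F \<omega> \<inter> A" "card G = Suc (card (F \<omega> \<inter> A))"
    then show False using card_mono[of "F \<omega> \<inter> A" G] by simp
  next
    fix G assume G: "\<not> (\<exists>G'\<subseteq>F \<omega> \<inter> A. finite G' \<and> card G' = Suc (card G))" "finite G" "G \<subseteq> F \<omega> \<inter> A"
    show fin: "finite (F \<omega> \<inter> A)"
    proof (rule ccontr)
      assume "infinite (F \<omega> \<inter> A)"
      from infinite_arbitrarily_large[OF this, of "Suc (card G)"]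
      obtain G' where "finite G'" "card G' = Suc (card G)" "G' \<subseteq> F \<omega> \<inter> A" by (elim exE conjE)
      then show False using G(1) by (elim notE) (intro exI conjI)
    qed
    show "card (F \<omega> \<inter> A) = card G"
    proof (rule ccontr)
      assume "card (F \<omega> \<inter> A) \<noteq> card G"
      then have "Suc (card G) \<le> card (F \<omega> \<inter> A)" using card_mono[OF fin G(3)] by simp
      then obtain G' where "G' \<subseteq> F \<omega> \<inter> A" "card G' = Suc (card G)" "finite G'"
        by (rule obtain_subset_with_card_n)
      then show False using G(1) by (elim notE) (intro exI conjI)
    qed
  qed
  then have "{\<omega> \<in> space N. finite (F \<omega> \<inter> A) \<and> card (F \<omega> \<inter> A) = n} = {\<omega> \<in> space N. Q n \<omega> \<and> \<not> Q (Suc n) \<omega>}"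
    by blast
  also have "\<dots> \<in> sets N" by measurable
  finally show "{\<omega> \<in> space N. finite (F \<omega> \<inter> A) \<and> card (F \<omega> \<inter> A) = n} \<in> sets N" .
qed

text \<open>Reads off a point isolated by \<open>I\<close>; the default 0 keeps the function total
  and measurable.\<close>

definition unique_point :: "real set \<Rightarrow> real set \<Rightarrow> real" where
  "unique_point I X = (if card (X \<inter> I) = 1 then the_elem (X \<inter> I) else 0)"

lemma measurable_unique_point [measurable]:
  assumes I [measurable]: "I \<in> sets borel"
  shows "unique_point I \<in> borel_measurable point_config"
proof (rule measurableI)
  fix A :: "real set" assume A [measurable]: "A \<in> sets borel"
  \<comment> \<open>A unique point of \<open>I\<close> lies in \<open>A\<close> exactly when cutting
    \<open>I\<close> down to \<open>A\<close> keeps the count at 1, so counts alone decide.\<close>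
  have "unique_point I X \<in> A \<longleftrightarrow> (card (X \<inter> I) = 1 \<and> card (X \<inter> (I \<inter> A)) = 1) \<or> (card (X \<inter> I) \<noteq> 1 \<and> 0 \<in> A)" for X
  proof (cases "card (X \<inter> I) = 1")
    case True
    then obtain x where x: "X \<inter> I = {x}" by (rule card_1_singletonE)
    then have "X \<inter> (I \<inter> A) = (if x \<in> A then {x} else {})" by auto
    then show ?thesis using True x unfolding unique_point_def by auto
  qed (auto simp: unique_point_def)
  then have "unique_point I -` A \<inter> space point_config =
     {X \<in> space point_config. (card (X \<inter> I) = 1 \<and> card (X \<inter> (I \<inter> A)) = 1) \<or> (card (X \<inter> I) \<noteq> 1 \<and> 0 \<in> A)}"
    by auto
  also have "\<dots> \<in> sets point_config" by measurable
  finally show "unique_point I -` A \<inter> space point_config \<in> sets point_config" .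
qed simp

lemma measurable_locally_finite_points [measurable]: "Measurable.pred point_config locally_finite_points"
  unfolding locally_finite_points_iff[abs_def] by measurable

text \<open>The intervals \<open>(p, p')\<close> and \<open>(q, q')\<close> isolate the endpoints of an edge of the bracket matching.
  Only counts in countably many intervals occur, which makes the condition measurable.\<close>

definition bracket_box :: "real set \<Rightarrow> real set \<Rightarrow> rat \<times> rat \<times> rat \<times> rat \<Rightarrow> bool" where
  "bracket_box R B = (\<lambda>(p, p', q, q').
     locally_finite_points R \<and> locally_finite_points B \<and> p' \<le> q \<and>
     card (R \<inter> {real_of_rat p<..<real_of_rat p'}) = 1 \<and> card (B \<inter> {real_of_rat p<..<real_of_rat p'}) = 0 \<and>
     card (R \<inter> {real_of_rat q<..<real_of_rat q'}) = 0 \<and> card (B \<inter> {real_of_rat q<..<real_of_rat q'}) = 1 \<and>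
     (\<forall>s. p' \<le> s \<longrightarrow> s \<le> q \<longrightarrow>
        card (B \<inter> {real_of_rat p<..real_of_rat s}) < card (R \<inter> {real_of_rat p<..real_of_rat s})) \<and>
     card (R \<inter> {real_of_rat p<..real_of_rat q}) = card (B \<inter> {real_of_rat p<..real_of_rat q}) + 1)"

lemma points_isolated:
  assumes "locally_finite_points X"
  obtains e where "e > 0" "X \<inter> {x - e<..<x + e} \<subseteq> {x}"
proof -
  let ?F = "X \<inter> {x - 1..x + 1} - {x}"
  have fin: "finite ?F" using locally_finite_pointsD(1)[OF assms] by auto
  define e where "e = Min (insert 1 ((\<lambda>y. \<bar>y - x\<bar>) ` ?F))"
  have "e > 0" unfolding e_def using fin by auto
  moreover have "y = x" if y: "y \<in> X" "x - e < y" "y < x + e" for y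
  proof (rule ccontr)
    assume "y \<noteq> x"
    have "e \<le> 1" unfolding e_def using fin by simp
    then have "y \<in> ?F" using y \<open>y \<noteq> x\<close> by auto
    then have "e \<le> \<bar>y - x\<bar>" unfolding e_def using fin by (intro Min_le) auto
    then show False using y by auto
  qed
  then have "X \<inter> {x - e<..<x + e} \<subseteq> {x}" by auto
  ultimately show ?thesis by (rule that)
qed

text \<open>No point precedes the isolated red one in its interval, so counts from \<open>p\<close>
  are counts from that point, and the box conditions become bracket conditions. Rational times
  suffice because a count does not change immediately after a given time.\<close>

lemma bracket_box_matching:
  assumes k: "bracket_box R B (p, p', q, q')"
  shows "(unique_point {real_of_rat p<..<real_of_rat p'} R, unique_point {real_of_rat q<..<real_of_rat q'} B)
    \<in> bracket_matching R B"
proof -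
  let ?p = "real_of_rat p" and ?p' = "real_of_rat p'" and ?q = "real_of_rat q" and ?q' = "real_of_rat q'"
  have lf: "locally_finite_points R" "locally_finite_points B" and pq: "?p' \<le> ?q"
    and c: "card (R \<inter> {?p<..<?p'}) = 1" "card (B \<inter> {?p<..<?p'}) = 0"
      "card (R \<inter> {?q<..<?q'}) = 0" "card (B \<inter> {?q<..<?q'}) = 1"
    and s: "\<And>s. p' \<le> s \<Longrightarrow> s \<le> q \<Longrightarrow> card (B \<inter> {?p<..real_of_rat s}) < card (R \<inter> {?p<..real_of_rat s})"
    and eq: "card (R \<inter> {?p<..?q}) = card (B \<inter> {?p<..?q}) + 1"
    using k unfolding bracket_box_def by (auto simp: of_rat_less_eq)
  obtain r where r: "R \<inter> {?p<..<?p'} = {r}" using c(1) by (rule card_1_singletonE)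
  obtain b where b: "B \<inter> {?q<..<?q'} = {b}" using c(4) by (rule card_1_singletonE)
  have Bp: "B \<inter> {?p<..<?p'} = {}" and Rq: "R \<inter> {?q<..<?q'} = {}"
    using c(2,3) locally_finite_pointsD(4)[OF lf(1)] locally_finite_pointsD(4)[OF lf(2)]
    by (simp_all add: card_eq_0_iff)
  have up: "unique_point {?p<..<?p'} R = r" "unique_point {?q<..<?q'} B = b"
    unfolding unique_point_def using r b c by simp_all
  have r': "r \<in> R" "?p < r" "r < ?p'" and b': "b \<in> B" "?q < b" "b < ?q'"
    using equalityD2[OF r] equalityD2[OF b] by simp_all
  have rB: "r \<notin> B" and bR: "b \<notin> R" using Bp Rq r' b' by auto
  have rb: "r < b" using r' b' pq by simp
  have Rr: "R \<inter> {r..t} = R \<inter> {?p<..t}" and Br: "B \<inter> {r..t} = B \<inter> {?p<..t}" if "?p' \<le> t" for t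
  proof -
    have "y = r" if "y \<in> R" "?p < y" "y < r" for y
      using r that r' by (metis IntI greaterThanLessThan_iff order_less_trans singletonD)
    then show "R \<inter> {r..t} = R \<inter> {?p<..t}" using r' by force
    have "\<not> y < r" if "y \<in> B" "?p < y" for y
      using Bp that r' by (metis IntI empty_iff greaterThanLessThan_iff order_less_trans)
    then show "B \<inter> {r..t} = B \<inter> {?p<..t}" using r' by force
  qed
  have mid: "card (B \<inter> {?p<..t}) < card (R \<inter> {?p<..t})" if t: "?p' \<le> t" "t \<le> ?q" for t
  proof (cases "t = ?q")
    case True
    then show ?thesis using eq by simp
  next
    case False
    \<comment> \<open>\<open>Min ?F\<close> is the next point after \<open>t\<close>, or
      \<open>q\<close> if there is none up to \<open>q\<close>; a rational \<open>s'\<close>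
      strictly between has the same counts as \<open>t\<close>. At \<open>t = q\<close> the
      prescribed balance was used instead.\<close>
    let ?F = "insert ?q ((R \<union> B) \<inter> {t<..?q})"
    have fin: "finite ?F"
      using locally_finite_pointsD(2)[OF lf(1)] locally_finite_pointsD(2)[OF lf(2)] by (simp add: Int_Un_distrib2)
    have "t < Min ?F" using fin False t by auto
    then obtain s' where s': "t < real_of_rat s'" "real_of_rat s' < Min ?F" using of_rat_dense by blast
    have no: "\<not> (t < y \<and> y \<le> real_of_rat s')" if "y \<in> R \<union> B" for y
    proof
      assume y: "t < y \<and> y \<le> real_of_rat s'"
      moreover have "Min ?F \<le> ?q" using fin by simp
      ultimately have "y \<in> ?F" using that s' by auto
      then have "Min ?F \<le> y" using fin by (rule Min_le[rotated])
      then show False using y s' by simp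
    qed
    have "B \<inter> {?p<..t} = B \<inter> {?p<..real_of_rat s'}" "R \<inter> {?p<..t} = R \<inter> {?p<..real_of_rat s'}"
      using no s' by force+
    moreover have "Min ?F \<le> ?q" using fin by simp
    then have "p' \<le> s'" "s' \<le> q" using s' t by (simp_all add: of_rat_less_eq[where 'a=real, symmetric])
    ultimately show ?thesis using s[of s'] by simp
  qed
  have before: "card (B \<inter> {r..t}) < card (R \<inter> {r..t})" if t: "r \<le> t" "t < b" for t
  proof -
    consider "t < ?p'" | "?p' \<le> t" "t \<le> ?q" | "?q < t" by linarith
    then show ?thesis
    proof cases
      case 1
      then have "B \<inter> {r..t} = {}" using Bp r' by force
      moreover have "r \<in> R \<inter> {r..t}" using r' t by simp
      then have "0 < card (R \<inter> {r..t})" using locally_finite_pointsD(1)[OF lf(1)] card_gt_0_iff by blast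
      ultimately show ?thesis by simp
    next
      case 2
      then show ?thesis using mid Rr Br by simp
    next
      case 3
      \<comment> \<open>Between \<open>q\<close> and \<open>b\<close> nothing happens: the second
        interval contains no red point and no blue point other than \<open>b\<close>.\<close>
      have "R \<inter> {?p<..t} = R \<inter> {?p<..?q}" using Rq t b' 3 by force
      moreover have "y = b" if "y \<in> B" "?q < y" "y \<le> t" for y
        using b that t b' by (metis IntI greaterThanLessThan_iff order_le_less_trans order_less_trans singletonD)
      then have "B \<inter> {?p<..t} = B \<inter> {?p<..?q}" using t 3 by force
      ultimately show ?thesis using eq Rr[of t] Br[of t] pq 3 by simp
    qed
  qed
  have "R \<inter> {?p<..b} = R \<inter> {?p<..?q}" using Rq b' by force
  moreover have "y = b" if "y \<in> B" "?q < y" "y \<le> b" for y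
    using b that b' by (metis IntI greaterThanLessThan_iff order_le_less_trans singletonD)
  then have "B \<inter> {?p<..b} = insert b (B \<inter> {?p<..?q})" using b' pq r' by force
  moreover have "b \<notin> B \<inter> {?p<..?q}" using b' by simp
  ultimately have "card (R \<inter> {r..b}) = card (B \<inter> {r..b})"
    using eq Rr[of b] Br[of b] pq b' locally_finite_pointsD(2)[OF lf(2)] by simp
  then show ?thesis unfolding up bracket_matching_def using r' b' rB bR rb before by simp
qed

lemma bracket_matching_box:
  assumes lf: "locally_finite_points R" "locally_finite_points B" and e: "(r, b) \<in> bracket_matching R B"
  obtains p p' q q' where "bracket_box R B (p, p', q, q')"
    "unique_point {real_of_rat p<..<real_of_rat p'} R = r"
    "unique_point {real_of_rat q<..<real_of_rat q'} B = b"
proof -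
  have rb: "r \<in> R" "r \<notin> B" "b \<in> B" "b \<notin> R" "r < b" and eq: "card (R \<inter> {r..b}) = card (B \<inter> {r..b})"
    and before: "\<And>t. r \<le> t \<Longrightarrow> t < b \<Longrightarrow> card (B \<inter> {r..t}) < card (R \<inter> {r..t})"
    using e unfolding bracket_matching_def by auto
  have lfU: "locally_finite_points (R \<union> B)"
    using lf unfolding locally_finite_points_def by (simp add: Int_Un_distrib2)
  obtain e1 where e1: "e1 > 0" "(R \<union> B) \<inter> {r - e1<..<r + e1} \<subseteq> {r}" using points_isolated[OF lfU] .
  obtain e2 where e2: "e2 > 0" "(R \<union> B) \<inter> {b - e2<..<b + e2} \<subseteq> {b}" using points_isolated[OF lfU] .
  \<comment> \<open>At most half the distance from \<open>r\<close> to \<open>b\<close>, so that the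
    two isolating intervals stay in order and \<open>p' \<le> q\<close> holds.\<close>
  define e where "e = min (min e1 e2) ((b - r) / 2)"
  have e: "e > 0" "e \<le> e1" "e \<le> e2" "r + e \<le> b - e"
  proof -
    have "e \<le> (b - r) / 2" unfolding e_def by (rule min.cobounded2)
    then show "r + e \<le> b - e" by (simp add: field_simps)
  qed (use e1 e2 rb(5) in \<open>auto simp: e_def\<close>)
  obtain p where p: "r - e < real_of_rat p" "real_of_rat p < r" using of_rat_dense[of "r - e" r] e by auto
  obtain p' where p': "r < real_of_rat p'" "real_of_rat p' < r + e" using of_rat_dense[of r "r + e"] e by auto
  obtain q where q: "b - e < real_of_rat q" "real_of_rat q < b" using of_rat_dense[of "b - e" b] e by auto
  obtain q' where q': "b < real_of_rat q'" "real_of_rat q' < b + e" using of_rat_dense[of b "b + e"] e by auto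
  let ?p = "real_of_rat p" and ?p' = "real_of_rat p'" and ?q = "real_of_rat q" and ?q' = "real_of_rat q'"
  have near_r: "y = r" if "y \<in> R \<union> B" "?p < y" "y < ?p'" for y
  proof -
    have "y \<in> (R \<union> B) \<inter> {r - e1<..<r + e1}" using that p p' e by auto
    then show ?thesis using e1(2) by blast
  qed
  have near_b: "y = b" if "y \<in> R \<union> B" "?q < y" "y < ?q'" for y
  proof -
    have "y \<in> (R \<union> B) \<inter> {b - e2<..<b + e2}" using that q q' e by auto
    then show ?thesis using e2(2) by blast
  qed
  have Rp: "R \<inter> {?p<..<?p'} = {r}"
  proof (rule set_eqI)
    show "z \<in> R \<inter> {?p<..<?p'} \<longleftrightarrow> z \<in> {r}" for z
      using near_r[of z] p p' rb(1) by auto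
  qed
  have Bp: "B \<inter> {?p<..<?p'} = {}"
  proof (rule set_eqI)
    show "z \<in> B \<inter> {?p<..<?p'} \<longleftrightarrow> z \<in> {}" for z
      using near_r[of z] rb(2) by auto
  qed
  have Bq: "B \<inter> {?q<..<?q'} = {b}"
  proof (rule set_eqI)
    show "z \<in> B \<inter> {?q<..<?q'} \<longleftrightarrow> z \<in> {b}" for z
      using near_b[of z] q q' rb(3) by auto
  qed
  have Rq: "R \<inter> {?q<..<?q'} = {}"
  proof (rule set_eqI)
    show "z \<in> R \<inter> {?q<..<?q'} \<longleftrightarrow> z \<in> {}" for z
      using near_b[of z] rb(4) by auto
  qed
  have pq: "?p' \<le> ?q" using p' q e by simp
  \<comment> \<open>No point lies between \<open>p\<close> and \<open>r\<close>, so counting may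
    start at either.\<close>
  have eqs: "R \<inter> {?p<..t} = R \<inter> {r..t}" "B \<inter> {?p<..t} = B \<inter> {r..t}" for t
  proof -
    have "r \<le> y" if "y \<in> R \<union> B" "?p < y" for y
      using near_r[OF that] p' by (cases "y < ?p'") auto
    then show "R \<inter> {?p<..t} = R \<inter> {r..t}" "B \<inter> {?p<..t} = B \<inter> {r..t}" using p by force+
  qed
  have "card (R \<inter> {r..?q}) = card (R \<inter> {r..b})"
  proof -
    have "y \<le> ?q" if "y \<in> R" "y \<le> b" for y
      using near_b[of y] that rb(4) q' by (cases "y = b") (auto simp: not_le[symmetric])
    then have "R \<inter> {r..?q} = R \<inter> {r..b}" using q by force
    then show ?thesis by simp
  qed
  moreover have "card (B \<inter> {r..b}) = card (B \<inter> {r..?q}) + 1"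
  proof -
    have "y \<le> ?q" if "y \<in> B" "y \<le> b" "y \<noteq> b" for y
      using near_b[of y] that q' by (auto simp: not_le[symmetric])
    then have "B \<inter> {r..b} = insert b (B \<inter> {r..?q})" using q rb by force
    then show ?thesis using q locally_finite_pointsD(1)[OF lf(2)] by simp
  qed
  ultimately have "bracket_box R B (p, p', q, q')"
    unfolding bracket_box_def
    using lf pq Rp Bp Bq Rq eq p p' q by (auto simp: eqs of_rat_less_eq[where 'a=real, symmetric] intro!: before)
  moreover have "unique_point {?p<..<?p'} R = r" "unique_point {?q<..<?q'} B = b"
    unfolding unique_point_def Rp Bq by simp_all
  ultimately show thesis by (rule that)
qed

text \<open>The guard matches the one inside \<open>bracket_box\<close>, so the box description
  holds for every pair of configurations and measurability needs no exceptional set.\<close>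

definition bracket_map :: "real set \<times> real set \<Rightarrow> edge set" where
  "bracket_map = (\<lambda>(R, B). if locally_finite_points R \<and> locally_finite_points B then bracket_matching R B else {})"

lemma measurable_bracket_map [measurable]: "bracket_map \<in> point_config \<Otimes>\<^sub>M point_config \<rightarrow>\<^sub>M point_config"
proof (rule measurable_point_config_edges[where T="\<lambda>k \<omega>. bracket_box (fst \<omega>) (snd \<omega>) k" and
    u="\<lambda>(p, p', q, q') \<omega>. unique_point {real_of_rat p<..<real_of_rat p'} (fst \<omega>)" and
    v="\<lambda>(p, p', q, q') \<omega>. unique_point {real_of_rat q<..<real_of_rat q'} (snd \<omega>)"])
  fix k :: "rat \<times> rat \<times> rat \<times> rat"
  obtain p p' q q' where k: "k = (p, p', q, q')" by (metis prod_cases4)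
  let ?N = "point_config \<Otimes>\<^sub>M point_config :: (real set \<times> real set) measure"
  have cR [measurable]: "(\<lambda>\<omega>. card (fst \<omega> \<inter> I)) \<in> ?N \<rightarrow>\<^sub>M count_space UNIV"
    and cB [measurable]: "(\<lambda>\<omega>. card (snd \<omega> \<inter> I)) \<in> ?N \<rightarrow>\<^sub>M count_space UNIV" if "I \<in> sets borel" for I
    using measurable_compose[OF measurable_fst measurable_card_count[OF that]]
      measurable_compose[OF measurable_snd measurable_card_count[OF that]] by auto
  have cards: "Measurable.pred ?N (\<lambda>\<omega>. Q (card (fst \<omega> \<inter> I)) (card (snd \<omega> \<inter> I)))"
    if I: "I \<in> sets borel" for I Q
  proof -
    have "(\<lambda>\<omega>. (card (fst \<omega> \<inter> I), card (snd \<omega> \<inter> I))) \<in> ?N \<rightarrow>\<^sub>M count_space UNIV"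
      using measurable_Pair[OF cR[OF I] cB[OF I]] by (simp add: pair_measure_countable)
    from measurable_compose[OF this, of "\<lambda>(a, b). Q a b" "count_space UNIV"] show ?thesis by simp
  qed
  have eq: "Measurable.pred ?N (\<lambda>\<omega>. card (fst \<omega> \<inter> I) = n)" "Measurable.pred ?N (\<lambda>\<omega>. card (snd \<omega> \<inter> I) = n)"
    and less: "Measurable.pred ?N (\<lambda>\<omega>. card (snd \<omega> \<inter> I) < card (fst \<omega> \<inter> I))"
    and succ: "Measurable.pred ?N (\<lambda>\<omega>. card (fst \<omega> \<inter> I) = card (snd \<omega> \<inter> I) + 1)"
    if "I \<in> sets borel" for I n
    using cards[OF that, of "\<lambda>a b. a = n"] cards[OF that, of "\<lambda>a b. b = n"]
      cards[OF that, of "\<lambda>a b. b < a"] cards[OF that, of "\<lambda>a b. a = b + 1"] by simp_all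
  have lf: "Measurable.pred ?N (\<lambda>\<omega>. locally_finite_points (fst \<omega>))" "Measurable.pred ?N (\<lambda>\<omega>. locally_finite_points (snd \<omega>))"
    by measurable
  show "Measurable.pred ?N (\<lambda>\<omega>. bracket_box (fst \<omega>) (snd \<omega>) k)"
    unfolding k bracket_box_def prod.case
    by (intro pred_intros_logic(3,4) pred_intros_countable(1) measurable_const lf eq less succ) simp_all
  show "(case k of (p, p', q, q') \<Rightarrow> \<lambda>\<omega>. unique_point {real_of_rat p<..<real_of_rat p'} (fst \<omega>))
    \<in> borel_measurable (point_config \<Otimes>\<^sub>M point_config)"
    unfolding k prod.case by measurable
  show "(case k of (p, p', q, q') \<Rightarrow> \<lambda>\<omega>. unique_point {real_of_rat q<..<real_of_rat q'} (snd \<omega>))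
    \<in> borel_measurable (point_config \<Otimes>\<^sub>M point_config)"
    unfolding k prod.case by measurable
next
  fix \<omega> :: "real set \<times> real set"
  obtain R B where \<omega>: "\<omega> = (R, B)" by (cases \<omega>)
  show "bracket_map \<omega> =
     {((case k of (p, p', q, q') \<Rightarrow> \<lambda>\<omega>. unique_point {real_of_rat p<..<real_of_rat p'} (fst \<omega>)) \<omega>,
       (case k of (p, p', q, q') \<Rightarrow> \<lambda>\<omega>. unique_point {real_of_rat q<..<real_of_rat q'} (snd \<omega>)) \<omega>) | k.
      bracket_box (fst \<omega>) (snd \<omega>) k}" (is "_ = ?S")
  proof (cases "locally_finite_points R \<and> locally_finite_points B")
    case True
    show ?thesis
    proof
      show "bracket_map \<omega> \<subseteq> ?S"
      proof
        fix e assume "e \<in> bracket_map \<omega>"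
        then have "(fst e, snd e) \<in> bracket_matching R B" unfolding \<omega> bracket_map_def by (simp split: if_splits)
        then obtain p p' q q' where "bracket_box R B (p, p', q, q')"
          "unique_point {real_of_rat p<..<real_of_rat p'} R = fst e"
          "unique_point {real_of_rat q<..<real_of_rat q'} B = snd e"
          using bracket_matching_box True by metis
        then show "e \<in> ?S" unfolding \<omega> by (intro CollectI exI[of _ "(p, p', q, q')"]) simp
      qed
      show "?S \<subseteq> bracket_map \<omega>"
        unfolding \<omega> bracket_map_def using True bracket_box_matching by auto
    qed
  next
    case False
    then show ?thesis unfolding \<omega> bracket_map_def bracket_box_def by auto
  qed
qed

section \<open>Translations of configurations and invariance in law\<close>

lemma shift_points_Int: "shift_points t X \<inter> A = shift_points t (X \<inter> (\<lambda>x. x + t) -` A)"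
  unfolding shift_points_def by auto

lemma inj_on_add_real: "inj_on (\<lambda>x::real. x + t) X"
  by (auto simp: inj_on_def)

lemma finite_shift_points [simp]: "finite (shift_points t X) \<longleftrightarrow> finite X"
  unfolding shift_points_def by (rule finite_image_iff[OF inj_on_add_real])

lemma card_shift_points [simp]: "card (shift_points t X) = card X"
  unfolding shift_points_def by (rule card_image[OF inj_on_add_real])

lemma vimage_add_borel: "A \<in> sets borel \<Longrightarrow> (\<lambda>x::real. x + t) -` A \<in> sets borel"
  using measurable_sets[of "\<lambda>x::real. x + t" borel borel A] by simp

lemma emeasure_vimage_add: "A \<in> sets borel \<Longrightarrow> emeasure lborel ((\<lambda>x::real. x + t) -` A) = emeasure lborel A"
proof -
  assume A: "A \<in> sets borel"
  have "(\<lambda>x::real. x + t) = (+) t" by (auto simp: add.commute)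
  then show ?thesis
    using emeasure_distr[of "(+) t" lborel borel A] lborel_distr_plus[of t] A by simp
qed

lemma measurable_shift_points [measurable]: "shift_points t \<in> point_config \<rightarrow>\<^sub>M point_config"
  by (rule measurable_point_configI) (auto simp: shift_points_Int intro!: sets_point_config vimage_add_borel)

text \<open>Counts of the shifted process in \<open>A\<close> are counts of the original one in a
  translate of \<open>A\<close>, and Lebesgue measure is translation invariant.\<close>

lemma poisson_process_shift:
  assumes X: "poisson_process P l X"
  shows "poisson_process P l (\<lambda>\<omega>. shift_points t (X \<omega>))"
  unfolding poisson_process_def
proof (intro conjI ballI impI allI)
  show "(\<lambda>\<omega>. shift_points t (X \<omega>)) \<in> P \<rightarrow>\<^sub>M point_config"
    using poisson_processD(1)[OF X] by measurable
  show "measure P {\<omega> \<in> space P. finite (shift_points t (X \<omega>) \<inter> A) \<and> card (shift_points t (X \<omega>) \<inter> A) = n} =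
      (l * measure lborel A) ^ n / fact n * exp (- (l * measure lborel A))"
    if "A \<in> sets borel" "emeasure lborel A < \<infinity>" for A n
    using poisson_processD(2)[OF X vimage_add_borel[OF that(1)], of t n] that emeasure_vimage_add[OF that(1), of t]
    by (simp add: shift_points_Int measure_def)
  fix I :: "nat set" and A :: "nat \<Rightarrow> real set"
  assume A: "finite I \<and> disjoint_family_on A I \<and> (\<forall>i\<in>I. A i \<in> sets borel \<and> emeasure lborel (A i) < \<infinity>)"
  have "disjoint_family_on (\<lambda>i. (\<lambda>x. x + t) -` A i) I"
    using A unfolding disjoint_family_on_def by blast
  then show "prob_space.indep_vars P (\<lambda>_. count_space UNIV) (\<lambda>i \<omega>. card (shift_points t (X \<omega>) \<inter> A i)) I"
    using poisson_processD(3)[OF X, of I "\<lambda>i. (\<lambda>x. x + t) -` A i"] A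
    by (simp add: shift_points_Int vimage_add_borel emeasure_vimage_add)
qed

lemma locally_finite_points_shift [simp]: "locally_finite_points (shift_points t X) \<longleftrightarrow> locally_finite_points X"
proof -
  have *: "(\<lambda>x::real. x + t) -` {a..b} = {a - t..b - t}" for a b by auto
  have "(\<forall>a b. finite (X \<inter> {a - t..b - t})) \<longleftrightarrow> (\<forall>a b. finite (X \<inter> {a..b}))"
  proof safe
    fix a b assume "\<forall>a b. finite (X \<inter> {a - t..b - t})"
    then have "finite (X \<inter> {a + t - t..b + t - t})" by blast
    then show "finite (X \<inter> {a..b})" by simp
  qed blast
  then show ?thesis unfolding locally_finite_points_def by (simp add: shift_points_Int *)
qed

text \<open>Brackets are defined by order and counts, both of which are compatible with
  translations.\<close>

lemma bracket_matching_shift: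
  "bracket_matching (shift_points t R) (shift_points t B) = shift_matching t (bracket_matching R B)"
proof -
  have mem: "x \<in> shift_points t X \<longleftrightarrow> x - t \<in> X" for x X
    unfolding shift_points_def by (auto intro: rev_image_eqI)
  have mem_edge: "e \<in> shift_matching t M \<longleftrightarrow> (fst e - t, snd e - t) \<in> M" for e M
    unfolding shift_matching_def by (cases e) (force intro: rev_image_eqI)
  have card: "card (shift_points t X \<inter> {a..b}) = card (X \<inter> {a - t..b - t})" for X a b
  proof -
    have "(\<lambda>x::real. x + t) -` {a..b} = {a - t..b - t}" by auto
    then show ?thesis by (simp add: shift_points_Int)
  qed
  have all: "(\<forall>s. r \<le> s \<longrightarrow> s < b \<longrightarrow> Q (s - t)) \<longleftrightarrow> (\<forall>s. r - t \<le> s \<longrightarrow> s < b - t \<longrightarrow> Q s)" for r b Q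
  proof safe
    fix s assume a: "\<forall>s. r \<le> s \<longrightarrow> s < b \<longrightarrow> Q (s - t)" "r - t \<le> s" "s < b - t"
    show "Q s" using a(1)[rule_format, of "s + t"] a(2,3) by simp
  qed auto
  have "e \<in> bracket_matching (shift_points t R) (shift_points t B) \<longleftrightarrow> e \<in> shift_matching t (bracket_matching R B)" for e
    unfolding mem_edge bracket_matching_def
    by (cases e) (simp add: mem card all[of _ _ "\<lambda>s. card (B \<inter> {_..s}) < card (R \<inter> {_..s})"])
  then show ?thesis by blast
qed

lemma bracket_map_shift:
  "bracket_map (shift_points t R, shift_points t B) = shift_matching t (bracket_map (R, B))"
  unfolding bracket_map_def by (simp add: bracket_matching_shift) (simp add: shift_matching_def)

context two_poisson
begin

text \<open>The shifted processes are again independent with the same marginals, which determine the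
  joint law.\<close>

lemma distr_shift:
  "distr P (point_config \<Otimes>\<^sub>M point_config) (\<lambda>\<omega>. (shift_points t (R \<omega>), shift_points t (B \<omega>))) =
   distr P (point_config \<Otimes>\<^sub>M point_config) (\<lambda>\<omega>. (R \<omega>, B \<omega>))"
proof -
  have "indep_var point_config (\<lambda>\<omega>. shift_points t (R \<omega>)) point_config (\<lambda>\<omega>. shift_points t (B \<omega>))"
    using indep_var_compose[OF indep measurable_shift_points measurable_shift_points, of t t] by (simp add: comp_def)
  then show ?thesis
    using indep poisson_process_distr_unique[OF prob_space_P poissonR poisson_process_shift[OF poissonR, of t]]
      poisson_process_distr_unique[OF prob_space_P poissonB poisson_process_shift[OF poissonB, of t]]
    unfolding indep_var_distribution_eq by metis
qed

text \<open>The triple is the image of the pair under a fixed map \<open>g\<close>. By equivariance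
  of \<open>bracket_map\<close> the shifted triple is the image of the shifted pair under the same
  map, so invariance of the law of the pair is enough.\<close>

lemma factor_scheme_bracket_map: "factor_scheme P R B (\<lambda>\<omega>. bracket_map (R \<omega>, B \<omega>))"
  unfolding factor_scheme_def invariant_scheme_def matching_scheme_def
proof (intro conjI allI)
  show "(\<lambda>\<omega>. bracket_map (R \<omega>, B \<omega>)) \<in> P \<rightarrow>\<^sub>M point_config" by measurable
  show "AE \<omega> in P. matching (R \<omega>) (B \<omega>) (bracket_map (R \<omega>, B \<omega>))"
    using AE_points
  proof eventually_elim
    fix \<omega> assume "points (R \<omega>) (B \<omega>)"
    then interpret points "R \<omega>" "B \<omega>" .
    show "matching (R \<omega>) (B \<omega>) (bracket_map (R \<omega>, B \<omega>))"
      unfolding bracket_map_def using lfR lfB bracket_matching_matching by simp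
  qed
  show "\<exists>\<Phi>\<in>point_config \<Otimes>\<^sub>M point_config \<rightarrow>\<^sub>M point_config. AE \<omega> in P. bracket_map (R \<omega>, B \<omega>) = \<Phi> (R \<omega>, B \<omega>)"
    by (rule bexI[of _ bracket_map]) (auto intro: measurable_bracket_map)
  fix t
  define g where "g p = (fst p, snd p, bracket_map p)" for p
  have g: "g \<in> point_config \<Otimes>\<^sub>M point_config \<rightarrow>\<^sub>M point_config \<Otimes>\<^sub>M point_config \<Otimes>\<^sub>M point_config"
    unfolding g_def[abs_def] by measurable
  have *: "distr P (point_config \<Otimes>\<^sub>M point_config \<Otimes>\<^sub>M point_config) (\<lambda>\<omega>. g (X \<omega>, Y \<omega>)) =
      distr (distr P (point_config \<Otimes>\<^sub>M point_config) (\<lambda>\<omega>. (X \<omega>, Y \<omega>))) (point_config \<Otimes>\<^sub>M point_config \<Otimes>\<^sub>M point_config) g"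
    if [measurable]: "X \<in> P \<rightarrow>\<^sub>M point_config" "Y \<in> P \<rightarrow>\<^sub>M point_config" for X Y
    by (subst distr_distr[OF g]) (auto simp: comp_def)
  show "distr P (point_config \<Otimes>\<^sub>M point_config \<Otimes>\<^sub>M point_config)
      (\<lambda>\<omega>. (shift_points t (R \<omega>), shift_points t (B \<omega>), shift_matching t (bracket_map (R \<omega>, B \<omega>)))) =
    distr P (point_config \<Otimes>\<^sub>M point_config \<Otimes>\<^sub>M point_config) (\<lambda>\<omega>. (R \<omega>, B \<omega>, bracket_map (R \<omega>, B \<omega>)))"
    using *[of "\<lambda>\<omega>. shift_points t (R \<omega>)" "\<lambda>\<omega>. shift_points t (B \<omega>)"] *[of R B] distr_shift[of t]
    by (simp add: g_def bracket_map_shift)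
qed

end

theorem theorem1p4:
  fixes P :: "'w measure" and R B :: "'w \<Rightarrow> real set"
  assumes "prob_space P"
    and "poisson_process P 1 R"
    and "poisson_process P 1 B"
    and "prob_space.indep_var P point_config R point_config B"
  shows "(\<exists>M :: real \<Rightarrow> 'w \<Rightarrow> edge set.
            (\<forall>\<gamma><0. factor_scheme P R B (M \<gamma>)) \<and>
            (AE \<omega> in P. \<forall>\<gamma><0.
               {N. gamma_minimal \<gamma> (R \<omega>) (B \<omega>) N} = {M \<gamma> \<omega>} \<and>
               \<not> locally_finite (M \<gamma> \<omega>))) \<and>
         (\<not> scale_invariant_cost (cost 0) \<and>
          (AE \<omega> in P. uncountable {M. gamma_minimal 0 (R \<omega>) (B \<omega>) M \<and>
               \<not> scale_invariant_matching (cost 0) (R \<omega>) (B \<omega>) M})) \<and>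
         (AE \<omega> in P.
            (\<forall>\<gamma>>0. uncountable {M. gamma_minimal \<gamma> (R \<omega>) (B \<omega>) M}) \<and>
            uncountable {M. one_plus_minimal (R \<omega>) (B \<omega>) M} \<and>
            uncountable {M. one_minus_minimal (R \<omega>) (B \<omega>) M})"
proof -
  interpret two_poisson P R B
    using assms by (simp add: two_poisson_def two_poisson_axioms_def)
  \<comment> \<open>The quantifier over \<gamma> stands inside \<open>AE\<close>: both properties of
    the configuration are free of \<gamma>, so a single null set is discarded.\<close>
  have "AE \<omega> in P. \<forall>\<gamma><0. {N. gamma_minimal \<gamma> (R \<omega>) (B \<omega>) N} = {bracket_map (R \<omega>, B \<omega>)} \<and>
      \<not> locally_finite (bracket_map (R \<omega>, B \<omega>))"
    using AE_points AE_recurrent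
  proof eventually_elim
    fix \<omega> assume p: "points (R \<omega>) (B \<omega>)" and rec: "recurrent (R \<omega>) (B \<omega>)"
    interpret points "R \<omega>" "B \<omega>" by fact
    have "bracket_map (R \<omega>, B \<omega>) = bracket_matching (R \<omega>) (B \<omega>)"
      unfolding bracket_map_def using lfR lfB by simp
    then show "\<forall>\<gamma><0. {N. gamma_minimal \<gamma> (R \<omega>) (B \<omega>) N} = {bracket_map (R \<omega>, B \<omega>)} \<and>
        \<not> locally_finite (bracket_map (R \<omega>, B \<omega>))"
      using bracket_minimal[OF rec] gamma_minimal_eq_bracket[OF rec] recurrent_bracket_not_locally_finite[OF rec]
      by auto
  qed
  \<comment> \<open>One matching serves all exponents, hence the witness is a constant
    family.\<close>
  then have "\<exists>M :: real \<Rightarrow> 'w \<Rightarrow> edge set. (\<forall>\<gamma><0. factor_scheme P R B (M \<gamma>)) \<and>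
      (AE \<omega> in P. \<forall>\<gamma><0. {N. gamma_minimal \<gamma> (R \<omega>) (B \<omega>) N} = {M \<gamma> \<omega>} \<and> \<not> locally_finite (M \<gamma> \<omega>))"
    using factor_scheme_bracket_map by (intro exI[of _ "\<lambda>_ \<omega>. bracket_map (R \<omega>, B \<omega>)"]) simp
  moreover have "AE \<omega> in P. uncountable {M. gamma_minimal 0 (R \<omega>) (B \<omega>) M \<and>
      \<not> scale_invariant_matching (cost 0) (R \<omega>) (B \<omega>) M}"
    using AE_points AE_patterned by eventually_elim (rule points.uncountable_minimal_zero)
  moreover have "AE \<omega> in P. (\<forall>\<gamma>>0. uncountable {M. gamma_minimal \<gamma> (R \<omega>) (B \<omega>) M}) \<and>
      uncountable {M. one_plus_minimal (R \<omega>) (B \<omega>) M} \<and> uncountable {M. one_minus_minimal (R \<omega>) (B \<omega>) M}"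
    using AE_points AE_patterned
  proof eventually_elim
    fix \<omega> assume p: "points (R \<omega>) (B \<omega>)" and "patterned (R \<omega>) (B \<omega>)"
    then have "unbounded_points (R \<omega>) (B \<omega>)" by (rule points.patterned_unbounded_points)
    note uncountable = uncountable_minimal_positive[OF points.disj[OF p] this]
    show "(\<forall>\<gamma>>0. uncountable {M. gamma_minimal \<gamma> (R \<omega>) (B \<omega>) M}) \<and>
      uncountable {M. one_plus_minimal (R \<omega>) (B \<omega>) M} \<and> uncountable {M. one_minus_minimal (R \<omega>) (B \<omega>) M}"
      by (intro conjI allI impI uncountable)
  qed
  ultimately show ?thesis using not_scale_invariant_cost_zero by blast
qed

end
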